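(* Let $d\ge 2$, $n\ge 2$ and $k\ge1$ be integers, let $G=G(d,d,n)$ and let $c_{(d,d,n)}=[(1\,2\,\cdots\,n-1)(n);(0,\dots,0,1,-1)]\in G$. For nonnegative integers $r_1,\dots,r_k$ let $b^{(d)}_{r_1,\ldots,r_k}$ be the number of transitive factorizations $u_1\cdots u_k=c_{(d,d,n)}$ with $u_i\in G$ and $\dim\operatorname{fix}(u_i)=r_i$ for all $i$. Then \[ \sum_{r_1,\ldots,r_k\ge0} b^{(d)}_{r_1,\ldots,r_k}x_1^{r_1}\cdots x_k^{r_k}=\frac{|G|^{k-1}}{n^k}\sum_{p_1,\ldots,p_k\ge1}M^n_{p_1,\ldots,p_k}\frac{\mathcal{P}^{(d)}_{p_1}(x_1)}{d^{p_1-1}(p_1-1)!}\cdots\frac{\mathcal{P}^{(d)}_{p_k}(x_k)}{d^{p_k-1}(p_k-1)!}. \]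
   Context: Elements of $G(d,1,n)$ (the $n\times n$ monomial matrices whose nonzero entries are $d$-th roots of unity) are written as pairs $[\pi;a]$ with $\pi\in\mathfrak S_n$ (the underlying permutation) and $a=(a_1,\dots,a_n)\in(\mathbb Z/d\mathbb Z)^n$, with product $[\pi;a][\sigma;b]=[\pi\sigma;\sigma(a)+b]$ where $\sigma(a)=(a_{\sigma(1)},\dots,a_{\sigma(n)})$. The cycles of $[\pi;a]$ are the cycles of $\pi$; the weight of a cycle is the sum in $\mathbb Z/d\mathbb Z$ of the $a_i$ over the entries $i$ of the cycle. $G(d,d,n)$ is the subgroup of elements with $a_1+\cdots+a_n=0$; $|G(d,d,n)|=d^{n-1}n!$. $\operatorname{fix}(w)$ is the fixed subspace of $w$ acting on $\mathbb{C}^n$; its dimension equals the number of weight-$0$ cycles of $w$. The group acts by permutations on the set $X=\{\zeta^ie_j:0\le i<d,1\le j\le n\}$ ($\zeta$ a primitive $d$-th root of unity, $e_j$ standard basis vectors); a factorization $u_1\cdots u_k$ is transitive if the subgroup generated by $u_1,\dots,u_k$ acts transitively on $X$ (for factorizations of $c_{(d,d,n)}$, equivalently the underlying permutations generate a transitive subgroup of $\mathfrak S_n$). Polynomials: $(x-1)^{(d)}_m=\prod_{i=1}^m(x-1-(i-1)d)$; $\mathcal P^{(d)}_0(x)=1$, $\mathcal P^{(d)}_1(x)=x$, and $\mathcal P^{(d)}_m(x)=(x-(m-1)(d-1))\,(x-1)^{(d)}_{m-1}$ for $m>1$. $M^n_{p_1,\ldots,p_k}:=[x_1^{p_1}\cdots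 x_k^{p_k}]\big(\prod_i(1+x_i)-\prod_i x_i\big)^n=\sum_{t}(-1)^t\binom nt\prod_i\binom{n-t}{p_i-t}$. *)

theory Defs
  imports
    Complex_Main
    "HOL-Library.FuncSet"
    "HOL-Library.Function_Algebras"
    "HOL-Library.Poly_Mapping"
    "HOL-Combinatorics.Permutations"
    "HOL-Combinatorics.Cycles"
    "HOL-Algebra.Generated_Groups"
begin

section \<open>The groups $G(d,1,n)$ and $G(d,d,n)$\<close>

text \<open>
  The pair \<open>(\<pi>, a)\<close> stands for $[\pi;a]$. The integers modulo $d$ are represented by
  \<open>{0..<int d}\<close>, and \<open>a\<close> is \<open>undefined\<close> outside \<open>{1..n}\<close>, so that equality of pairs is
  equality of group elements.
\<close>

type_synonym colored_perm = "(nat \<Rightarrow> nat) \<times> (nat \<Rightarrow> int)"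

definition G_d1n :: "nat \<Rightarrow> nat \<Rightarrow> colored_perm monoid" where
  "G_d1n d n =
    \<lparr>carrier = {\<pi>. \<pi> permutes {1..n}} \<times> ({1..n} \<rightarrow>\<^sub>E {0..<int d}),
     mult = (\<lambda>(\<pi>, a) (\<sigma>, b). (\<pi> \<circ> \<sigma>, \<lambda>i\<in>{1..n}. (a (\<sigma> i) + b i) mod int d)),
     one = (id, \<lambda>i\<in>{1..n}. 0)\<rparr>"

definition G_ddn :: "nat \<Rightarrow> nat \<Rightarrow> colored_perm monoid" where
  "G_ddn d n = (G_d1n d n)
     \<lparr>carrier := {(\<pi>, a) \<in> carrier (G_d1n d n). (\<Sum>i=1..n. a i) mod int d = 0}\<rparr>"

definition c_ddn :: "nat \<Rightarrow> nat \<Rightarrow> colored_perm" where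
  "c_ddn d n =
    (cycle_of_list [1..<n],
     \<lambda>i\<in>{1..n}. (if i = n - 1 then 1 else if i = n then -1 else 0) mod int d)"


section \<open>The action on $\mathbb{C}^n$\<close>

text \<open>
  $\mathbb{C}^n$ consists of the functions \<open>nat \<Rightarrow> complex\<close> that vanish outside \<open>{1..n}\<close>.
\<close>

definition Cn :: "nat \<Rightarrow> (nat \<Rightarrow> complex) set" where
  "Cn n = {v. \<forall>i. i \<notin> {1..n} \<longrightarrow> v i = 0}"

definition scaleC :: "complex \<Rightarrow> (nat \<Rightarrow> complex) \<Rightarrow> (nat \<Rightarrow> complex)" where
  "scaleC z v = (\<lambda>i. z * v i)"

lemma vector_space_scaleC: "vector_space scaleC"
  by unfold_locales (auto simp: scaleC_def fun_eq_iff algebra_simps)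

definition prim_root :: "nat \<Rightarrow> complex" where
  "prim_root d = cis (2 * pi / real d)"

text \<open>
  Column \<open>j\<close> of the monomial matrix of $[\pi;a]$ is $\zeta^{a_j} e_{\pi(j)}$; this is the
  convention under which the product of pairs is the product of matrices.
\<close>

definition monomial_entry :: "nat \<Rightarrow> colored_perm \<Rightarrow> nat \<Rightarrow> nat \<Rightarrow> complex" where
  "monomial_entry d w i j = (if i = fst w j then prim_root d ^ nat (snd w j) else 0)"

definition act :: "nat \<Rightarrow> nat \<Rightarrow> colored_perm \<Rightarrow> (nat \<Rightarrow> complex) \<Rightarrow> (nat \<Rightarrow> complex)" where
  "act d n w v = (\<lambda>i. if i \<in> {1..n} then \<Sum>j=1..n. monomial_entry d w i j * v j else 0)"

definition fix_space :: "nat \<Rightarrow> nat \<Rightarrow> colored_perm \<Rightarrow> (nat \<Rightarrow> complex) set" where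
  "fix_space d n w = {v \<in> Cn n. act d n w v = v}"

definition dim_fix :: "nat \<Rightarrow> nat \<Rightarrow> colored_perm \<Rightarrow> nat" where
  "dim_fix d n w = vector_space.dim scaleC (fix_space d n w)"

definition unit_vector :: "nat \<Rightarrow> nat \<Rightarrow> complex" where
  "unit_vector j = (\<lambda>i. if i = j then 1 else 0)"

definition X_set :: "nat \<Rightarrow> nat \<Rightarrow> (nat \<Rightarrow> complex) set" where
  "X_set d n = {scaleC (prim_root d ^ i) (unit_vector j) | i j. i < d \<and> j \<in> {1..n}}"


section \<open>Transitive factorizations\<close>

definition transitive_on_X :: "nat \<Rightarrow> nat \<Rightarrow> colored_perm set \<Rightarrow> bool" where
  "transitive_on_X d n U \<longleftrightarrow>
    (\<forall>x \<in> X_set d n. \<forall>y \<in> X_set d n. \<exists>g \<in> generate (G_ddn d n) U. act d n g x = y)"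

definition ordered_prod :: "('a, 'b) monoid_scheme \<Rightarrow> nat \<Rightarrow> (nat \<Rightarrow> 'a) \<Rightarrow> 'a" where
  "ordered_prod G k u = foldr (\<otimes>\<^bsub>G\<^esub>) (map u [1..<Suc k]) \<one>\<^bsub>G\<^esub>"

definition transitive_factorizations ::
    "nat \<Rightarrow> nat \<Rightarrow> nat \<Rightarrow> (nat \<Rightarrow>\<^sub>0 nat) \<Rightarrow> (nat \<Rightarrow> colored_perm) set" where
  "transitive_factorizations d n k r =
    {u \<in> {1..k} \<rightarrow>\<^sub>E carrier (G_ddn d n).
       ordered_prod (G_ddn d n) k u = c_ddn d n \<and>
       transitive_on_X d n (u ` {1..k}) \<and>
       (\<forall>i \<in> {1..k}. dim_fix d n (u i) = Poly_Mapping.lookup r i)}"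

definition b_coeff :: "nat \<Rightarrow> nat \<Rightarrow> nat \<Rightarrow> (nat \<Rightarrow>\<^sub>0 nat) \<Rightarrow> nat" where
  "b_coeff d n k r = card (transitive_factorizations d n k r)"


section \<open>Polynomials\<close>

text \<open>
  Polynomials in the variables $x_i$ over \<open>'a\<close>: finitely supported maps from exponent
  vectors \<open>nat \<Rightarrow>\<^sub>0 nat\<close> to coefficients, multiplied by convolution.
\<close>

type_synonym 'a mpoly = "(nat \<Rightarrow>\<^sub>0 nat) \<Rightarrow>\<^sub>0 'a"

definition Var :: "nat \<Rightarrow> 'a::zero_neq_one mpoly" where
  "Var i = Poly_Mapping.single (Poly_Mapping.single i 1) 1"

definition Const :: "'a::zero \<Rightarrow> 'a mpoly" where
  "Const c = Poly_Mapping.single 0 c"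

definition d_falling :: "nat \<Rightarrow> nat \<Rightarrow> 'a::comm_ring_1 \<Rightarrow> 'a" where
  "d_falling d m x = (\<Prod>i=1..m. x - 1 - of_nat ((i - 1) * d))"

definition P_poly :: "nat \<Rightarrow> nat \<Rightarrow> 'a::comm_ring_1 \<Rightarrow> 'a" where
  "P_poly d m x =
    (if m = 0 then 1
     else if m = 1 then x
     else (x - of_nat ((m - 1) * (d - 1))) * d_falling d (m - 1) x)"

definition M_coeff :: "nat \<Rightarrow> nat \<Rightarrow> (nat \<Rightarrow>\<^sub>0 nat) \<Rightarrow> rat" where
  "M_coeff n k p =
    Poly_Mapping.lookup (((\<Prod>i=1..k. 1 + Var i) - (\<Prod>i=1..k. Var i)) ^ n) p"


section \<open>Finiteness of the supports\<close>

text \<open>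
  \<open>Sum_any\<close> is the sum of a finitely supported family (and $0$ otherwise); the lemmas below
  give this for families weighted by \<open>b_coeff\<close> or \<open>M_coeff\<close>.
\<close>

lemma finite_carrier_G_ddn: "finite (carrier (G_ddn d n))"
proof (rule finite_subset)
  show "carrier (G_ddn d n) \<subseteq> {\<pi>. \<pi> permutes {1..n}} \<times> ({1..n} \<rightarrow>\<^sub>E {0..<int d})"
    by (auto simp: G_ddn_def G_d1n_def)
  show "finite ({\<pi>. \<pi> permutes {1..n}} \<times> ({1..n} \<rightarrow>\<^sub>E {0..<int d}))"
    by (intro finite_cartesian_product finite_permutations finite_PiE) auto
qed

lemma finite_support_b_coeff:
  "finite {r. Poly_Mapping.keys r \<subseteq> {1..k} \<and> b_coeff d n k r \<noteq> 0}"
proof (rule finite_subset)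
  let ?F = "\<lambda>u. Abs_poly_mapping (\<lambda>i. if i \<in> {1..k} then dim_fix d n (u i) else 0)"
  show "finite (?F ` ({1..k} \<rightarrow>\<^sub>E carrier (G_ddn d n)))"
    by (intro finite_imageI finite_PiE finite_carrier_G_ddn) auto
  show "{r. Poly_Mapping.keys r \<subseteq> {1..k} \<and> b_coeff d n k r \<noteq> 0}
      \<subseteq> ?F ` ({1..k} \<rightarrow>\<^sub>E carrier (G_ddn d n))"
  proof
    fix r assume "r \<in> {r. Poly_Mapping.keys r \<subseteq> {1..k} \<and> b_coeff d n k r \<noteq> 0}"
    then have keys: "Poly_Mapping.keys r \<subseteq> {1..k}" and "transitive_factorizations d n k r \<noteq> {}"
      by (auto simp: b_coeff_def)
    then obtain u where u: "u \<in> transitive_factorizations d n k r" by blast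
    have "Poly_Mapping.lookup r = (\<lambda>i. if i \<in> {1..k} then dim_fix d n (u i) else 0)"
    proof
      fix i show "Poly_Mapping.lookup r i = (if i \<in> {1..k} then dim_fix d n (u i) else 0)"
        using u keys by (cases "i \<in> {1..k}")
          (auto simp: transitive_factorizations_def Poly_Mapping.in_keys_iff subset_iff)
    qed
    then have "r = ?F u" by (metis Poly_Mapping.lookup_inverse)
    with u show "r \<in> ?F ` ({1..k} \<rightarrow>\<^sub>E carrier (G_ddn d n))"
      by (auto simp: transitive_factorizations_def)
  qed
qed

lemma finite_support_M_coeff: "finite {p. M_coeff n k p \<noteq> 0}"
  unfolding M_coeff_def by (rule Poly_Mapping.finite_lookup)

end

theory Submission
  imports Defs "HOL-Computational_Algebra.Polynomial"
begin

text \<open>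
  A transitive factorization of $c_{(d,d,n)}$ projects to a factorization of the permutation
  $(1\,2\cdots n-1)(n)$ in which some factor moves $n$. Conversely, the cycle weights and the product
  together form the boundary map of a connected graph, so all admissible cycle weights of a lift
  are attained equally often, and the sum over the lifts is a product over the factors.

  In the symmetric group, pulling out the transposition of the first factor that moves $n$
  reduces the count to products that are $n$-cycles. These are detected by an alternating sum of
  the characters of the exterior powers of the reflection representation. Averaging such a
  character against \<open>y ^ num_cycles\<close> multiplies it by a product of linear factors in \<open>y\<close>:
  the average is a polynomial in \<open>y\<close>, and at sufficiently many integers it vanishes by a
  sign-reversing involution. Vandermonde's identity turns the result into the stated form.
\<close>

section \<open>Cycles\<close>

text \<open>Only hooks occur because, by the Murnaghan-Nakayama rule, their characters are the
  irreducible ones that do not vanish on an n-cycle. Up to sign they are truncated sign sums over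
  stable subsets, so no representation theory enters; interpolation replaces Schur's lemma.

  The target is an (n-1)-cycle with fixed point n, and the condition that n be moved is not
  invariant under conjugation by all permutations. Multiplication by a transposition containing n
  repairs both defects at once.

  The polynomials P arise from the substitution x = 1 + d y. For a factor with c cycles, the
  zero-sum cycle weights, with x marking each zero weight, have generating function d^(c-1) ((y+1)^c
  + (d-1) y^c). So the count in G(d,d,n) is a sum of d^k counts in the symmetric group, where each
  variable takes the value y + 1 once and the value y in d - 1 ways. The powers d^c cancel against
  the fibre size of the boundary map, since every cycle is a vertex of the graph.

  The identities are proved over arbitrary commutative rings, with denominators cleared, because the
  arguments will themselves be polynomials in the x_i.\<close>

definition cycle_through :: "('a \<Rightarrow> 'a) \<Rightarrow> 'a \<Rightarrow> 'a set" where
  "cycle_through p x = range (\<lambda>i. (p ^^ i) x)"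

definition cycles_on :: "'a set \<Rightarrow> ('a \<Rightarrow> 'a) \<Rightarrow> 'a set set" where
  "cycles_on S p = cycle_through p ` S"

text \<open>The ground set is explicit: fixed points in \<open>S\<close> count as cycles, and
  \<open>p\<close> need only map \<open>S\<close> bijectively to itself, so that cycles can be
  counted on a stable subset of a larger domain.\<close>

definition num_cycles :: "'a set \<Rightarrow> ('a \<Rightarrow> 'a) \<Rightarrow> nat" where
  "num_cycles S p = card (cycles_on S p)"

lemma self_in_cycle: "x \<in> cycle_through p x"
  unfolding cycle_through_def by (rule range_eqI[of _ _ 0]) simp

lemma funpow_in_stable:
  assumes "bij_betw p S S" "x \<in> S" shows "(p ^^ i) x \<in> S"
  using assms by (induction i) (auto simp: bij_betw_def)

lemma cycle_subset: "bij_betw p S S \<Longrightarrow> x \<in> S \<Longrightarrow> cycle_through p x \<subseteq> S"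
  by (auto simp: cycle_through_def funpow_in_stable)

lemma funpow_returns:
  assumes "finite S" "bij_betw p S S" "x \<in> S"
  shows "\<exists>k>0. (p ^^ k) x = x"
proof -
  have "\<not> inj_on (\<lambda>i. (p ^^ i) x) (UNIV :: nat set)"
    using assms funpow_in_stable[OF assms(2,3)] finite_subset[of "range (\<lambda>i. (p ^^ i) x)" S]
    by (metis finite_imageD image_subsetI infinite_UNIV_nat)
  then obtain i j where ij: "(p ^^ i) x = (p ^^ j) x" "i < j"
    unfolding inj_on_def by (metis linorder_neqE_nat)
  have "(p ^^ i) ((p ^^ (j - i)) x) = (p ^^ i) x"
    using ij by (metis add_diff_inverse_nat comp_apply funpow_add less_imp_not_less)
  moreover have "inj_on (p ^^ i) S"
    using assms(2) by (metis bij_betw_funpow bij_betw_imp_inj_on)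
  ultimately have "(p ^^ (j - i)) x = x"
    using funpow_in_stable[OF assms(2,3)] assms(3) by (meson inj_onD)
  with ij show ?thesis by (intro exI[of _ "j - i"]) auto
qed

lemma cycle_eqI:
  assumes "finite S" "bij_betw p S S" "x \<in> S" "y \<in> cycle_through p x"
  shows "cycle_through p y = cycle_through p x"
proof -
  obtain i where i: "y = (p ^^ i) x" using assms(4) by (auto simp: cycle_through_def)
  obtain k where k: "k > 0" "(p ^^ k) x = x" using funpow_returns[OF assms(1-3)] by auto
  have kk: "(p ^^ (k * l)) x = x" for l
    by (induction l) (auto simp: k funpow_add)
  have "k * i = (k * i - i) + i" using k(1) by (cases k) auto
  then have "x = (p ^^ (k * i - i)) y"
    using kk[of i] unfolding i by (metis comp_apply funpow_add)
  then obtain j where j: "x = (p ^^ j) y" by blast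
  have "cycle_through p y \<subseteq> cycle_through p x"
    unfolding cycle_through_def i by (metis (no_types, lifting) comp_apply funpow_add image_subsetI rangeI)
  moreover have "cycle_through p x \<subseteq> cycle_through p y"
    unfolding cycle_through_def by (subst j) (metis (no_types, lifting) comp_apply funpow_add image_subsetI rangeI)
  ultimately show ?thesis by blast
qed

lemma cycle_step:
  assumes "finite S" "bij_betw p S S" "x \<in> S"
  shows "cycle_through p (p x) = cycle_through p x"
  by (rule cycle_eqI[OF assms]) (auto simp: cycle_through_def intro: range_eqI[of _ _ 1])

lemma finite_cycles_on: "finite S \<Longrightarrow> finite (cycles_on S p)"
  by (simp add: cycles_on_def)

lemma invariant_on_cycle:
  assumes "bij_betw p S S" "\<And>x. x \<in> S \<Longrightarrow> f (p x) = f x" "x \<in> S" "y \<in> cycle_through p x"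
  shows "f y = f x"
proof -
  obtain i where i: "y = (p ^^ i) x" using assms(4) by (auto simp: cycle_through_def)
  have "f ((p ^^ i) x) = f x"
    by (induction i) (auto simp: assms(2,3) funpow_in_stable[OF assms(1,3)])
  then show ?thesis by (simp add: i)
qed

text \<open>Invariant functions are constant on cycles, hence are functions on the set of cycles.
  Two colours suffice to compare numbers of cycles; with q colours, \<open>q ^ num_cycles\<close>
  becomes a number of fixed colourings.\<close>

lemma card_invariant_functions:
  assumes "finite S" "bij_betw p S S" "finite Q"
  shows "card {f \<in> S \<rightarrow>\<^sub>E Q. \<forall>x\<in>S. f (p x) = f x} = card Q ^ num_cycles S p"
proof -
  have "bij_betw (\<lambda>F. \<lambda>x\<in>S. F (cycle_through p x)) (cycles_on S p \<rightarrow>\<^sub>E Q)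
          {f \<in> S \<rightarrow>\<^sub>E Q. \<forall>x\<in>S. f (p x) = f x}"
  proof (rule bij_betw_byWitness[where f' = "\<lambda>f. \<lambda>C\<in>cycles_on S p. f (SOME x. x \<in> C)"], goal_cases)
    case 1
    show ?case
    proof
      fix F assume F: "F \<in> cycles_on S p \<rightarrow>\<^sub>E Q"
      have "F C = (\<lambda>C\<in>cycles_on S p. (\<lambda>x\<in>S. F (cycle_through p x)) (SOME x. x \<in> C)) C" for C
      proof (cases "C \<in> cycles_on S p")
        case True
        then obtain x where x: "x \<in> S" "C = cycle_through p x" by (auto simp: cycles_on_def)
        define y where "y = (SOME x. x \<in> C)"
        have "y \<in> C" unfolding y_def using x self_in_cycle by (metis someI)
        then have "y \<in> S" "cycle_through p y = C"
          using x cycle_subset[OF assms(2)] cycle_eqI[OF assms(1,2)] by blast+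
        then show ?thesis using True by (simp flip: y_def)
      qed (use F in auto)
      then show "(\<lambda>C\<in>cycles_on S p. (\<lambda>x\<in>S. F (cycle_through p x)) (SOME x. x \<in> C)) = F"
        by auto
    qed
  next
    case 2
    show ?case
    proof
      fix f assume f: "f \<in> {f \<in> S \<rightarrow>\<^sub>E Q. \<forall>x\<in>S. f (p x) = f x}"
      show "(\<lambda>x\<in>S. (\<lambda>C\<in>cycles_on S p. f (SOME x. x \<in> C)) (cycle_through p x)) = f"
      proof
        fix x
        show "(\<lambda>x\<in>S. (\<lambda>C\<in>cycles_on S p. f (SOME x. x \<in> C)) (cycle_through p x)) x = f x"
        proof (cases "x \<in> S")
          case True
          have "(SOME z. z \<in> cycle_through p x) \<in> cycle_through p x"
            using self_in_cycle by (metis someI)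
          then have "f (SOME z. z \<in> cycle_through p x) = f x"
            using invariant_on_cycle[OF assms(2) _ True, of f] f by blast
          then show ?thesis using True by (simp add: cycles_on_def)
        qed (use f in auto)
      qed
    qed
  next
    case 3
    show ?case
    proof (intro image_subsetI CollectI conjI ballI)
      fix F assume F: "F \<in> cycles_on S p \<rightarrow>\<^sub>E Q"
      show "(\<lambda>x\<in>S. F (cycle_through p x)) \<in> S \<rightarrow>\<^sub>E Q"
        using F by (auto simp: cycles_on_def)
      fix x assume x: "x \<in> S"
      then have "p x \<in> S" using assms(2) by (meson bij_betw_apply)
      then show "(\<lambda>x\<in>S. F (cycle_through p x)) (p x) = (\<lambda>x\<in>S. F (cycle_through p x)) x"
        using x cycle_step[OF assms(1,2) x] by simp
    qed
  next
    case 4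
    show ?case
    proof (clarsimp simp: cycles_on_def)
      fix f x assume f: "f \<in> S \<rightarrow>\<^sub>E Q" "x \<in> S"
      have "(SOME z. z \<in> cycle_through p x) \<in> cycle_through p x"
        using self_in_cycle by (metis someI)
      then have "(SOME z. z \<in> cycle_through p x) \<in> S" using cycle_subset[OF assms(2) f(2)] by blast
      then show "f (SOME z. z \<in> cycle_through p x) \<in> Q" using f by auto
    qed
  qed
  from bij_betw_same_card[OF this] show ?thesis
    using assms by (simp add: card_PiE finite_cycles_on num_cycles_def)
qed

lemma num_cycles_eqI:
  assumes "finite S" "bij_betw p S S" "finite T" "bij_betw q T T"
    and "card {f \<in> S \<rightarrow>\<^sub>E (UNIV :: bool set). \<forall>x\<in>S. f (p x) = f x}
       = 2 ^ j * card {f \<in> T \<rightarrow>\<^sub>E (UNIV :: bool set). \<forall>x\<in>T. f (q x) = f x}"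
  shows "num_cycles S p = num_cycles T q + j"
proof -
  have "(2::nat) ^ num_cycles S p = 2 ^ (num_cycles T q + j)"
    using assms(5) card_invariant_functions[OF assms(1,2), of "(UNIV :: bool set)"]
      card_invariant_functions[OF assms(3,4), of "(UNIV :: bool set)"]
    by (simp add: power_add mult.commute)
  then show ?thesis by simp
qed

lemma num_cycles_cong:
  assumes "\<And>x. x \<in> S \<Longrightarrow> p x = q x" "bij_betw p S S"
  shows "num_cycles S p = num_cycles S q"
proof -
  have "(p ^^ i) x = (q ^^ i) x" if "x \<in> S" for i x
    by (induction i) (use assms(1) funpow_in_stable[OF assms(2) that] in \<open>auto, metis\<close>)
  then show ?thesis
    unfolding num_cycles_def cycles_on_def cycle_through_def
    by (metis (mono_tags, lifting) image_cong)
qed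

lemma cycles_on_Un: "cycles_on (S \<union> T) p = cycles_on S p \<union> cycles_on T p"
  by (auto simp: cycles_on_def)

lemma num_cycles_Un:
  assumes "finite S" "finite T" "bij_betw p S S" "bij_betw p T T" "S \<inter> T = {}"
  shows "num_cycles (S \<union> T) p = num_cycles S p + num_cycles T p"
proof -
  have "cycles_on S p \<inter> cycles_on T p = {}"
  proof (rule ccontr)
    assume "cycles_on S p \<inter> cycles_on T p \<noteq> {}"
    then obtain x y where "x \<in> S" "y \<in> T" "cycle_through p x = cycle_through p y"
      unfolding cycles_on_def by blast
    then have "x \<in> T" using cycle_subset[OF assms(4)] self_in_cycle[of x p] by blast
    with \<open>x \<in> S\<close> show False using assms(5) by blast
  qed
  then show ?thesis
    unfolding num_cycles_def cycles_on_Un using assms by (intro card_Un_disjoint) (auto simp: finite_cycles_on)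
qed

lemma num_cycles_empty [simp]: "num_cycles {} p = 0"
  by (simp add: num_cycles_def cycles_on_def)

lemma num_cycles_cycle:
  assumes "finite S" "bij_betw p S S" "x \<in> S"
  shows "num_cycles (cycle_through p x) p = 1"
proof -
  have "cycles_on (cycle_through p x) p = {cycle_through p x}"
    unfolding cycles_on_def using cycle_eqI[OF assms] self_in_cycle[of x p] by blast
  then show ?thesis by (simp add: num_cycles_def)
qed

lemma bij_betw_cycle:
  assumes "finite S" "bij_betw p S S" "x \<in> S"
  shows "bij_betw p (cycle_through p x) (cycle_through p x)"
proof -
  have sub: "cycle_through p x \<subseteq> S" by (rule cycle_subset[OF assms(2,3)])
  have "p ` cycle_through p x \<subseteq> cycle_through p x"
  proof (intro image_subsetI)
    fix y assume "y \<in> cycle_through p x"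
    then obtain i where "y = (p ^^ i) x" by (auto simp: cycle_through_def)
    then have "p y = (p ^^ Suc i) x" by simp
    then show "p y \<in> cycle_through p x" unfolding cycle_through_def by (rule range_eqI)
  qed
  moreover have "inj_on p (cycle_through p x)"
    using sub assms(2) by (meson bij_betw_def inj_on_subset)
  ultimately show ?thesis
    using assms(1) sub by (metis bij_betw_def endo_inj_surj finite_subset)
qed

lemma num_cycles_le: "finite S \<Longrightarrow> num_cycles S p \<le> card S"
  by (simp add: num_cycles_def cycles_on_def card_image_le)

lemma num_cycles_eq_card_iff:
  assumes "finite S" "p permutes S"
  shows "num_cycles S p = card S \<longleftrightarrow> p = id"
proof
  assume "num_cycles S p = card S"
  then have "inj_on (cycle_through p) S"
    using assms(1) by (simp add: num_cycles_def cycles_on_def inj_on_iff_eq_card)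
  then have "p x = x" if "x \<in> S" for x
    using that cycle_step[OF assms(1) permutes_imp_bij[OF assms(2)] that] permutes_in_image[OF assms(2)]
    by (meson inj_onD)
  then show "p = id" using assms(2) by (metis eq_id_iff permutes_not_in)
next
  have "(id ^^ i) x = x" for i and x :: 'a by (induction i) auto
  then have "inj_on (cycle_through id) S"
    by (intro inj_onI) (auto simp: cycle_through_def)
  moreover assume "p = id"
  ultimately show "num_cycles S p = card S" by (simp add: num_cycles_def cycles_on_def card_image)
qed

lemma num_cycles_insert_fixed:
  assumes "finite S" "bij_betw p S S" "a \<notin> S" "p a = a"
  shows "num_cycles (insert a S) p = num_cycles S p + 1"
proof -
  have "(p ^^ i) a = a" for i by (induction i) (auto simp: assms)
  then have "num_cycles {a} p = 1" by (simp add: num_cycles_def cycles_on_def)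
  moreover have "bij_betw p {a} {a}" using assms(4) by (simp add: bij_betw_def)
  ultimately show ?thesis using num_cycles_Un[of S "{a}" p] assms by simp
qed

text \<open>The composite sends a to b and the q-preimage of b to a, so a is spliced into the cycle
  of b just before b. On invariant two-colourings this means that a takes the colour of b, so
  restriction to \<open>S\<close> is a bijection.\<close>

lemma num_cycles_insert_transpose:
  assumes "finite S" "q permutes S" "a \<notin> S" "b \<in> S"
  shows "num_cycles (insert a S) (transpose a b \<circ> q) = num_cycles S q"
proof -
  define p where "p = transpose a b \<circ> q"
  have qa: "q a = a" using assms(2,3) by (simp add: permutes_def)
  have pa: "p a = b" by (simp add: p_def qa)
  have p: "p permutes insert a S" unfolding p_def
    using assms by (intro permutes_compose permutes_imp_permutes_insert permutes_swap_id) auto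
  have q_in: "q x \<in> S \<longleftrightarrow> x \<in> S" for x using permutes_in_image[OF assms(2)] .
  have px: "p x = (if q x = b then a else q x)" if "x \<in> S" for x
    using that q_in[of x] assms(3) by (auto simp: p_def transpose_def)
  obtain c where c: "c \<in> S" "q c = b" using assms(2,4) by (metis permutes_surj surjD q_in)
  let ?I = "{f \<in> insert a S \<rightarrow>\<^sub>E (UNIV :: bool set). \<forall>x\<in>insert a S. f (p x) = f x}"
  let ?J = "{f \<in> S \<rightarrow>\<^sub>E (UNIV :: bool set). \<forall>x\<in>S. f (q x) = f x}"
  have "bij_betw (\<lambda>f. restrict f S) ?I ?J"
  proof (rule bij_betw_byWitness[where f' = "\<lambda>f. f(a := f b)"], goal_cases)
    case 1
    show ?case
    proof
      fix f assume f: "f \<in> ?I"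
      then have "f b = f a" using pa by force
      then show "(restrict f S)(a := restrict f S b) = f" 
        using f assms(3,4) by (auto simp: fun_eq_iff PiE_def extensional_def)
    qed
  next
    case 2
    then show ?case using assms(3) by (auto simp: fun_eq_iff PiE_def extensional_def)
  next
    case 3
    show ?case
    proof
      fix g assume "g \<in> (\<lambda>f. restrict f S) ` ?I"
      then obtain f where f: "f \<in> ?I" "g = restrict f S" by auto
      have fab: "f b = f a" using f pa by force
      have "f (q x) = f x" if "x \<in> S" for x
        using f that px[OF that] fab by (auto split: if_splits)
      then show "g \<in> ?J" using f q_in by auto
    qed
  next
    case 4
    show ?case
    proof
      fix g assume "g \<in> (\<lambda>f. f(a := f b)) ` ?J"
      then obtain f where f: "f \<in> ?J" "g = f(a := f b)" by auto
      have "g (p x) = g x" if "x \<in> insert a S" for x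
      proof (cases "x = a")
        case True then show ?thesis using f pa assms(3,4) by auto
      next
        case False
        then have "x \<in> S" using that by simp
        then show ?thesis using f px[of x] q_in[of x] assms(3) False by auto
      qed
      then show "g \<in> ?I" using f assms(4) by (auto simp: PiE_def extensional_def)
    qed
  qed
  from bij_betw_same_card[OF this] show ?thesis
    using num_cycles_eqI[of "insert a S" p S q 0] assms p permutes_imp_bij unfolding p_def by auto
qed

text \<open>When a point a is added, either it is fixed (one more element, one more cycle, same
  sign) or a transposition splices it into a cycle (one more element, same number of cycles,
  opposite sign).\<close>

lemma neg_one_power_num_cycles:
  assumes "finite S" "p permutes S"
  shows "(-1) ^ num_cycles S p = (-1) ^ card S * (sign p :: int)"
  using assms
proof (induction S arbitrary: p rule: finite_induct)
  case empty
  then show ?case by simp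
next
  case (insert a S)
  define q where "q = transpose a (p a) \<circ> p"
  have q: "q permutes S" unfolding q_def by (rule permutes_insert_lemma[OF insert.prems])
  have pq: "p = transpose a (p a) \<circ> q" by (simp add: q_def fun_eq_iff)
  have pa: "p a \<in> insert a S" using permutes_in_image[OF insert.prems, of a] by simp
  show ?case
  proof (cases "p a = a")
    case True
    then have "p permutes S" using pq q by simp
    then show ?thesis using insert True num_cycles_insert_fixed[of S p a] by (simp add: permutes_imp_bij)
  next
    case False
    have "permutation q" using q insert.hyps(1) permutation_permutes by blast
    then have "sign p = - sign q"
      using False by (subst pq, subst sign_compose) (auto simp: sign_swap_id permutation_swap_id)
    moreover have "num_cycles (insert a S) p = num_cycles S q"
      using False pa q insert.hyps num_cycles_insert_transpose[of S q a "p a"] pq by auto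
    ultimately show ?thesis using insert q by simp
  qed
qed

section \<open>Hook characters\<close>

lemma stable_bij_betw: "finite S \<Longrightarrow> s ` S = S \<Longrightarrow> bij_betw s S S"
  by (simp add: bij_betw_def eq_card_imp_inj_on)

text \<open>
  For a permutation \<open>s\<close> of the \<open>n\<close>-element set \<open>A\<close> and $h < n$, \<open>hook_char A (Suc h) s\<close> is $(-1)^h$ times
  the character of the hook $(n-h, 1^h)$: the coefficient of $t^h$ in
  $\frac{1}{1-t}\prod_C (1 - t^{|C|})$, where \<open>C\<close> runs over the cycles of \<open>s\<close>.
\<close>

definition hook_char :: "'a set \<Rightarrow> nat \<Rightarrow> ('a \<Rightarrow> 'a) \<Rightarrow> int" where
  "hook_char A h s = (\<Sum>S | S \<subseteq> A \<and> s ` S = S \<and> card S < h. (-1) ^ num_cycles S s)"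

text \<open>Stable sets are unions of cycles. Adding the cycle B of x to a stable set disjoint from
  it reverses the sign and raises the cardinality by \<open>card B\<close>. The free weight
  \<open>g\<close> covers both the plain sign sum and the weighted one in
  \<open>sum_hook_char\<close>.\<close>

lemma sum_stable_toggle:
  fixes g :: "nat \<Rightarrow> int"
  assumes "finite A" "bij_betw s A A" "x \<in> A"
  defines "B \<equiv> cycle_through s x"
  shows "(\<Sum>S | S \<subseteq> A \<and> s ` S = S. g (card S) * (-1) ^ num_cycles S s)
       = (\<Sum>S | S \<subseteq> A - B \<and> s ` S = S. (g (card S) - g (card S + card B)) * (-1) ^ num_cycles S s)"
proof -
  have B: "B \<subseteq> A" "s ` B = B" "x \<in> B"
    using cycle_subset[OF assms(2,3)] bij_betw_cycle[OF assms(1-3)] self_in_cycle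
    by (auto simp: B_def bij_betw_def)
  have finB: "finite B" using B assms(1) finite_subset by blast
  have inj: "inj_on s A" using assms(2) by (simp add: bij_betw_def)
  define X0 where "X0 = {S. S \<subseteq> A - B \<and> s ` S = S}"
  define X1 where "X1 = (\<lambda>S. S \<union> B) ` X0"
  have fin: "finite X0" unfolding X0_def
    by (rule finite_subset[of _ "Pow A"]) (use assms(1) in auto)
  have X: "{S. S \<subseteq> A \<and> s ` S = S} = X0 \<union> X1"
  proof
    show "{S. S \<subseteq> A \<and> s ` S = S} \<subseteq> X0 \<union> X1"
    proof
      fix S assume "S \<in> {S. S \<subseteq> A \<and> s ` S = S}"
      then have S: "S \<subseteq> A" "s ` S = S" by auto
      have finS: "finite S" using S assms(1) finite_subset by blast
      note bS = stable_bij_betw[OF finS S(2)]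
      show "S \<in> X0 \<union> X1"
      proof (cases "S \<inter> B = {}")
        case True then show ?thesis using S by (auto simp: X0_def)
      next
        case False
        then obtain y where y: "y \<in> S" "y \<in> B" by blast
        have "B = cycle_through s y" using cycle_eqI[OF assms(1-3)] y(2) by (simp add: B_def)
        then have BS: "B \<subseteq> S" using cycle_subset[OF bS y(1)] by simp
        have "s ` (S - B) = S - B"
          using inj_on_image_set_diff[of s A S B] inj S B by (metis Diff_subset subset_trans)
        then have "S - B \<in> X0" using S by (auto simp: X0_def)
        moreover have "S = (S - B) \<union> B" using BS by blast
        ultimately show ?thesis unfolding X1_def by blast
      qed
    qed
    show "X0 \<union> X1 \<subseteq> {S. S \<subseteq> A \<and> s ` S = S}"
      using B unfolding X0_def X1_def by (auto simp: image_Un)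
  qed
  have disj: "X0 \<inter> X1 = {}" using B(3) unfolding X0_def X1_def by blast
  have injU: "inj_on (\<lambda>S. S \<union> B) X0" unfolding X0_def inj_on_def by blast
  have "(\<Sum>S\<in>X1. g (card S) * (-1) ^ num_cycles S s)
      = (\<Sum>S\<in>X0. g (card (S \<union> B)) * (-1) ^ num_cycles (S \<union> B) s)"
    unfolding X1_def by (simp add: sum.reindex[OF injU])
  also have "\<dots> = (\<Sum>S\<in>X0. - g (card S + card B) * (-1) ^ num_cycles S s)"
  proof (rule sum.cong, goal_cases)
    case (2 S)
    then have S: "S \<subseteq> A - B" "s ` S = S" by (auto simp: X0_def)
    have finS: "finite S" using S assms(1) finite_subset by blast
    have d: "S \<inter> B = {}" using S by blast
    have "num_cycles (S \<union> B) s = num_cycles S s + num_cycles B s"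
      by (rule num_cycles_Un) (use finS finB d stable_bij_betw S B in auto)
    moreover have "num_cycles B s = 1" unfolding B_def by (rule num_cycles_cycle[OF assms(1-3)])
    moreover have "card (S \<union> B) = card S + card B" using finS finB d by (rule card_Un_disjoint)
    ultimately show ?case by simp
  qed simp
  finally show ?thesis
    unfolding X using fin disj
    by (subst sum.union_disjoint)
      (auto simp: X1_def sum.distrib[symmetric] algebra_simps X0_def[symmetric] sum_negf sum_subtractf)
qed

lemma sum_stable_eq_0:
  assumes "finite A" "bij_betw s A A" "A \<noteq> {}"
  shows "(\<Sum>S | S \<subseteq> A \<and> s ` S = S. (-1) ^ num_cycles S s) = (0::int)"
proof -
  obtain x where "x \<in> A" using assms(3) by blast
  from sum_stable_toggle[OF assms(1,2) this, of "\<lambda>_. 1"] show ?thesis by simp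
qed

lemma hook_char_if:
  assumes "finite A"
  shows "hook_char A h s = (\<Sum>S | S \<subseteq> A \<and> s ` S = S. if card S < h then (-1) ^ num_cycles S s else 0)"
proof -
  have "finite {S. S \<subseteq> A \<and> s ` S = S}"
    by (rule finite_subset[of _ "Pow A"]) (use assms in auto)
  then show ?thesis
    unfolding hook_char_def by (simp add: sum.inter_filter[symmetric] conj_assoc)
qed

text \<open>On a full cycle every summand is 1, since the empty set is the only stable set below the
  threshold. In general a stable S lies below \<open>card A - card S\<close> of the thresholds h;
  toggling one cycle B leaves \<open>card B\<close> times the sign sum over stable subsets of
  \<open>A - B\<close>, which vanishes unless B is all of A.\<close>

lemma sum_hook_char:
  assumes "finite A" "bij_betw s A A" "A \<noteq> {}"
  shows "(\<Sum>h=1..card A. hook_char A h s) = (if num_cycles A s = 1 then int (card A) else 0)"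
proof -
  obtain x where x: "x \<in> A" using assms(3) by blast
  define B where "B = cycle_through s x"
  have B: "B \<subseteq> A" "s ` B = B" "x \<in> B"
    using cycle_subset[OF assms(2) x] bij_betw_cycle[OF assms(1,2) x] self_in_cycle
    by (auto simp: B_def bij_betw_def)
  have finB: "finite B" using B assms(1) finite_subset by blast
  have "(\<Sum>h=1..card A. hook_char A h s)
      = (\<Sum>S | S \<subseteq> A \<and> s ` S = S. \<Sum>h=1..card A. if card S < h then (-1) ^ num_cycles S s else 0)"
    unfolding hook_char_if[OF assms(1)] by (rule sum.swap)
  also have "\<dots> = (\<Sum>S | S \<subseteq> A \<and> s ` S = S. int (card A - card S) * (-1) ^ num_cycles S s)"
  proof (rule sum.cong, goal_cases)
    case (2 S)
    have "{h \<in> {1..card A}. card S < h} = {card S<..card A}" by auto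
    then show ?case
      by (simp add: sum.inter_filter[symmetric])
  qed simp
  also have "\<dots> = (\<Sum>S | S \<subseteq> A - B \<and> s ` S = S.
      (int (card A - card S) - int (card A - (card S + card B))) * (-1) ^ num_cycles S s)"
    unfolding B_def by (rule sum_stable_toggle[OF assms(1,2) x, of "\<lambda>c. int (card A - c)"])
  also have "\<dots> = (\<Sum>S | S \<subseteq> A - B \<and> s ` S = S. int (card B) * (-1) ^ num_cycles S s)"
  proof (rule sum.cong, goal_cases)
    case (2 S)
    then have "card S \<le> card (A - B)" using assms(1) by (auto intro: card_mono)
    \<comment> \<open>This makes both natural-number differences genuine, so that their difference
      is exactly \<open>card B\<close>.\<close>
    then have "card S + card B \<le> card A"
      using card_Diff_subset[OF finB B(1)] card_mono[OF assms(1) B(1)] by linarith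
    then show ?case
      by (simp add: of_nat_diff)
  qed simp
  also have "\<dots> = int (card B) * (\<Sum>S | S \<subseteq> A - B \<and> s ` S = S. (-1) ^ num_cycles S s)"
    by (simp add: sum_distrib_left)
  finally have eq: "(\<Sum>h=1..card A. hook_char A h s) = \<dots>" .
  show ?thesis
  proof (cases "A = B")
    case True
    then have "num_cycles A s = 1" using num_cycles_cycle[OF assms(1,2) x] by (simp add: B_def)
    moreover have "{S. S \<subseteq> A - B \<and> s ` S = S} = {{}}" using True by auto
    ultimately show ?thesis using eq True by simp
  next
    case False
    then have ne: "A - B \<noteq> {}" using B by blast
    have inj: "inj_on s A" using assms(2) by (simp add: bij_betw_def)
    have sA: "s ` A = A" using assms(2) by (simp add: bij_betw_def)
    have st: "s ` (A - B) = A - B"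
      using inj_on_image_set_diff[OF inj Diff_subset B(1)] sA B(2) by simp
    have bij: "bij_betw s (A - B) (A - B)" using assms(1) by (intro stable_bij_betw[OF _ st]) simp
    obtain y where y: "y \<in> A - B" using ne by blast
    have "cycle_through s y \<noteq> cycle_through s x"
      using y self_in_cycle[of y s] by (auto simp: B_def)
    moreover have "cycle_through s y = cycle_through s x" if one: "num_cycles A s = 1"
    proof -
      obtain C where "cycles_on A s = {C}"
        using one unfolding num_cycles_def by (meson card_1_singletonE)
      then have "cycle_through s z = C" if "z \<in> A" for z using that unfolding cycles_on_def by blast
      then show ?thesis using x y by blast
    qed
    ultimately have "num_cycles A s \<noteq> 1" by blast
    moreover have "(\<Sum>S | S \<subseteq> A - B \<and> s ` S = S. (-1) ^ num_cycles S s) = (0::int)"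
      by (rule sum_stable_eq_0) (use assms(1) bij ne in auto)
    ultimately show ?thesis using eq by simp
  qed
qed

text \<open>Since the sign sum over all stable sets vanishes, small sets can be exchanged for large
  ones, to which the pigeonhole principle applies.\<close>

lemma hook_char_compl:
  assumes "finite A" "s permutes A" "A \<noteq> {}"
  shows "hook_char A h s = - (\<Sum>S | S \<subseteq> A \<and> s ` S = S \<and> h \<le> card S. (-1) ^ num_cycles S s)"
proof -
  have fin: "finite {S. S \<subseteq> A \<and> s ` S = S \<and> Q S}" for Q
    by (rule finite_subset[of _ "Pow A"]) (use assms in auto)
  have "{S. S \<subseteq> A \<and> s ` S = S} = {S. S \<subseteq> A \<and> s ` S = S \<and> card S < h} \<union> {S. S \<subseteq> A \<and> s ` S = S \<and> h \<le> card S}"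
    by auto
  then have "(\<Sum>S | S \<subseteq> A \<and> s ` S = S. (-1) ^ num_cycles S s)
    = hook_char A h s + (\<Sum>S | S \<subseteq> A \<and> s ` S = S \<and> h \<le> card S. (-1) ^ num_cycles S s)"
    unfolding hook_char_def using fin by (simp, subst sum.union_disjoint) auto
  then show ?thesis
    using sum_stable_eq_0[OF assms(1) permutes_imp_bij[OF assms(2)] assms(3)] by simp
qed

text \<open>Complementation of stable sets, which amounts to tensoring with the sign character and
  hence transposes the hook. The condition \<open>card S < h\<close> becomes
  \<open>card A + 1 - h\<close> at most \<open>card (A - S)\<close>; passing back to small sets
  produces the minus sign.\<close>

lemma hook_char_dual:
  assumes "finite A" "s permutes A" "A \<noteq> {}" "h \<le> card A"
  shows "(-1) ^ num_cycles A s * hook_char A h s = - hook_char A (card A + 1 - h) s"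
proof -
  have inj: "inj_on s A" "s ` A = A" using assms(2) by (auto simp: permutes_inj_on permutes_image)
  have st: "s ` (A - S) = A - S" if "S \<subseteq> A" "s ` S = S" for S
    using inj_on_image_set_diff[of s A A S] inj that by (metis Diff_subset order_refl)
  have "(-1) ^ num_cycles A s * hook_char A h s
      = (\<Sum>S | S \<subseteq> A \<and> s ` S = S \<and> card S < h. (-1) ^ num_cycles (A - S) s)"
    unfolding hook_char_def sum_distrib_left
  proof (rule sum.cong, goal_cases)
    case (2 S)
    then have S: "S \<subseteq> A" "s ` S = S" by auto
    have finS: "finite S" using S assms(1) finite_subset by blast
    have "num_cycles (S \<union> (A - S)) s = num_cycles S s + num_cycles (A - S) s"
      using finS assms(1) stable_bij_betw S st[OF S] by (intro num_cycles_Un) auto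
    moreover have "S \<union> (A - S) = A" using S by blast
    ultimately show ?case
      by (simp add: power_add flip: power_mult_distrib)
  qed simp
  also have "\<dots> = (\<Sum>S | S \<subseteq> A \<and> s ` S = S \<and> card A + 1 - h \<le> card S. (-1) ^ num_cycles S s)"
  proof (rule sum.reindex_bij_witness[of _ "\<lambda>S. A - S" "\<lambda>S. A - S"], goal_cases)
    case (2 S)
    then have "card (A - S) = card A - card S" using assms(1) by (auto simp: card_Diff_subset finite_subset)
    moreover have "card S \<le> card A" using 2 assms(1) by (auto simp: card_mono)
    ultimately show ?case using 2 assms(4) st[of S] by auto
  next
    case (4 S)
    then have "card (A - S) = card A - card S" using assms(1) by (auto simp: card_Diff_subset finite_subset)
    moreover have "card S \<le> card A" using 4 assms(1) by (auto simp: card_mono)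
    ultimately show ?case using 4 assms(4) st[of S] by auto
  qed auto
  finally show ?thesis using hook_char_compl[OF assms(1-3), of "card A + 1 - h"] by simp
qed

text \<open>A transposition changes the sign and hence the parity of the number of cycles. As
  \<open>t\<close> is only assumed to stabilise \<open>S\<close>, the sign is taken of the map
  \<open>r\<close> that agrees with \<open>t\<close> on \<open>S\<close> and is the identity
  elsewhere.\<close>

lemma num_cycles_parity_transpose:
  assumes "finite S" "t ` S = S" "a \<in> S" "b \<in> S" "a \<noteq> b"
  shows "(-1) ^ num_cycles S (t \<circ> transpose a b) = (- ((-1) ^ num_cycles S t) :: int)"
proof -
  define r where "r = (\<lambda>x. if x \<in> S then t x else x)"
  have bt: "bij_betw t S S" using stable_bij_betw assms by blast
  then have "bij_betw r S S" by (subst bij_betw_cong[of S r t]) (auto simp: r_def)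
  then have r: "r permutes S" by (rule bij_imp_permutes) (simp add: r_def)
  have tr: "transpose a b permutes S" using assms by (simp add: permutes_swap_id)
  have rt: "(r \<circ> transpose a b) permutes S" using permutes_compose[OF tr r] .
  have "num_cycles S r = num_cycles S t"
    by (rule num_cycles_cong) (use r in \<open>auto simp: r_def permutes_imp_bij\<close>)
  moreover have "num_cycles S (r \<circ> transpose a b) = num_cycles S (t \<circ> transpose a b)"
  proof (rule num_cycles_cong)
    fix x assume "x \<in> S"
    then have "transpose a b x \<in> S" using permutes_in_image[OF tr] by blast
    then show "(r \<circ> transpose a b) x = (t \<circ> transpose a b) x" by (simp add: r_def)
  qed (use rt permutes_imp_bij in auto)
  moreover have "sign (r \<circ> transpose a b) = - sign r"
  proof -
    have "permutation r" using r assms(1) permutation_permutes by blast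
    then show ?thesis using assms(5) by (subst sign_compose) (auto simp: sign_swap_id permutation_swap_id)
  qed
  ultimately show ?thesis
    using neg_one_power_num_cycles[OF assms(1) r] neg_one_power_num_cycles[OF assms(1) rt] by simp
qed

text \<open>
  Only sets \<open>S\<close> with at least \<open>h\<close> elements matter, since the sum over all \<open>S\<close> vanishes. Such a set
  contains two points \<open>a\<close>, \<open>b\<close> of the same colour, and composing with \<open>transpose a b\<close> reverses the sign.
\<close>

lemma sum_hook_char_young:
  assumes "finite A" "s permutes A" "A \<noteq> {}" "card (f ` A) < h"
  shows "(\<Sum>p | p permutes A \<and> (\<forall>x\<in>A. f (p x) = f x). hook_char A h (s \<circ> p)) = 0"
proof -
  \<comment> \<open>The Young subgroup of the colouring \<open>f\<close>.\<close>
  define Y where "Y = {p. p permutes A \<and> (\<forall>x\<in>A. f (p x) = f x)}"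
  have finY: "finite Y" unfolding Y_def
    by (rule finite_subset[OF _ finite_permutations[OF assms(1)]]) auto
  have "(\<Sum>p\<in>Y. hook_char A h (s \<circ> p))
      = - (\<Sum>p\<in>Y. \<Sum>S | S \<subseteq> A \<and> h \<le> card S. if (s \<circ> p) ` S = S then (-1) ^ num_cycles S (s \<circ> p) else 0)"
  proof (subst sum_negf[symmetric], rule sum.cong, goal_cases)
    case (2 p)
    then have "(s \<circ> p) permutes A" using assms(2) permutes_compose by (auto simp: Y_def)
    from hook_char_compl[OF assms(1) this assms(3), of h]
    have "hook_char A h (s \<circ> p) = - (\<Sum>S\<in>{S \<in> {S. S \<subseteq> A \<and> h \<le> card S}. (s \<circ> p) ` S = S}. (-1) ^ num_cycles S (s \<circ> p))"
      by (simp add: conj_ac)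
    moreover have "finite {S. S \<subseteq> A \<and> h \<le> card S}"
      by (rule finite_subset[of _ "Pow A"]) (use assms in auto)
    ultimately show ?case
      by (simp only: sum.inter_filter)
  qed simp
  also have "(\<Sum>p\<in>Y. \<Sum>S | S \<subseteq> A \<and> h \<le> card S. if (s \<circ> p) ` S = S then (-1) ^ num_cycles S (s \<circ> p) else 0)
      = (\<Sum>S | S \<subseteq> A \<and> h \<le> card S. \<Sum>p\<in>Y. if (s \<circ> p) ` S = S then (-1) ^ num_cycles S (s \<circ> p) else (0::int))"
    by (rule sum.swap)
  also have "\<dots> = 0"
  proof (rule sum.neutral, rule ballI)
    fix S assume "S \<in> {S. S \<subseteq> A \<and> h \<le> card S}"
    then have S: "S \<subseteq> A" "h \<le> card S" by auto
    have finS: "finite S" using S assms(1) finite_subset by blast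
    have "card (f ` S) \<le> card (f ` A)" using S assms(1) by (intro card_mono) auto
    then have "\<not> inj_on f S" using S assms(4) card_image[of f S] by linarith
    then obtain a b where ab: "a \<in> S" "b \<in> S" "a \<noteq> b" "f a = f b" unfolding inj_on_def by blast
    have tr: "transpose a b permutes A" using ab S by (intro permutes_swap_id) auto
    have inv: "p \<circ> transpose a b \<in> Y" if "p \<in> Y" for p
    proof -
      have p: "p permutes A" "\<And>x. x \<in> A \<Longrightarrow> f (p x) = f x" using that by (auto simp: Y_def)
      have "f (p (transpose a b x)) = f x" if "x \<in> A" for x
        using p(2)[of "transpose a b x"] permutes_in_image[OF tr, of x] that ab(4)
        by (auto simp: transpose_def)
      then show ?thesis using permutes_compose[OF tr p(1)] by (simp add: Y_def)
    qed
    \<comment> \<open>Hence S is stable under \<open>s \<circ> p\<close> exactly when it is stable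
      under \<open>s \<circ> p \<circ> transpose a b\<close>, and the involution acts on the terms
      belonging to this S.\<close>
    have trS: "transpose a b ` S = S" using ab by simp
    let ?F = "\<lambda>p. if (s \<circ> p) ` S = S then (-1) ^ num_cycles S (s \<circ> p) else (0::int)"
    have "(\<Sum>p\<in>Y. ?F p) = (\<Sum>p\<in>Y. - ?F p)"
    proof (rule sum.reindex_bij_witness[of _ "\<lambda>p. p \<circ> transpose a b" "\<lambda>p. p \<circ> transpose a b"], goal_cases)
      case (5 p)
      have "(s \<circ> (p \<circ> transpose a b)) ` S = (s \<circ> p) ` S"
        using trS by (metis comp_assoc image_comp)
      moreover have "(-1) ^ num_cycles S (s \<circ> (p \<circ> transpose a b)) = (- ((-1) ^ num_cycles S (s \<circ> p)) :: int)" if "(s \<circ> p) ` S = S"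
        using num_cycles_parity_transpose[OF finS that ab(1-3)] by (simp only: comp_assoc)
      ultimately show ?case by auto
    qed (use inv in \<open>auto simp: comp_assoc\<close>)
    then show "(\<Sum>p\<in>Y. ?F p) = 0" by (simp add: sum_negf)
  qed
  finally show ?thesis unfolding Y_def by (simp only: minus_zero)
qed

text \<open>\<open>q ^ num_cycles A p\<close> counts the q-colourings preserved by p. After the sums
  are exchanged, each colouring contributes a sum over its Young subgroup, and it uses fewer than h
  colours.\<close>

lemma sum_power_num_cycles_hook_char_eq_0:
  assumes "finite A" "s permutes A" "A \<noteq> {}" "q < h"
  shows "(\<Sum>p | p permutes A. int q ^ num_cycles A p * hook_char A h (s \<circ> p)) = 0"
proof -
  have fin: "finite {p. p permutes A}" using finite_permutations[OF assms(1)] .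
  have finE: "finite (A \<rightarrow>\<^sub>E {..<q})" using assms(1) by (intro finite_PiE) auto
  have "(\<Sum>p | p permutes A. int q ^ num_cycles A p * hook_char A h (s \<circ> p))
     = (\<Sum>p | p permutes A. \<Sum>f\<in>A \<rightarrow>\<^sub>E {..<q}. if \<forall>x\<in>A. f (p x) = f x then hook_char A h (s \<circ> p) else 0)"
  proof (rule sum.cong, goal_cases)
    case (2 p)
    then have "bij_betw p A A" by (simp add: permutes_imp_bij)
    from card_invariant_functions[OF assms(1) this, of "{..<q}"]
    have "card {f \<in> A \<rightarrow>\<^sub>E {..<q}. \<forall>x\<in>A. f (p x) = f x} = q ^ num_cycles A p" by simp
    then have "int q ^ num_cycles A p = int (card {f \<in> A \<rightarrow>\<^sub>E {..<q}. \<forall>x\<in>A. f (p x) = f x})" by simp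
    then show ?case
      using finE by (simp add: sum.inter_filter[symmetric])
  qed simp
  also have "\<dots> = (\<Sum>f\<in>A \<rightarrow>\<^sub>E {..<q}. \<Sum>p | p permutes A. if \<forall>x\<in>A. f (p x) = f x then hook_char A h (s \<circ> p) else 0)"
    by (rule sum.swap)
  also have "\<dots> = 0"
  proof (rule sum.neutral, rule ballI)
    fix f assume f: "f \<in> A \<rightarrow>\<^sub>E {..<q}"
    then have "card (f ` A) \<le> card {..<q}" by (intro card_mono) auto
    then have "card (f ` A) < h" using assms(4) by simp
    from sum_hook_char_young[OF assms(1-3) this]
    show "(\<Sum>p | p permutes A. if \<forall>x\<in>A. f (p x) = f x then hook_char A h (s \<circ> p) else 0) = 0"
      using fin by (simp add: sum.inter_filter[symmetric])
  qed
  finally show ?thesis .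
qed

text \<open>The remaining zeros come from transposing the hook: \<open>hook_char_dual\<close> for
  \<open>s \<circ> p\<close> absorbs the sign of \<open>(- int q) ^ num_cycles A p\<close>, and the
  bound on q says that it is smaller than \<open>card A + 1 - h\<close>, the index of the transposed
  hook.\<close>

lemma sum_neg_power_num_cycles_hook_char_eq_0:
  assumes "finite A" "s permutes A" "A \<noteq> {}" "h \<le> card A" "q \<le> card A - h"
  shows "(\<Sum>p | p permutes A. (- int q) ^ num_cycles A p * hook_char A h (s \<circ> p)) = 0"
proof -
  have "(- int q) ^ num_cycles A p * hook_char A h (s \<circ> p)
      = - ((-1) ^ num_cycles A s * (-1) ^ card A) * (int q ^ num_cycles A p * hook_char A (card A + 1 - h) (s \<circ> p))"
    if p: "p permutes A" for p
  proof -
    have sp: "(s \<circ> p) permutes A" using permutes_compose[OF p assms(2)] .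
    have "permutation s" "permutation p" using p assms(1,2) permutation_permutes by blast+
    then have "(-1) ^ num_cycles A (s \<circ> p) = ((-1) ^ num_cycles A s * (-1) ^ num_cycles A p * (-1) ^ card A :: int)"
      unfolding neg_one_power_num_cycles[OF assms(1) sp] neg_one_power_num_cycles[OF assms(1) p]
        neg_one_power_num_cycles[OF assms(1,2)] by (simp add: sign_compose flip: power_mult_distrib)
    then have "- hook_char A (card A + 1 - h) (s \<circ> p) 
        = ((-1) ^ num_cycles A s * (-1) ^ num_cycles A p * (-1) ^ card A) * hook_char A h (s \<circ> p)"
      using hook_char_dual[OF assms(1) sp assms(3,4)] by simp
    then have "((-1) ^ num_cycles A s * (-1) ^ card A) * - hook_char A (card A + 1 - h) (s \<circ> p)
        = (-1) ^ num_cycles A p * hook_char A h (s \<circ> p)"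
      by (simp add: algebra_simps flip: power_mult_distrib)
    then show ?thesis by (simp add: power_minus[of "int q"] algebra_simps)
  qed
  then have "(\<Sum>p | p permutes A. (- int q) ^ num_cycles A p * hook_char A h (s \<circ> p))
     = - ((-1) ^ num_cycles A s * (-1) ^ card A) * (\<Sum>p | p permutes A. int q ^ num_cycles A p * hook_char A (card A + 1 - h) (s \<circ> p))"
    unfolding sum_distrib_left by (intro sum.cong) auto
  also have "(\<Sum>p | p permutes A. int q ^ num_cycles A p * hook_char A (card A + 1 - h) (s \<circ> p)) = 0"
    by (rule sum_power_num_cycles_hook_char_eq_0) (use assms in auto)
  finally show ?thesis by (simp only: mult_zero_right)
qed

text \<open>For h from 1 to N the numbers j - h are the contents of the cells of the hook with N
  cells and h rows; they run from 1 - h to N - h. The values h = 0 and h = N + 1 belong to no hook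
  but occur as boundary terms of later sums.\<close>

definition content_prod :: "nat \<Rightarrow> nat \<Rightarrow> 'a::comm_ring_1 \<Rightarrow> 'a" where
  "content_prod N h y = (\<Prod>j=1..N. y + of_nat j - of_nat h)"

lemma degree_prod_linear: "degree (\<Prod>j\<in>J. [:c j, 1:] :: int poly) = card J"
proof (cases "finite J")
  case True
  then show ?thesis by (subst degree_prod_eq_sum_degree) auto
qed simp

text \<open>Both sides have degree at most n = \<open>card A\<close> and the same coefficient in
  degree n, because only the identity has n cycles. Their difference has the n distinct roots h - 1,
  ..., h - n, so it is zero.\<close>

lemma sum_num_cycles_hook_char_poly:
  assumes "finite A" "s permutes A" "A \<noteq> {}" "h \<le> card A"
  shows "(\<Sum>p | p permutes A. monom (hook_char A h (s \<circ> p)) (num_cycles A p))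
       = smult (hook_char A h s) (\<Prod>j=1..card A. [:int j - int h, 1:])"
    (is "?P = smult ?c ?Q")
proof -
  let ?n = "card A"
  have fin: "finite {p. p permutes A}" using finite_permutations[OF assms(1)] .
  have poly: "poly ?P x = (\<Sum>p | p permutes A. x ^ num_cycles A p * hook_char A h (s \<circ> p))" for x
    by (simp add: poly_sum poly_monom mult.commute)
  have monic: "coeff ?Q ?n = 1"
  proof -
    have "lead_coeff ?Q = 1" by (simp add: lead_coeff_prod)
    then show ?thesis by (simp add: degree_prod_linear)
  qed
  have coeffP: "coeff ?P ?n = ?c"
  proof -
    have "coeff ?P ?n = (\<Sum>p | p permutes A. if p = id then ?c else 0)"
      unfolding coeff_sum
    proof (rule sum.cong, goal_cases)
      case (2 p)
      then show ?case
        using num_cycles_eq_card_iff[OF assms(1), of p] by auto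
    qed simp
    then show ?thesis using fin by (simp add: permutes_id)
  qed
  define D where "D = ?P - smult ?c ?Q"
  have degP: "degree ?P \<le> ?n"
    by (rule degree_sum_le) (auto intro: fin degree_monom_le[THEN le_trans] num_cycles_le[OF assms(1)])
  have "degree D \<le> ?n" unfolding D_def
    by (rule degree_diff_le[OF degP]) (metis degree_prod_linear degree_smult_le card_atLeastAtMost diff_Suc_1)
  moreover have "coeff D ?n = 0" unfolding D_def using monic coeffP by simp
  ultimately have degD: "D = 0 \<or> degree D < ?n"
    by (metis le_neq_implies_less leading_coeff_0_iff)
  have roots: "poly D (int h - int j) = 0" if j: "j \<in> {1..?n}" for j
  proof -
    have "poly ?P (int h - int j) = 0"
    proof (cases "j \<le> h")
      case True
      then have "int h - int j = int (h - j)" by simp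
      then show ?thesis unfolding poly using j True
        sum_power_num_cycles_hook_char_eq_0[OF assms(1-3), of "h - j" h] by auto
    next
      case False
      then have "int h - int j = - int (j - h)" by simp
      then show ?thesis unfolding poly using j False
        sum_neg_power_num_cycles_hook_char_eq_0[OF assms(1-4), of "j - h"] by auto
    qed
    moreover have "poly ?Q (int h - int j) = 0"
      unfolding poly_prod by (rule prod_zero) (use j in auto)
    ultimately show ?thesis by (simp add: D_def)
  qed
  have "D = 0"
  proof (rule ccontr)
    assume "D \<noteq> 0"
    then have "finite {x. poly D x = 0}" "card {x. poly D x = 0} \<le> degree D"
      by (auto simp: poly_roots_finite card_poly_roots_bound)
    moreover have "(\<lambda>j. int h - int j) ` {1..?n} \<subseteq> {x. poly D x = 0}" using roots by auto
    ultimately have "card ((\<lambda>j. int h - int j) ` {1..?n}) \<le> degree D"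
      by (meson card_mono le_trans)
    moreover have "card ((\<lambda>j. int h - int j) ` {1..?n}) = ?n" by (subst card_image) (auto simp: inj_on_def)
    ultimately show False using degD \<open>D \<noteq> 0\<close> by simp
  qed
  then show ?thesis by (simp add: D_def)
qed

lemma poly_map_of_int_prod_linear:
  fixes y :: "'a::comm_ring_1"
  shows "poly (map_poly of_int (\<Prod>j\<in>J. [:c j, 1:])) y = (\<Prod>j\<in>J. y + of_int (c j))"
proof (induction J rule: infinite_finite_induct)
  case (insert j J)
  let ?p = "\<Prod>j\<in>J. [:c j, 1:]"
  have "map_poly of_int ([:c j, 1:] * ?p) = smult (of_int (c j) :: 'a) (map_poly of_int ?p) + pCons 0 (map_poly of_int ?p)"
    by (rule poly_eqI) (simp add: coeff_map_poly coeff_pCons split: nat.split)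
  then show ?case using insert by (simp add: algebra_simps)
qed simp_all

text \<open>An identity of integer polynomials can be evaluated in every commutative ring. It says
  that averaging against \<open>y ^ num_cycles A p\<close> acts on a hook character by the scalar
  \<open>content_prod\<close>.\<close>

lemma sum_num_cycles_hook_char:
  fixes y :: "'a::comm_ring_1"
  assumes "finite A" "s permutes A" "A \<noteq> {}" "h \<le> card A"
  shows "(\<Sum>p | p permutes A. y ^ num_cycles A p * of_int (hook_char A h (s \<circ> p)))
       = content_prod (card A) h y * of_int (hook_char A h s)"
proof -
  let ?P = "\<Sum>p | p permutes A. monom (hook_char A h (s \<circ> p)) (num_cycles A p)"
  have "map_poly of_int ?P = (\<Sum>p | p permutes A. monom (of_int (hook_char A h (s \<circ> p)) :: 'a) (num_cycles A p))"
    by (rule poly_eqI) (auto simp: coeff_map_poly coeff_sum intro!: sum.cong)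
  then have "(\<Sum>p | p permutes A. y ^ num_cycles A p * of_int (hook_char A h (s \<circ> p)))
      = poly (map_poly of_int ?P) y"
    by (simp add: poly_sum poly_monom mult.commute)
  also have "\<dots> = of_int (hook_char A h s) * poly (map_poly of_int (\<Prod>j=1..card A. [:int j - int h, 1:])) y"
    unfolding sum_num_cycles_hook_char_poly[OF assms] by (simp add: map_poly_smult)
  also have "poly (map_poly of_int (\<Prod>j=1..card A. [:int j - int h, 1:])) y = content_prod (card A) h y"
    unfolding poly_map_of_int_prod_linear content_prod_def by (simp add: algebra_simps)
  also have "of_int (hook_char A h s) * content_prod (card A) h y = content_prod (card A) h y * of_int (hook_char A h s)"
    by (rule mult.commute)
  finally show ?thesis .
qed

text \<open>The branching rule for hooks: a stable set either omits a or contains the singleton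
  cycle of a, which costs one element and one sign.\<close>

lemma hook_char_insert_fixed:
  assumes "finite A" "s permutes A" "a \<notin> A"
  shows "hook_char (insert a A) (Suc h) s = hook_char A (Suc h) s - hook_char A h s"
proof -
  have sa: "s a = a" using assms by (simp add: permutes_def)
  let ?X = "\<lambda>h. {S. S \<subseteq> A \<and> s ` S = S \<and> card S < h}"
  have fin: "finite (?X h)" for h
    by (rule finite_subset[of _ "Pow A"]) (use assms in auto)
  have "{S. S \<subseteq> insert a A \<and> s ` S = S \<and> card S < Suc h} = ?X (Suc h) \<union> insert a ` ?X h" (is "?L = ?R")
  proof
    show "?L \<subseteq> ?R"
    proof
      fix S assume S: "S \<in> ?L"
      then have finS: "finite S" using assms(1) finite_subset[of S "insert a A"] by simp
      show "S \<in> ?R"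
      proof (cases "a \<in> S")
        case True
        then have "s ` (S - {a}) = S - {a}"
          using S sa image_set_diff[OF permutes_inj[OF assms(2)], of S "{a}"] by simp
        moreover have "card (S - {a}) < h" using S card_Suc_Diff1[OF finS True] by simp
        ultimately have "S - {a} \<in> ?X h" using S by blast
        moreover have "S = insert a (S - {a})" using True by blast
        ultimately show ?thesis by blast
      qed (use S in auto)
    qed
    show "?R \<subseteq> ?L"
      using sa assms(1) by (auto simp: card_insert_if finite_subset)
  qed
  moreover have "?X (Suc h) \<inter> insert a ` ?X h = {}" using assms(3) by auto
  moreover have "inj_on (insert a) (?X h)" using assms(3) by (auto simp: inj_on_def)
  moreover have "(\<Sum>S\<in>?X h. (-1) ^ num_cycles (insert a S) s) = - hook_char A h s"
    unfolding hook_char_def sum_negf[symmetric]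
  proof (rule sum.cong, goal_cases)
    case S: (2 S)
    then have "finite S" "a \<notin> S" using assms(1,3) finite_subset by blast+
    then have "num_cycles (insert a S) s = num_cycles S s + 1"
      using S sa by (intro num_cycles_insert_fixed stable_bij_betw) auto
    then show ?case by simp
  qed simp
  ultimately show ?thesis
    unfolding hook_char_def using fin by (simp add: sum.union_disjoint sum.reindex)
qed

lemma num_cycles_id: "finite S \<Longrightarrow> num_cycles S id = card S"
  using num_cycles_eq_card_iff[of S id] permutes_id by blast

text \<open>Up to sign, the dimension of a hook. For the identity every subset is stable, and the
  branching rule at one point leaves only the h-element subsets of the remaining points.\<close>

lemma hook_char_id:
  assumes "finite A" "A \<noteq> {}"
  shows "hook_char A (Suc h) id = (-1) ^ h * int ((card A - 1) choose h)"
proof -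
  obtain a B where B: "A = insert a B" "a \<notin> B" using assms(2) by (metis Set.set_insert ex_in_conv)
  then have finB: "finite B" using assms(1) by simp
  have c: "card A - 1 = card B" using B finB by simp
  have eq: "{S. S \<subseteq> B \<and> card S < Suc h} = {S. S \<subseteq> B \<and> card S < h} \<union> {S. S \<subseteq> B \<and> card S = h}" by auto
  have fin: "finite {S. S \<subseteq> B \<and> P S}" for P
    by (rule finite_subset[of _ "Pow B"]) (use finB in auto)
  have "hook_char B (Suc h) id = hook_char B h id + (\<Sum>S | S \<subseteq> B \<and> card S = h. (-1) ^ num_cycles S id)"
    unfolding hook_char_def image_id id_apply simp_thms eq using fin by (subst sum.union_disjoint) auto
  also have "(\<Sum>S | S \<subseteq> B \<and> card S = h. (-1) ^ num_cycles S id) = (\<Sum>S | S \<subseteq> B \<and> card S = h. (-1::int) ^ h)"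
  proof (rule sum.cong, goal_cases)
    case (2 S)
    then have "finite S" "card S = h" using finB finite_subset by auto
    then show ?case using num_cycles_id by metis
  qed simp
  also have "\<dots> = (-1) ^ h * int (card B choose h)" using n_subsets[OF finB, of h] by simp
  finally show ?thesis
    using hook_char_insert_fixed[OF finB permutes_id B(2), of h] unfolding c unfolding B(1) by linarith
qed

section \<open>Factorizations in the symmetric group\<close>

text \<open>The product reads from left to right, so \<open>u k\<close> acts first; this agrees with
  the multiplication of pairs.\<close>

definition perm_prod :: "nat \<Rightarrow> (nat \<Rightarrow> 'a \<Rightarrow> 'a) \<Rightarrow> 'a \<Rightarrow> 'a" where
  "perm_prod k u = foldr (\<circ>) (map u [1..<Suc k]) id"

lemma foldr_comp_append: "foldr (\<circ>) xs g = foldr (\<circ>) xs id \<circ> g"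
  by (induction xs) (simp_all add: fun_eq_iff)

lemma perm_prod_0 [simp]: "perm_prod 0 u = id"
  by (simp add: perm_prod_def)

lemma perm_prod_Suc: "perm_prod (Suc k) u = perm_prod k u \<circ> u (Suc k)"
  unfolding perm_prod_def using foldr_comp_append[of "map u [1..<Suc k]" "u (Suc k)"] by simp

lemma perm_prod_cong: "(\<And>i. i \<in> {1..k} \<Longrightarrow> u i = v i) \<Longrightarrow> perm_prod k u = perm_prod k v"
  by (induction k) (simp_all add: perm_prod_Suc)

lemma perm_prod_upd [simp]: "perm_prod k (u(Suc k := p)) = perm_prod k u"
  by (rule perm_prod_cong) auto

lemma perm_prod_permutes:
  "(\<And>i. i \<in> {1..k} \<Longrightarrow> u i permutes A) \<Longrightarrow> perm_prod k u permutes A"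
  by (induction k) (auto simp: perm_prod_Suc permutes_id intro!: permutes_compose)

lemma sum_PiE_Suc:
  "(\<Sum>u\<in>PiE {1..Suc k} U. F u) = (\<Sum>u\<in>PiE {1..k} U. \<Sum>p\<in>U (Suc k). F (u(Suc k := p)))"
proof -
  have eq: "{1..Suc k} = insert (Suc k) {1..k}" by auto
  have inj: "inj_on (\<lambda>(y, g). g(Suc k := y)) (U (Suc k) \<times> PiE {1..k} U)"
    using inj_combinator[of "Suc k" "{1..k}" U] by simp
  have "(\<Sum>u\<in>PiE {1..Suc k} U. F u) = (\<Sum>(p, u)\<in>U (Suc k) \<times> PiE {1..k} U. F (u(Suc k := p)))"
    unfolding eq PiE_insert_eq sum.reindex[OF inj] by (simp add: case_prod_unfold)
  also have "\<dots> = (\<Sum>p\<in>U (Suc k). \<Sum>u\<in>PiE {1..k} U. F (u(Suc k := p)))"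
    by (rule sum.cartesian_product[symmetric])
  also have "\<dots> = (\<Sum>u\<in>PiE {1..k} U. \<Sum>p\<in>U (Suc k). F (u(Suc k := p)))"
    by (rule sum.swap)
  finally show ?thesis .
qed

lemma prod_upd_Suc:
  "(\<Prod>i=1..Suc k. y i ^ num_cycles A ((u(Suc k := p)) i))
    = (\<Prod>i=1..k. y i ^ num_cycles A (u i)) * (y (Suc k) :: 'r::comm_monoid_mult) ^ num_cycles A p"
  by simp

text \<open>Summation over the last factor multiplies the hook character by its eigenvalue and
  leaves the same sum with one factor less.\<close>

lemma sum_perm_prod_hook_char:
  fixes y :: "nat \<Rightarrow> 'r::comm_ring_1"
  assumes "finite A" "A \<noteq> {}" "h \<le> card A"
  shows "(\<Sum>u\<in>{1..k} \<rightarrow>\<^sub>E {p. p permutes A}.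
            (\<Prod>i=1..k. y i ^ num_cycles A (u i)) * of_int (hook_char A h (perm_prod k u)))
       = (\<Prod>i=1..k. content_prod (card A) h (y i)) * of_int (hook_char A h id)"
proof (induction k)
  case 0
  then show ?case by simp
next
  case (Suc k)
  have "(\<Sum>u\<in>{1..Suc k} \<rightarrow>\<^sub>E {p. p permutes A}.
            (\<Prod>i=1..Suc k. y i ^ num_cycles A (u i)) * of_int (hook_char A h (perm_prod (Suc k) u)))
     = (\<Sum>u\<in>{1..k} \<rightarrow>\<^sub>E {p. p permutes A}. (\<Prod>i=1..k. y i ^ num_cycles A (u i)) *
          (\<Sum>p | p permutes A. y (Suc k) ^ num_cycles A p * of_int (hook_char A h (perm_prod k u \<circ> p))))"
    unfolding sum_PiE_Suc perm_prod_Suc prod_upd_Suc perm_prod_upd fun_upd_same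
    by (simp only: sum_distrib_left mult.assoc)
  also have "\<dots> = (\<Sum>u\<in>{1..k} \<rightarrow>\<^sub>E {p. p permutes A}. (\<Prod>i=1..k. y i ^ num_cycles A (u i)) *
          (content_prod (card A) h (y (Suc k)) * of_int (hook_char A h (perm_prod k u))))"
  proof (rule sum.cong[OF refl], goal_cases)
    case (1 u)
    then have "perm_prod k u permutes A" by (intro perm_prod_permutes) auto
    from sum_num_cycles_hook_char[OF assms(1) this assms(2,3), of "y (Suc k)"]
    show ?case
      by (simp only:)
  qed
  also have "\<dots> = content_prod (card A) h (y (Suc k)) * (\<Sum>u\<in>{1..k} \<rightarrow>\<^sub>E {p. p permutes A}.
            (\<Prod>i=1..k. y i ^ num_cycles A (u i)) * of_int (hook_char A h (perm_prod k u)))"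
    unfolding sum_distrib_left by (simp add: mult_ac)
  also have "\<dots> = (\<Prod>i=1..Suc k. content_prod (card A) h (y i)) * of_int (hook_char A h id)"
    unfolding Suc.IH by (simp add: mult_ac)
  finally show ?case .
qed

section \<open>Tuples of permutations in which some factor moves a marked point\<close>

lemma sum_permutes_moving:
  assumes "finite M" "a \<notin> M"
  shows "(\<Sum>p | p permutes insert a M \<and> p a \<noteq> a. g p)
       = (\<Sum>q | q permutes M. \<Sum>r\<in>M. g (transpose a r \<circ> q))"
proof -
  have fin: "finite {p. p permutes insert a M}" using assms(1) by (simp add: finite_permutations)
  have "(\<Sum>p | p permutes insert a M \<and> p a \<noteq> a. g p)
      = (\<Sum>p | p permutes insert a M. if p a \<noteq> a then g p else 0)"
    using sum.inter_filter[OF fin, of g "\<lambda>p. p a \<noteq> a"] by simp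
  also have "\<dots> = (\<Sum>r\<in>insert a M. \<Sum>q | q permutes M.
      if (transpose a r \<circ> q) a \<noteq> a then g (transpose a r \<circ> q) else 0)"
    by (rule sum_over_permutations_insert[OF assms])
  also have "\<dots> = (\<Sum>r\<in>insert a M. if r = a then 0 else \<Sum>q | q permutes M. g (transpose a r \<circ> q))"
  proof (intro sum.cong refl)
    fix r assume r: "r \<in> insert a M"
    have "(transpose a r \<circ> q) a = r" if "q permutes M" for q
      using that assms(2) by (simp add: permutes_not_in)
    then show "(\<Sum>q | q permutes M. if (transpose a r \<circ> q) a \<noteq> a then g (transpose a r \<circ> q) else 0)
       = (if r = a then 0 else \<Sum>q | q permutes M. g (transpose a r \<circ> q))"
      by (auto intro!: sum.cong sum.neutral)
  qed
  also have "\<dots> = (\<Sum>r\<in>M. \<Sum>q | q permutes M. g (transpose a r \<circ> q))"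
    using assms by (auto intro!: sum.cong)
  finally show ?thesis by (subst sum.swap)
qed

lemma content_prod_Suc: "content_prod (Suc m) h y = content_prod m h y * (y + of_nat (Suc m) - of_nat h)"
  by (simp add: content_prod_def)

text \<open>The smallest content \<open>- h\<close> is split off here, the largest one in
  \<open>content_prod_Suc\<close>. Both forms of the same product are needed for the cancellation in
  \<open>moving_sum_hook_char\<close>.\<close>

lemma content_prod_Suc':
  "content_prod (Suc m) (Suc h) y = (y - of_nat h) * content_prod m h (y :: 'a::comm_ring_1)"
  unfolding content_prod_def prod.atLeast_Suc_atMost_Suc_shift[symmetric]
  by (subst prod.atLeast_Suc_atMost)
     (auto simp: prod.shift_bounds_cl_Suc_ivl algebra_simps simp del: prod.cl_ivl_Suc)

lemma permutes_insert_fixed_iff: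
  "a \<notin> M \<Longrightarrow> (p permutes insert a M \<and> p a = a) \<longleftrightarrow> p permutes M"
  by (metis insertE insertI1 permutes_not_in permutes_superset permutes_subset subset_insertI insert_iff Diff_iff)

text \<open>The test function \<phi> of the product is arbitrary so that the average over the last
  factor can be absorbed into it.\<close>

definition moving_sum :: "'a \<Rightarrow> 'a set \<Rightarrow> nat \<Rightarrow> (nat \<Rightarrow> 'r::comm_ring_1) \<Rightarrow> (('a \<Rightarrow> 'a) \<Rightarrow> 'r) \<Rightarrow> 'r" where
  "moving_sum a M k y \<phi> =
    (\<Sum>u\<in>{1..k} \<rightarrow>\<^sub>E {p. p permutes insert a M}. if \<exists>i\<in>{1..k}. u i a \<noteq> a
      then (\<Prod>i=1..k. y i ^ num_cycles (insert a M) (u i)) * \<phi> (perm_prod k u) else 0)"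

text \<open>Either one of the first k factors moves a, and the last factor is then free and becomes
  an average inside \<phi>; or only the last factor moves a. In the second case the earlier factors
  are permutations of M with the extra cycle of a, which accounts for the product of the
  \<open>y i\<close>, and the last is a transposition times a permutation of M with equally many
  cycles.\<close>

lemma moving_sum_Suc:
  assumes "finite M" "a \<notin> M"
  shows "moving_sum a M (Suc k) y \<phi> =
     moving_sum a M k y (\<lambda>s. \<Sum>p | p permutes insert a M. y (Suc k) ^ num_cycles (insert a M) p * \<phi> (s \<circ> p))
   + (\<Prod>i=1..k. y i) * (\<Sum>u\<in>{1..Suc k} \<rightarrow>\<^sub>E {p. p permutes M}.
       (\<Prod>i=1..Suc k. y i ^ num_cycles M (u i)) * (\<Sum>r\<in>M. \<phi> (transpose a r \<circ> perm_prod (Suc k) u)))"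
proof -
  let ?A = "insert a M"
  let ?w = "\<lambda>u. \<Prod>i=1..k. y i ^ num_cycles ?A (u i)"
  let ?Z = "\<lambda>s. \<Sum>p | p permutes ?A. y (Suc k) ^ num_cycles ?A p * \<phi> (s \<circ> p)"
  let ?G = "\<lambda>s p. y (Suc k) ^ num_cycles ?A p * \<phi> (s \<circ> p)"
  let ?K = "\<lambda>s. \<Sum>p | p permutes ?A \<and> p a \<noteq> a. ?G s p"
  have finA: "finite {p. p permutes ?A}" using assms(1) by (simp add: finite_permutations)
  have finU: "finite ({1..k} \<rightarrow>\<^sub>E {p. p permutes ?A})" using finA by (intro finite_PiE) auto
  have ex: "(\<exists>i\<in>{1..Suc k}. (u(Suc k := p)) i a \<noteq> a) \<longleftrightarrow> (\<exists>i\<in>{1..k}. u i a \<noteq> a) \<or> p a \<noteq> a" for u :: "nat \<Rightarrow> 'a \<Rightarrow> 'a" and p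
  proof -
    have "{1..Suc k} = insert (Suc k) {1..k}" by auto
    then show ?thesis by auto
  qed
  have "moving_sum a M (Suc k) y \<phi> = (\<Sum>u\<in>{1..k} \<rightarrow>\<^sub>E {p. p permutes ?A}. \<Sum>p | p permutes ?A.
      if (\<exists>i\<in>{1..k}. u i a \<noteq> a) \<or> p a \<noteq> a then ?w u * ?G (perm_prod k u) p else 0)"
    unfolding moving_sum_def sum_PiE_Suc ex perm_prod_Suc prod_upd_Suc perm_prod_upd fun_upd_same
    by (simp only: mult.assoc)
  also have "\<dots> = (\<Sum>u\<in>{1..k} \<rightarrow>\<^sub>E {p. p permutes ?A}.
      (if \<exists>i\<in>{1..k}. u i a \<noteq> a then ?w u * ?Z (perm_prod k u) else 0)
      + (if \<exists>i\<in>{1..k}. u i a \<noteq> a then 0 else ?w u * ?K (perm_prod k u)))"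
  proof (rule sum.cong[OF refl], goal_cases)
    case (1 u)
    show ?case
    proof (cases "\<exists>i\<in>{1..k}. u i a \<noteq> a")
      case True
      then show ?thesis by (simp only: True simp_thms if_True sum_distrib_left add_0_right)
    next
      case False
      have "?K (perm_prod k u) = (\<Sum>p | p permutes ?A. if p a \<noteq> a then ?G (perm_prod k u) p else 0)"
        using sum.inter_filter[OF finA, of "?G (perm_prod k u)" "\<lambda>p. p a \<noteq> a"] by simp
      then show ?thesis using False
        by (simp only: False simp_thms if_False sum_distrib_left add_0_left if_distrib[of "(*) (?w u)"] mult_zero_right)
    qed
  qed
  also have "\<dots> = moving_sum a M k y ?Z +
     (\<Sum>u\<in>{1..k} \<rightarrow>\<^sub>E {p. p permutes ?A}. if \<exists>i\<in>{1..k}. u i a \<noteq> a then 0 else ?w u * ?K (perm_prod k u))"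
    unfolding moving_sum_def by (rule sum.distrib)
  also have "(\<Sum>u\<in>{1..k} \<rightarrow>\<^sub>E {p. p permutes ?A}. if \<exists>i\<in>{1..k}. u i a \<noteq> a then 0 else ?w u * ?K (perm_prod k u))
    = (\<Sum>u\<in>{1..k} \<rightarrow>\<^sub>E {p. p permutes M}. ?w u * ?K (perm_prod k u))"
  proof -
    have "{u \<in> {1..k} \<rightarrow>\<^sub>E {p. p permutes ?A}. \<forall>i\<in>{1..k}. u i a = a} = {1..k} \<rightarrow>\<^sub>E {p. p permutes M}"
      using permutes_insert_fixed_iff[OF assms(2)] unfolding PiE_def Pi_def by blast
    then show ?thesis using sum.inter_filter[OF finU, of "\<lambda>u. ?w u * ?K (perm_prod k u)" "\<lambda>u. \<forall>i\<in>{1..k}. u i a = a"]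
      by (simp add: if_not_P cong: if_cong) (auto intro!: sum.cong)
  qed
  also have "\<dots> = (\<Sum>u\<in>{1..k} \<rightarrow>\<^sub>E {p. p permutes M}. \<Sum>q | q permutes M.
      (\<Prod>i=1..k. y i) * (((\<Prod>i=1..k. y i ^ num_cycles M (u i)) * y (Suc k) ^ num_cycles M q) *
        (\<Sum>r\<in>M. \<phi> (transpose a r \<circ> (perm_prod k u \<circ> q)))))"
  proof (rule sum.cong[OF refl], goal_cases)
    case u: (1 u)
    have w: "?w u = (\<Prod>i=1..k. y i) * (\<Prod>i=1..k. y i ^ num_cycles M (u i))"
      unfolding prod.distrib[symmetric]
    proof (rule prod.cong[OF refl], goal_cases)
      case (1 i)
      then have "u i permutes M" using u by auto
      then have "num_cycles ?A (u i) = num_cycles M (u i) + 1"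
        using assms by (intro num_cycles_insert_fixed) (auto simp: permutes_imp_bij permutes_not_in)
      then show ?case by simp
    qed
    have P: "perm_prod k u permutes M" using u by (intro perm_prod_permutes) auto
    let ?P = "perm_prod k u"
    have "?K ?P = (\<Sum>q | q permutes M. \<Sum>r\<in>M. ?G ?P (transpose a r \<circ> q))"
      by (rule sum_permutes_moving[OF assms])
    also have "\<dots> = (\<Sum>q | q permutes M. y (Suc k) ^ num_cycles M q * (\<Sum>r\<in>M. \<phi> (transpose a r \<circ> (?P \<circ> q))))"
    proof (rule sum.cong[OF refl], goal_cases)
      case (1 q)
      then have q: "q permutes M" by simp
      have "(\<Sum>r\<in>M. ?G ?P (transpose a r \<circ> q)) = y (Suc k) ^ num_cycles M q * (\<Sum>r\<in>M. \<phi> (transpose a (?P r) \<circ> (?P \<circ> q)))"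
        unfolding sum_distrib_left
      proof (rule sum.cong[OF refl], goal_cases)
        case r: (1 r)
        \<comment> \<open>The transposition is conjugated past the product of the earlier factors.
          That product fixes a, so only r changes, and the sum over r is reindexed below.\<close>
        have "?P \<circ> transpose a r = transpose (?P a) (?P r) \<circ> ?P"
          using inj_eq[OF permutes_inj[OF P]] by (simp add: fun_eq_iff transpose_def)
        moreover have "?P a = a" using P assms(2) by (simp add: permutes_not_in)
        ultimately have "?P \<circ> (transpose a r \<circ> q) = transpose a (?P r) \<circ> (?P \<circ> q)"
          by (simp only: comp_assoc[symmetric])
        then show ?case
          using num_cycles_insert_transpose[OF assms(1) q assms(2) r] by (simp only:)
      qed
      also have "(\<Sum>r\<in>M. \<phi> (transpose a (?P r) \<circ> (?P \<circ> q))) = (\<Sum>r\<in>M. \<phi> (transpose a r \<circ> (?P \<circ> q)))"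
        by (rule sum.reindex_bij_betw[OF permutes_imp_bij[OF P], of "\<lambda>r. \<phi> (transpose a r \<circ> (?P \<circ> q))"])
      finally show ?case .
    qed
    finally show ?case
      unfolding w mult.assoc by (simp only: sum_distrib_left[of _ "\<lambda>q. y (Suc k) ^ num_cycles M q * (\<Sum>r\<in>M. \<phi> (transpose a r \<circ> (perm_prod k u \<circ> q)))"]
        sum_distrib_left[of _ "\<lambda>q. (\<Prod>i=1..k. y i ^ num_cycles M (u i)) * (y (Suc k) ^ num_cycles M q * (\<Sum>r\<in>M. \<phi> (transpose a r \<circ> (perm_prod k u \<circ> q))))"])
  qed
  also have "\<dots> = (\<Prod>i=1..k. y i) * (\<Sum>u\<in>{1..Suc k} \<rightarrow>\<^sub>E {p. p permutes M}.
       (\<Prod>i=1..Suc k. y i ^ num_cycles M (u i)) * (\<Sum>r\<in>M. \<phi> (transpose a r \<circ> perm_prod (Suc k) u)))"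
    unfolding sum_PiE_Suc perm_prod_Suc prod_upd_Suc perm_prod_upd fun_upd_same
    by (simp only: sum_distrib_left)
  finally show ?thesis .
qed

lemma mult_rearrange:
  assumes "m * c = a * (b :: 'r::comm_ring_1)"
  shows "m * (P * (e * c)) = e * b * (a * P)"
proof -
  have "m * (P * (e * c)) = (m * c) * (e * P)" by (simp only: mult_ac)
  also have "\<dots> = e * b * (a * P)" unfolding assms by (simp only: mult_ac)
  finally show ?thesis .
qed

text \<open>
  The first factor moving \<open>a\<close> is \<open>transpose a r \<circ> q\<close> with \<open>q\<close> fixing \<open>a\<close>, and the transposition
  can be pulled out to the left. The hypothesis on \<open>\<phi>\<close> is therefore all that is needed, and it is
  preserved by the averaging over the last factor.
\<close>

lemma moving_sum_hook_char:
  fixes y :: "nat \<Rightarrow> 'r::comm_ring_1"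
  assumes "finite M" "a \<notin> M" "M \<noteq> {}"
    and "\<And>s. s permutes insert a M \<Longrightarrow>
      (\<Sum>r\<in>M. \<phi> (transpose a r \<circ> s)) = (\<Sum>h=0..card M. c h * of_int (hook_char (insert a M) (Suc h) s))"
  shows "of_nat (card M) * moving_sum a M k y \<phi> =
    (\<Sum>h=0..card M. c h * (-1) ^ h * of_nat (card M choose h) *
      ((\<Prod>i=1..k. y i * content_prod (card M) h (y i)) - (\<Prod>i=1..k. y i * content_prod (card M) (Suc h) (y i))))"
  using assms(4)
proof (induction k arbitrary: \<phi> c)
  case 0
  then show ?case by (simp add: moving_sum_def)
next
  case (Suc k)
  let ?A = "insert a M" and ?m = "card M" and ?y = "y (Suc k)"
  let ?Y = "\<lambda>h. \<Prod>i=1..k. y i * content_prod ?m h (y i)"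
  define Z where "Z = (\<lambda>s. \<Sum>p | p permutes ?A. ?y ^ num_cycles ?A p * \<phi> (s \<circ> p))"
  define \<kappa> :: "nat \<Rightarrow> 'r" where "\<kappa> h = (-1) ^ h * of_nat (?m choose h)" for h
  have cA: "card ?A = Suc ?m" using assms by simp
  have finA: "finite ?A" using assms by simp
  \<comment> \<open>The averaged function satisfies the hypothesis again: each coefficient
    \<open>c h\<close> is multiplied by the eigenvalue for the hook with \<open>Suc h\<close> rows
    on \<open>insert a M\<close>.\<close>
  have Z: "(\<Sum>r\<in>M. Z (transpose a r \<circ> s)) = (\<Sum>h=0..?m. (c h * content_prod (Suc ?m) (Suc h) ?y) * of_int (hook_char ?A (Suc h) s))"
    if s: "s permutes ?A" for s
  proof -
    have "(\<Sum>r\<in>M. Z (transpose a r \<circ> s)) = (\<Sum>p | p permutes ?A. ?y ^ num_cycles ?A p * (\<Sum>r\<in>M. \<phi> (transpose a r \<circ> (s \<circ> p))))"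
      unfolding Z_def sum_distrib_left comp_assoc by (rule sum.swap)
    also have "\<dots> = (\<Sum>p | p permutes ?A. \<Sum>h=0..?m. c h * (?y ^ num_cycles ?A p * of_int (hook_char ?A (Suc h) (s \<circ> p))))"
    proof (rule sum.cong[OF refl], goal_cases)
      case (1 p)
      then have "(s \<circ> p) permutes ?A" using s permutes_compose by blast
      from Suc.prems[OF this] show ?case
        by (simp only: sum_distrib_left mult.left_commute)
    qed
    also have "\<dots> = (\<Sum>h=0..?m. c h * (\<Sum>p | p permutes ?A. ?y ^ num_cycles ?A p * of_int (hook_char ?A (Suc h) (s \<circ> p))))"
      unfolding sum_distrib_left by (rule sum.swap)
    also have "\<dots> = (\<Sum>h=0..?m. c h * (content_prod (Suc ?m) (Suc h) ?y * of_int (hook_char ?A (Suc h) s)))"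
    proof (rule sum.cong[OF refl], goal_cases)
      case (1 h)
      then have "Suc h \<le> card ?A" using cA by simp
      from sum_num_cycles_hook_char[OF finA s _ this, of ?y]
      show ?case
        by (simp only: cA insert_not_empty not_False_eq_True simp_thms)
    qed
    finally show ?thesis by (simp only: mult.assoc)
  qed
  have IH: "of_nat ?m * moving_sum a M k y Z
      = (\<Sum>h=0..?m. c h * content_prod (Suc ?m) (Suc h) ?y * (-1) ^ h * of_nat (?m choose h) * (?Y h - ?Y (Suc h)))"
    by (rule Suc.IH[OF Z])
  \<comment> \<open>\<open>W h\<close> is the sum over tuples on M tested with a hook character of
    M. By the branching rule a hook character of \<open>insert a M\<close> contributes
    \<open>W (Suc h) - W h\<close>.\<close>
  define W where "W h = (\<Sum>u\<in>{1..Suc k} \<rightarrow>\<^sub>E {p. p permutes M}.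
     (\<Prod>i=1..Suc k. y i ^ num_cycles M (u i)) * of_int (hook_char M h (perm_prod (Suc k) u)))" for h
  have tail: "(\<Sum>u\<in>{1..Suc k} \<rightarrow>\<^sub>E {p. p permutes M}.
       (\<Prod>i=1..Suc k. y i ^ num_cycles M (u i)) * (\<Sum>r\<in>M. \<phi> (transpose a r \<circ> perm_prod (Suc k) u)))
     = (\<Sum>h=0..?m. c h * (W (Suc h) - W h))"
  proof -
    have "(\<Sum>u\<in>{1..Suc k} \<rightarrow>\<^sub>E {p. p permutes M}.
       (\<Prod>i=1..Suc k. y i ^ num_cycles M (u i)) * (\<Sum>r\<in>M. \<phi> (transpose a r \<circ> perm_prod (Suc k) u)))
      = (\<Sum>u\<in>{1..Suc k} \<rightarrow>\<^sub>E {p. p permutes M}. \<Sum>h=0..?m. c h *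
       ((\<Prod>i=1..Suc k. y i ^ num_cycles M (u i)) * of_int (hook_char M (Suc h) (perm_prod (Suc k) u))
      - (\<Prod>i=1..Suc k. y i ^ num_cycles M (u i)) * of_int (hook_char M h (perm_prod (Suc k) u))))"
    proof (rule sum.cong[OF refl], goal_cases)
      case u: (1 u)
      then have P: "perm_prod (Suc k) u permutes M" by (intro perm_prod_permutes) auto
      then have "perm_prod (Suc k) u permutes ?A" by (rule permutes_imp_permutes_insert)
      from Suc.prems[OF this]
      show ?case
        by (simp only: hook_char_insert_fixed[OF assms(1) P assms(2)] of_int_diff sum_distrib_left
            right_diff_distrib mult.left_commute)
    qed
    also have "\<dots> = (\<Sum>h=0..?m. c h * (W (Suc h) - W h))"
      unfolding W_def sum_subtractf[symmetric] sum_distrib_left by (rule sum.swap)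
    finally show ?thesis .
  qed
  have W: "W h = (\<Prod>i=1..Suc k. content_prod ?m h (y i)) * of_int (hook_char M h id)" if "h \<le> ?m" for h
    unfolding W_def by (rule sum_perm_prod_hook_char[OF assms(1,3) that])
  \<comment> \<open>The index \<open>Suc (card M)\<close> lies outside the range of the averaging
    formula. The hook character is zero there, because no subset of M has more than
    \<open>card M\<close> elements.\<close>
  have Wtop: "W (Suc ?m) = 0"
  proof -
    have "hook_char M (Suc ?m) s = 0" if "s permutes M" for s
    proof -
      have "{S. S \<subseteq> M \<and> s ` S = S \<and> Suc ?m \<le> card S} = {}"
        by (auto dest!: card_mono[OF assms(1)])
      then show ?thesis using hook_char_compl[OF assms(1) that assms(3), of "Suc ?m"]
        by (simp only: sum.empty minus_zero)
    qed
    then show ?thesis unfolding W_def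
    proof (intro sum.neutral ballI)
      fix u assume "u \<in> {1..Suc k} \<rightarrow>\<^sub>E {p. p permutes M}"
      then have "perm_prod (Suc k) u permutes M" by (intro perm_prod_permutes) auto
      then have "hook_char M (Suc ?m) (perm_prod (Suc k) u) = 0" by (rule \<open>\<And>s. s permutes M \<Longrightarrow> hook_char M (Suc ?m) s = 0\<close>)
      then show "(\<Prod>i=1..Suc k. y i ^ num_cycles M (u i)) * of_int (hook_char M (Suc ?m) (perm_prod (Suc k) u)) = 0"
        by (simp only: of_int_0 mult_zero_right)
    qed
  qed
  \<comment> \<open>Multiplication by m = \<open>card M\<close> turns the dimensions, binomials of m
    - 1, into binomials of m: m C(m-1,h) = (m-h) C(m,h) and m C(m-1,h-1) = h C(m,h).\<close>
  have mW: "of_nat ?m * (W (Suc h) - W h) = \<kappa> h * (of_nat (?m - h) * (\<Prod>i=1..Suc k. content_prod ?m (Suc h) (y i))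
       + of_nat h * (\<Prod>i=1..Suc k. content_prod ?m h (y i)))" if h: "h \<le> ?m" for h
  proof -
    have m: "?m > 0" using assms(1,3) by (simp add: card_gt_0_iff)
    have 1: "of_nat ?m * W (Suc h) = \<kappa> h * (of_nat (?m - h) * (\<Prod>i=1..Suc k. content_prod ?m (Suc h) (y i)))"
    proof (cases "h = ?m")
      case True
      then show ?thesis using Wtop by simp
    next
      case False
      then have h': "Suc h \<le> ?m" using h by simp
      have "?m * ((?m - 1) choose h) = (?m - h) * (?m choose h)"
        using m binomial_absorb_comp[of ?m h] by simp
      then have "(of_nat ?m * of_nat ((?m - 1) choose h) :: 'r) = of_nat (?m - h) * of_nat (?m choose h)"
        by (metis of_nat_mult)
      then show ?thesis
        unfolding W[OF h'] hook_char_id[OF assms(1,3)] \<kappa>_def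
          of_int_mult of_int_power of_int_minus of_int_1 of_int_of_nat_eq
        by (rule mult_rearrange)
    qed
    have 2: "- (of_nat ?m * W h) = \<kappa> h * (of_nat h * (\<Prod>i=1..Suc k. content_prod ?m h (y i)))"
    proof (cases h)
      case 0
      then show ?thesis using W[OF h] by (simp add: hook_char_def)
    next
      case (Suc g)
      have "?m * ((?m - 1) choose g) = h * (?m choose h)"
        using m Suc binomial_absorption[of g ?m] by simp
      then have "(of_nat ?m * of_nat ((?m - 1) choose g) :: 'r) = of_nat h * of_nat (?m choose h)"
        by (metis of_nat_mult)
      then show ?thesis
        unfolding W[OF h] \<kappa>_def unfolding Suc hook_char_id[OF assms(1,3)]
          of_int_mult of_int_power of_int_minus of_int_1 of_int_of_nat_eq power_Suc
          mult_minus1 mult_minus_left neg_equal_iff_equal mult_1 by (rule mult_rearrange)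
    qed
    show ?thesis unfolding right_diff_distrib distrib_left 1 2[symmetric] by (rule diff_conv_add_uminus)
  qed
  have "of_nat ?m * moving_sum a M (Suc k) y \<phi> = of_nat ?m * moving_sum a M k y Z +
      (\<Sum>h=0..?m. c h * ((\<Prod>i=1..k. y i) * (of_nat ?m * (W (Suc h) - W h))))"
    unfolding moving_sum_Suc[OF assms(1,2)] Z_def[symmetric] tail
    by (simp only: distrib_left sum_distrib_left mult_ac)
  also have "\<dots> = (\<Sum>h=0..?m. c h * content_prod (Suc ?m) (Suc h) ?y * (-1) ^ h * of_nat (?m choose h) * (?Y h - ?Y (Suc h))
      + c h * ((\<Prod>i=1..k. y i) * (of_nat ?m * (W (Suc h) - W h))))"
    unfolding IH by (rule sum.distrib[symmetric])
  \<comment> \<open>The tail supplies exactly the missing multiples: (y - h) + h = y in front of the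
    first product and (y + m - h) - (m - h) = y in front of the second.\<close>
  also have "\<dots> = (\<Sum>h=0..?m. c h * (-1) ^ h * of_nat (?m choose h) *
      (?Y h * (?y * content_prod ?m h ?y) - ?Y (Suc h) * (?y * content_prod ?m (Suc h) ?y)))"
  proof (rule sum.cong[OF refl], goal_cases)
    case (1 h)
    then have h: "h \<le> ?m" by simp
    have yw: "(\<Prod>i=1..k. y i) * (\<Prod>i=1..Suc k. content_prod ?m g (y i)) = ?Y g * content_prod ?m g ?y" for g
      by (simp add: prod.distrib mult_ac)
    have c1: "content_prod (Suc ?m) (Suc h) ?y * ?Y h = (?y - of_nat h) * (content_prod ?m h ?y * ?Y h)"
      by (simp add: content_prod_Suc' mult_ac)
    have c2: "content_prod (Suc ?m) (Suc h) ?y * ?Y (Suc h) = (?y + of_nat (?m - h)) * (content_prod ?m (Suc h) ?y * ?Y (Suc h))"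
      using h by (simp add: content_prod_Suc of_nat_diff algebra_simps)
    have "c h * content_prod (Suc ?m) (Suc h) ?y * (-1) ^ h * of_nat (?m choose h) * (?Y h - ?Y (Suc h))
      + c h * ((\<Prod>i=1..k. y i) * (of_nat ?m * (W (Suc h) - W h)))
      = c h * \<kappa> h * (content_prod (Suc ?m) (Suc h) ?y * ?Y h - content_prod (Suc ?m) (Suc h) ?y * ?Y (Suc h)
        + of_nat (?m - h) * ((\<Prod>i=1..k. y i) * (\<Prod>i=1..Suc k. content_prod ?m (Suc h) (y i)))
        + of_nat h * ((\<Prod>i=1..k. y i) * (\<Prod>i=1..Suc k. content_prod ?m h (y i))))"
      unfolding mW[OF h] by (simp only: \<kappa>_def algebra_simps)
    also have "\<dots> = c h * \<kappa> h * (?Y h * (?y * content_prod ?m h ?y) - ?Y (Suc h) * (?y * content_prod ?m (Suc h) ?y))"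
      unfolding yw c1 c2 by (simp only: algebra_simps) 
    finally show ?case
      by (simp only: \<kappa>_def mult.assoc)
  qed
  finally show ?case by simp
qed

text \<open>Summation by parts with Pascal's rule: the coefficient of \<open>Y s\<close> collects
  the binomials of m over s and over s - 1 with the same sign.\<close>

lemma binomial_telescope:
  fixes Y :: "nat \<Rightarrow> 'r::comm_ring_1"
  shows "(\<Sum>h=0..m. (-1) ^ h * of_nat (m choose h) * (Y h - Y (Suc h)))
       = (\<Sum>s=0..Suc m. (-1) ^ s * of_nat (Suc m choose s) * Y s)"
proof -
  have "(\<Sum>s=0..Suc m. (-1) ^ s * of_nat (Suc m choose s) * Y s)
      = Y 0 + (\<Sum>h=0..m. (-1) ^ Suc h * of_nat (Suc m choose Suc h) * Y (Suc h))"
    by (subst sum.atLeast0_atMost_Suc_shift) (simp add: o_def)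
  also have "(\<Sum>h=0..m. (-1) ^ Suc h * of_nat (Suc m choose Suc h) * Y (Suc h))
      = (\<Sum>h=0..m. (-1) ^ Suc h * of_nat (m choose h) * Y (Suc h) + (-1) ^ Suc h * of_nat (m choose Suc h) * Y (Suc h))"
    by (simp only: binomial_Suc_Suc of_nat_add distrib_left distrib_right)
  also have "\<dots> = - (\<Sum>h=0..m. (-1) ^ h * of_nat (m choose h) * Y (Suc h))
      + (\<Sum>h=0..m. (-1) ^ Suc h * of_nat (m choose Suc h) * Y (Suc h))"
    unfolding sum.distrib by (simp add: sum_negf)
  finally have 1: "(\<Sum>s=0..Suc m. (-1) ^ s * of_nat (Suc m choose s) * Y s)
      = Y 0 + (- (\<Sum>h=0..m. (-1) ^ h * of_nat (m choose h) * Y (Suc h))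
      + (\<Sum>h=0..m. (-1) ^ Suc h * of_nat (m choose Suc h) * Y (Suc h)))" .
  have "(\<Sum>s=0..Suc m. (-1) ^ s * of_nat (m choose s) * Y s)
      = Y 0 + (\<Sum>h=0..m. (-1) ^ Suc h * of_nat (m choose Suc h) * Y (Suc h))"
    by (subst sum.atLeast0_atMost_Suc_shift) (simp add: o_def)
  moreover have "(\<Sum>s=0..Suc m. (-1) ^ s * of_nat (m choose s) * Y s) = (\<Sum>h=0..m. (-1) ^ h * of_nat (m choose h) * Y h)"
    by (simp add: binomial_eq_0)
  ultimately have 2: "(\<Sum>h=0..m. (-1) ^ h * of_nat (m choose h) * Y h)
      = Y 0 + (\<Sum>h=0..m. (-1) ^ Suc h * of_nat (m choose Suc h) * Y (Suc h))" by simp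
  show ?thesis unfolding 1 right_diff_distrib sum_subtractf 2 by simp
qed

text \<open>Here the transposition pays off. Among the products only the one with
  \<open>r = s a\<close> fixes a, and it removes a from its cycle. Summation over r therefore turns
  the condition on the product into the indicator of full cycles on \<open>insert a M\<close>, a
  class function.\<close>

lemma sum_transpose_single_cycle:
  assumes "finite M" "a \<notin> M" "M \<noteq> {}" "s permutes insert a M"
  shows "(\<Sum>r\<in>M. if (transpose a r \<circ> s) a = a \<and> num_cycles M (transpose a r \<circ> s) = 1 then 1 else 0)
       = (if num_cycles (insert a M) s = 1 then 1 else (0 :: 'r::comm_ring_1))"
proof -
  define q where "q = transpose a (s a) \<circ> s"
  have q: "q permutes M" unfolding q_def by (rule permutes_insert_lemma[OF assms(4)])
  have sq: "s = transpose a (s a) \<circ> q" by (simp add: q_def fun_eq_iff)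
  have sa: "s a \<in> insert a M" using permutes_in_image[OF assms(4), of a] by simp
  have fx: "(transpose a r \<circ> s) a = a \<longleftrightarrow> r = s a" if "r \<in> M" for r
    using that assms(2) by (auto simp: transpose_def)
  show ?thesis
  proof (cases "s a = a")
    case True
    then have "s permutes M" using sq q by simp
    then have "num_cycles (insert a M) s = num_cycles M s + 1"
      using True assms by (intro num_cycles_insert_fixed) (auto simp: permutes_imp_bij)
    moreover have "num_cycles M s \<noteq> 0"
      using assms(1,3) by (simp add: num_cycles_def cycles_on_def)
    moreover have "(\<Sum>r\<in>M. if (transpose a r \<circ> s) a = a \<and> num_cycles M (transpose a r \<circ> s) = 1 then 1 else (0::'r)) = 0"
      by (rule sum.neutral) (use fx True assms(2) in auto)
    ultimately show ?thesis by simp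
  next
    case False
    then have sM: "s a \<in> M" using sa by simp
    have "num_cycles (insert a M) s = num_cycles M q"
      using num_cycles_insert_transpose[OF assms(1) q assms(2) sM] sq by simp
    moreover have "(\<Sum>r\<in>M. if (transpose a r \<circ> s) a = a \<and> num_cycles M (transpose a r \<circ> s) = 1 then 1 else 0)
        = (\<Sum>r\<in>M. if r = s a then (if num_cycles M q = 1 then 1 else (0::'r)) else 0)"
      by (rule sum.cong) (use fx q_def in auto)
    ultimately show ?thesis using sM assms(1) by simp
  qed
qed

text \<open>By \<open>sum_hook_char\<close>, the indicator of full cycles times
  \<open>Suc (card M)\<close> is the sum of all hook characters, so every coefficient
  \<open>c h\<close> is 1. The other factor \<open>card M\<close> is the denominator cleared in
  \<open>moving_sum_hook_char\<close>.\<close>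

lemma moving_sum_single_cycle:
  fixes y :: "nat \<Rightarrow> 'r::comm_ring_1"
  assumes "finite M" "a \<notin> M" "M \<noteq> {}"
  shows "of_nat (card M) * (of_nat (Suc (card M)) *
      moving_sum a M k y (\<lambda>s. if s a = a \<and> num_cycles M s = 1 then 1 else 0))
    = (\<Sum>s=0..Suc (card M). (-1) ^ s * of_nat (Suc (card M) choose s) * (\<Prod>i=1..k. y i * content_prod (card M) s (y i)))"
proof -
  let ?\<phi> = "\<lambda>s. if s a = a \<and> num_cycles M s = 1 then 1 else (0::'r)"
  let ?n = "of_nat (Suc (card M)) :: 'r"
  have lin: "?n * moving_sum a M k y ?\<phi> = moving_sum a M k y (\<lambda>s. ?n * ?\<phi> s)"
    unfolding moving_sum_def sum_distrib_left by (intro sum.cong) auto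
  have "of_nat (card M) * moving_sum a M k y (\<lambda>s. ?n * ?\<phi> s) = (\<Sum>h=0..card M. 1 * (-1) ^ h * of_nat (card M choose h) *
      ((\<Prod>i=1..k. y i * content_prod (card M) h (y i)) - (\<Prod>i=1..k. y i * content_prod (card M) (Suc h) (y i))))"
  proof (rule moving_sum_hook_char[OF assms])
    fix s assume s: "s permutes insert a M"
    have c: "card (insert a M) = Suc (card M)" using assms by simp
    have "(\<Sum>r\<in>M. ?n * ?\<phi> (transpose a r \<circ> s)) = ?n * (if num_cycles (insert a M) s = 1 then 1 else 0)"
      unfolding sum_distrib_left[symmetric] sum_transpose_single_cycle[OF assms s] ..
    also have "\<dots> = of_int (if num_cycles (insert a M) s = 1 then int (card (insert a M)) else 0)"
      using c by simp
    also have "\<dots> = of_int (\<Sum>h=1..Suc (card M). hook_char (insert a M) h s)"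
      using sum_hook_char[of "insert a M" s] assms(1) permutes_imp_bij[OF s] c by simp
    also have "(\<Sum>h=1..Suc (card M). hook_char (insert a M) h s) = (\<Sum>h=0..card M. hook_char (insert a M) (Suc h) s)"
      using sum.shift_bounds_cl_Suc_ivl[of "\<lambda>h. hook_char (insert a M) h s" 0 "card M"] by simp
    finally show "(\<Sum>r\<in>M. ?n * ?\<phi> (transpose a r \<circ> s)) = (\<Sum>h=0..card M. 1 * of_int (hook_char (insert a M) (Suc h) s))"
      by (simp only: of_int_sum mult_1)
  qed
  then show ?thesis unfolding lin using binomial_telescope by (simp only: mult_1)
qed

section \<open>Full cycles: enumeration, conjugacy and number\<close>

lemma cycle_enumeration:
  assumes "finite S" "bij_betw p S S" "x \<in> S"
  shows "bij_betw (\<lambda>i. (p ^^ i) x) {..<card (cycle_through p x)} (cycle_through p x)"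
    and "(p ^^ card (cycle_through p x)) x = x"
proof -
  define L where "L = (LEAST k. k > 0 \<and> (p ^^ k) x = x)"
  have L: "L > 0" "(p ^^ L) x = x"
    using LeastI_ex[OF funpow_returns[OF assms]] by (auto simp: L_def)
  have inj: "inj_on (\<lambda>i. (p ^^ i) x) {..<L}"
  proof (rule linorder_inj_onI', goal_cases)
    case (1 i j)
    show ?case
    proof
      assume eq: "(p ^^ i) x = (p ^^ j) x"
      have "(p ^^ i) ((p ^^ (j - i)) x) = (p ^^ i) x"
        using 1 eq by (metis add_diff_inverse_nat comp_apply funpow_add less_imp_not_less)
      moreover have "inj_on (p ^^ i) S"
        using assms(2) by (metis bij_betw_funpow bij_betw_imp_inj_on)
      ultimately have "(p ^^ (j - i)) x = x"
        using funpow_in_stable[OF assms(2,3)] assms(3) by (meson inj_onD)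
      then have "L \<le> j - i" unfolding L_def using 1 by (intro Least_le) auto
      then show False using 1 by auto
    qed
  qed
  have "(p ^^ i) x = (p ^^ (i mod L)) x" for i
    using L(2) by (metis funpow_mod_eq)
  then have "cycle_through p x = (\<lambda>i. (p ^^ i) x) ` {..<L}"
    unfolding cycle_through_def using L(1) by (auto intro!: image_eqI[of _ _ "_ mod L"])
  then have bij: "bij_betw (\<lambda>i. (p ^^ i) x) {..<L} (cycle_through p x)" using inj by (simp add: bij_betw_def)
  from bij_betw_same_card[OF this] have "card (cycle_through p x) = L" by simp
  with bij L show "bij_betw (\<lambda>i. (p ^^ i) x) {..<card (cycle_through p x)} (cycle_through p x)"
    and "(p ^^ card (cycle_through p x)) x = x" by auto
qed

lemma single_cycle_through:
  assumes "finite S" "bij_betw p S S" "x \<in> S" "num_cycles S p = 1"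
  shows "cycle_through p x = S"
proof -
  obtain C where C: "cycles_on S p = {C}"
    using assms(4) unfolding num_cycles_def by (meson card_1_singletonE)
  then have "cycle_through p z = C" if "z \<in> S" for z using that unfolding cycles_on_def by blast
  then have "S \<subseteq> cycle_through p x" using assms(3) self_in_cycle by fastforce
  then show ?thesis using cycle_subset[OF assms(2,3)] by blast
qed

text \<open>Both cycles are enumerated from a common point x and matched step by step. The last step
  needs separate care, since there both enumerations return to x.\<close>

lemma single_cycles_conjugate:
  assumes "finite M" "p permutes M" "q permutes M" "num_cycles M p = 1" "num_cycles M q = 1"
  obtains g where "g permutes M" "g \<circ> p = q \<circ> g"
proof -
  have "M \<noteq> {}" using assms(4) by auto
  then obtain x where x: "x \<in> M" by blast
  let ?m = "card M"
  note bp = permutes_imp_bij[OF assms(2)] and bq = permutes_imp_bij[OF assms(3)]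
  have P: "bij_betw (\<lambda>i. (p ^^ i) x) {..<?m} M" "(p ^^ ?m) x = x"
    using cycle_enumeration[OF assms(1) bp x] single_cycle_through[OF assms(1) bp x assms(4)] by auto
  have Q: "bij_betw (\<lambda>i. (q ^^ i) x) {..<?m} M" "(q ^^ ?m) x = x"
    using cycle_enumeration[OF assms(1) bq x] single_cycle_through[OF assms(1) bq x assms(5)] by auto
  define g where "g = (\<lambda>z. if z \<in> M then (q ^^ (inv_into {..<?m} (\<lambda>i. (p ^^ i) x) z)) x else z)"
  have gi: "g ((p ^^ i) x) = (q ^^ i) x" if "i < ?m" for i
    using that bij_betw_inv_into_left[OF P(1), of i] funpow_in_stable[OF bp x] by (simp add: g_def)
  have "bij_betw ((\<lambda>i. (q ^^ i) x) \<circ> inv_into {..<?m} (\<lambda>i. (p ^^ i) x)) M M"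
    by (rule bij_betw_trans[OF bij_betw_inv_into[OF P(1)] Q(1)])
  then have "bij_betw g M M" by (subst bij_betw_cong[of M g]) (auto simp: g_def)
  then have g: "g permutes M" by (rule bij_imp_permutes) (simp add: g_def)
  have "g (p z) = q (g z)" for z
  proof (cases "z \<in> M")
    case True
    then obtain i where i: "i < ?m" "z = (p ^^ i) x" using P(1) by (auto simp: bij_betw_def)
    show ?thesis
    proof (cases "Suc i = ?m")
      case True
      then have "p z = x" "q (g z) = x" using i P(2) Q(2) gi[OF i(1)] by (metis funpow.simps(2) comp_apply)+
      moreover have "g x = x" using gi[of 0] i(1) by simp
      ultimately show ?thesis by simp
    next
      case False
      then have "Suc i < ?m" using i(1) by simp
      then show ?thesis using gi[of "Suc i"] gi[OF i(1)] i(2) by simp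
    qed
  next
    case False
    then show ?thesis using assms(2,3) g by (simp add: permutes_not_in)
  qed
  then have "g \<circ> p = q \<circ> g" by (simp add: fun_eq_iff)
  with g show ?thesis by (rule that)
qed

text \<open>Each full cycle on \<open>insert a M\<close> arises exactly once from a full cycle on M
  by splicing a in before one of the \<open>card M\<close> points.\<close>

lemma card_single_cycles:
  assumes "finite M" "M \<noteq> {}"
  shows "card {p. p permutes M \<and> num_cycles M p = 1} = fact (card M - 1)"
  using assms
proof (induction M rule: finite_ne_induct)
  case (singleton a)
  have "num_cycles {a} id = 1" using num_cycles_id[of "{a}"] by simp
  then have "{p. p permutes {a} \<and> num_cycles {a} p = 1} = {id}" by (auto simp: permutes_sing)
  then show ?case by simp
next
  case (insert a M)
  have fin: "finite {p. p permutes insert a M}" "finite {p. p permutes M}"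
    using insert by (auto simp: finite_permutations)
  have "card {p. p permutes insert a M \<and> num_cycles (insert a M) p = 1}
      = (\<Sum>p | p permutes insert a M. if num_cycles (insert a M) p = 1 then 1 else 0)"
    using sum.inter_filter[OF fin(1), of "\<lambda>_. 1::nat" "\<lambda>p. num_cycles (insert a M) p = 1"] by simp
  also have "\<dots> = (\<Sum>b\<in>insert a M. \<Sum>q | q permutes M. if num_cycles (insert a M) (transpose a b \<circ> q) = 1 then 1 else 0)"
    by (rule sum_over_permutations_insert[OF insert.hyps(1,3)])
  also have "\<dots> = (\<Sum>b\<in>insert a M. if b = a then 0 else card {p. p permutes M \<and> num_cycles M p = 1})"
  proof (rule sum.cong[OF refl], goal_cases)
    case b: (1 b)
    show ?case
    proof (cases "b = a")
      case True
      have "num_cycles (insert a M) q \<noteq> 1" if "q permutes M" for q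
      proof -
        have "num_cycles (insert a M) q = num_cycles M q + 1"
          using insert that by (intro num_cycles_insert_fixed) (auto simp: permutes_imp_bij permutes_not_in)
        moreover have "num_cycles M q \<noteq> 0" using insert by (simp add: num_cycles_def cycles_on_def)
        ultimately show ?thesis by simp
      qed
      then show ?thesis using True by simp
    next
      case False
      then have "b \<in> M" using b by simp
      then have "num_cycles (insert a M) (transpose a b \<circ> q) = num_cycles M q" if "q permutes M" for q
        using num_cycles_insert_transpose[OF insert.hyps(1) that insert.hyps(3)] by simp
      then have "(\<Sum>q | q permutes M. if num_cycles (insert a M) (transpose a b \<circ> q) = 1 then 1 else 0)
        = (\<Sum>q | q permutes M. if num_cycles M q = 1 then 1 else (0::nat))" by (intro sum.cong) auto
      also have "\<dots> = card {p. p permutes M \<and> num_cycles M p = 1}"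
        using sum.inter_filter[OF fin(2), of "\<lambda>_. 1::nat" "\<lambda>p. num_cycles M p = 1"] by simp
      finally show ?thesis using False by simp
    qed
  qed
  also have "\<dots> = (\<Sum>b\<in>M. card {p. p permutes M \<and> num_cycles M p = 1})"
  proof -
    have "(\<Sum>b\<in>M. if b = a then 0 else card {p. p permutes M \<and> num_cycles M p = 1})
        = (\<Sum>b\<in>M. card {p. p permutes M \<and> num_cycles M p = 1})"
      by (rule sum.cong[OF refl], rule if_not_P) (use insert.hyps in auto)
    then show ?thesis using insert.hyps by (subst sum.insert) (simp_all only: if_True add_0 simp_thms)
  qed
  also have "\<dots> = card M * fact (card M - 1)" using insert.IH by simp
  also have "\<dots> = fact (card M)" using insert.hyps by (simp add: fact_reduce card_gt_0_iff)
  finally show ?case using insert.hyps by simp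
qed

abbreviation (input) perm_inv :: "('a \<Rightarrow> 'a) \<Rightarrow> 'a \<Rightarrow> 'a" where
  "perm_inv g \<equiv> inv_into UNIV g"

lemma num_cycles_conj:
  assumes "finite S" "g permutes S" "p permutes S"
  shows "num_cycles S (g \<circ> p \<circ> perm_inv g) = num_cycles S p"
proof -
  have bg: "bij g" using assms(2) by (rule permutes_bij)
  have pow: "((g \<circ> p \<circ> perm_inv g) ^^ i) (g x) = g ((p ^^ i) x)" for i x
    by (induction i) (simp_all add: bij_is_inj[OF bg] inv_f_f)
  have "cycle_through (g \<circ> p \<circ> perm_inv g) (g x) = g ` cycle_through p x" for x
    unfolding cycle_through_def pow by (simp add: image_image)
  then have "cycles_on S (g \<circ> p \<circ> perm_inv g) = (\<lambda>C. g ` C) ` cycles_on S p"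
    unfolding cycles_on_def using permutes_image[OF assms(2)] by (metis (no_types, lifting) image_cong image_image)
  moreover have "inj_on (\<lambda>C. g ` C) (cycles_on S p)"
    by (rule inj_onI) (use bg in \<open>simp add: bij_def inj_image_eq_iff\<close>)
  ultimately show ?thesis by (simp add: num_cycles_def card_image)
qed

lemma perm_prod_conj:
  assumes "bij g"
  shows "perm_prod k (\<lambda>i. g \<circ> u i \<circ> perm_inv g) = g \<circ> perm_prod k u \<circ> perm_inv g"
proof (induction k)
  case 0
  then show ?case using assms by (simp add: fun_eq_iff bij_is_surj surj_f_inv_f)
next
  case (Suc k)
  then show ?case using assms by (simp add: perm_prod_Suc fun_eq_iff bij_is_inj inv_f_f)
qed

definition factorization_sum :: "'a \<Rightarrow> 'a set \<Rightarrow> nat \<Rightarrow> (nat \<Rightarrow> 'r::comm_ring_1) \<Rightarrow> ('a \<Rightarrow> 'a) \<Rightarrow> 'r" where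
  "factorization_sum a M k y c =
    (\<Sum>u | u \<in> {1..k} \<rightarrow>\<^sub>E {p. p permutes insert a M} \<and> perm_prod k u = c \<and> (\<exists>i\<in>{1..k}. u i a \<noteq> a).
      \<Prod>i=1..k. y i ^ num_cycles (insert a M) (u i))"

text \<open>All factors are conjugated simultaneously. As \<open>g\<close> permutes M, it fixes a,
  so the condition that some factor moves a is preserved along with the cycle numbers.\<close>

lemma factorization_sum_conj:
  assumes "finite M" "a \<notin> M" "g permutes M"
  shows "factorization_sum a M k y (g \<circ> c \<circ> perm_inv g) = factorization_sum a M k y c"
  unfolding factorization_sum_def
proof (rule sum.reindex_bij_witness[of _ "\<lambda>u. \<lambda>i\<in>{1..k}. g \<circ> u i \<circ> perm_inv g" "\<lambda>u. \<lambda>i\<in>{1..k}. perm_inv g \<circ> u i \<circ> g"], goal_cases)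
  let ?A = "insert a M"
  have gA: "g permutes ?A" using assms(3) by (rule permutes_imp_permutes_insert)
  have iA: "perm_inv g permutes ?A" using gA by (rule permutes_inv)
  have bg: "bij g" using assms(3) by (rule permutes_bij)
  have ig: "perm_inv g \<circ> g = id" "g \<circ> perm_inv g = id" using permutes_inv_o[OF assms(3)] by auto
  have ig': "perm_inv g (g x) = x" "g (perm_inv g x) = x" for x using ig by (auto simp: fun_eq_iff)
  have ga: "g a = a" "perm_inv g a = a" using assms(2,3) permutes_inv[OF assms(3)] by (auto simp: permutes_not_in)
  have ii: "perm_inv (perm_inv g) = g" using bg by (rule inv_inv_eq)
  {
    case (1 u)
    then show ?case by (auto simp: fun_eq_iff ig' PiE_def extensional_def)
  next
    case (2 u)
    have "perm_prod k (\<lambda>i\<in>{1..k}. perm_inv g \<circ> u i \<circ> g) = perm_prod k (\<lambda>i. perm_inv g \<circ> u i \<circ> perm_inv (perm_inv g))"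
      by (rule perm_prod_cong) (simp add: ii)
    also have "\<dots> = perm_inv g \<circ> perm_prod k u \<circ> g"
      using perm_prod_conj[of "perm_inv g" k u] bg by (simp add: ii bij_imp_bij_inv)
    also have "\<dots> = c" using 2 by (auto simp: fun_eq_iff ig')
    finally have pp: "perm_prod k (\<lambda>i\<in>{1..k}. perm_inv g \<circ> u i \<circ> g) = c" .
    have "perm_inv g \<circ> u i \<circ> g permutes ?A" if "i \<in> {1..k}" for i
      using 2 that gA iA by (auto intro!: permutes_compose)
    moreover have "\<exists>i\<in>{1..k}. (perm_inv g \<circ> u i \<circ> g) a \<noteq> a"
    proof -
      from 2 obtain i where i: "i \<in> {1..k}" "u i a \<noteq> a" by blast
      then have "perm_inv g (u i a) \<noteq> a" using ga(1) ig'(2)[of "u i a"] by auto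
      then show ?thesis using i(1) ga(1) by auto
    qed
    ultimately show ?case using pp by auto
  next
    case (3 u)
    then show ?case by (auto simp: fun_eq_iff ig' PiE_def extensional_def)
  next
    case (4 u)
    have "perm_prod k (\<lambda>i\<in>{1..k}. g \<circ> u i \<circ> perm_inv g) = perm_prod k (\<lambda>i. g \<circ> u i \<circ> perm_inv g)"
      by (rule perm_prod_cong) simp
    also have "\<dots> = g \<circ> c \<circ> perm_inv g"
      using perm_prod_conj[OF bg, of k u] 4 by simp
    finally have pp: "perm_prod k (\<lambda>i\<in>{1..k}. g \<circ> u i \<circ> perm_inv g) = g \<circ> c \<circ> perm_inv g" .
    have "g \<circ> u i \<circ> perm_inv g permutes ?A" if "i \<in> {1..k}" for i
      using 4 that gA iA by (auto intro!: permutes_compose)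
    moreover have "\<exists>i\<in>{1..k}. (g \<circ> u i \<circ> perm_inv g) a \<noteq> a"
    proof -
      from 4 obtain i where i: "i \<in> {1..k}" "u i a \<noteq> a" by blast
      then have "g (u i a) \<noteq> a" using ga(2) ig'(1)[of "u i a"] by auto
      then show ?thesis using i(1) ga(2) by auto
    qed
    ultimately show ?case using pp by auto
  next
    case (5 u)
    show ?case
    proof (rule prod.cong[OF refl], goal_cases)
      case i: (1 i)
      then have "u i permutes ?A" using 5 by auto
      from num_cycles_conj[OF _ iA this] assms(1) i
      show ?case
        by (simp add: ii)
    qed
  }
qed

text \<open>Full cycles on M are conjugate under permutations of M, so they all have the same
  factorization sum. With m = \<open>card M\<close>, the moving sum is (m-1)! times this value, and
  (m+1)! = m (m+1) (m-1)!.\<close>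

lemma factorization_sum_single_cycle:
  fixes y :: "nat \<Rightarrow> 'r::comm_ring_1"
  assumes "finite M" "a \<notin> M" "M \<noteq> {}" "c permutes M" "num_cycles M c = 1"
  shows "of_nat (fact (Suc (card M))) * factorization_sum a M k y c
    = (\<Sum>s=0..Suc (card M). (-1) ^ s * of_nat (Suc (card M) choose s) * (\<Prod>i=1..k. y i * content_prod (card M) s (y i)))"
proof -
  let ?A = "insert a M" and ?T = "{c. c permutes M \<and> num_cycles M c = 1}"
  let ?U = "{1..k} \<rightarrow>\<^sub>E {p. p permutes ?A}"
  have finA: "finite {p. p permutes ?A}" using assms(1) by (simp add: finite_permutations)
  have finU: "finite ?U" using finA by (intro finite_PiE) auto
  have finT: "finite ?T" by (rule finite_subset[OF _ finite_permutations[OF assms(1)]]) auto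
  have "factorization_sum a M k y c' = factorization_sum a M k y c" if "c' \<in> ?T" for c'
  proof -
    obtain g where g: "g permutes M" "g \<circ> c = c' \<circ> g"
      using single_cycles_conjugate[OF assms(1,4) _ assms(5)] \<open>c' \<in> ?T\<close> by blast
    have "c' = g \<circ> c \<circ> perm_inv g"
      unfolding g(2) comp_assoc using permutes_inv_o[OF g(1)] by simp
    then show ?thesis using factorization_sum_conj[OF assms(1,2) g(1), of k y c] by simp
  qed
  then have "(\<Sum>c'\<in>?T. factorization_sum a M k y c') = of_nat (fact (card M - 1)) * factorization_sum a M k y c"
    using card_single_cycles[OF assms(1,3)] by simp
  moreover have "(\<Sum>c'\<in>?T. factorization_sum a M k y c')
      = moving_sum a M k y (\<lambda>s. if s a = a \<and> num_cycles M s = 1 then 1 else 0)"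
  proof -
    let ?w = "\<lambda>u. \<Prod>i=1..k. y i ^ num_cycles ?A (u i)"
    have "(\<Sum>c'\<in>?T. factorization_sum a M k y c')
       = (\<Sum>c'\<in>?T. \<Sum>u\<in>?U. if perm_prod k u = c' \<and> (\<exists>i\<in>{1..k}. u i a \<noteq> a) then ?w u else 0)"
      unfolding factorization_sum_def
      by (intro sum.cong[OF refl] sum.inter_filter[OF finU])
    also have "\<dots> = (\<Sum>u\<in>?U. \<Sum>c'\<in>?T. if perm_prod k u = c' then (if \<exists>i\<in>{1..k}. u i a \<noteq> a then ?w u else 0) else 0)"
      by (subst sum.swap) (intro sum.cong refl, auto)
    also have "\<dots> = moving_sum a M k y (\<lambda>s. if s a = a \<and> num_cycles M s = 1 then 1 else 0)"
      unfolding moving_sum_def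
    proof (rule sum.cong[OF refl], goal_cases)
      case (1 u)
      then have P: "perm_prod k u permutes ?A" by (intro perm_prod_permutes) auto
      have "perm_prod k u \<in> ?T \<longleftrightarrow> perm_prod k u a = a \<and> num_cycles M (perm_prod k u) = 1"
        using permutes_insert_fixed_iff[OF assms(2), of "perm_prod k u"] P by auto
      then show ?case
        using finT by (simp add: sum.delta)
    qed
    finally show ?thesis .
  qed
  ultimately have eq: "moving_sum a M k y (\<lambda>s. if s a = a \<and> num_cycles M s = 1 then 1 else 0)
     = of_nat (fact (card M - 1)) * factorization_sum a M k y c" by simp
  have "fact (Suc (card M)) = card M * (Suc (card M) * fact (card M - 1))"
    using assms(1,3) by (simp add: fact_reduce[of "card M"] card_gt_0_iff algebra_simps)
  then have "of_nat (fact (Suc (card M))) * factorization_sum a M k y c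
    = of_nat (card M) * (of_nat (Suc (card M)) * (of_nat (fact (card M - 1)) * factorization_sum a M k y c))"
    by (simp only: of_nat_mult mult.assoc)
  then show ?thesis using moving_sum_single_cycle[OF assms(1-3), of k y] unfolding eq by simp
qed

section \<open>Counting lifts\<close>

text \<open>One value is determined by the others, which are free.\<close>

lemma card_sum_zero_functions:
  assumes "finite V" "V \<noteq> {}" "d > 0"
  shows "card {f \<in> V \<rightarrow>\<^sub>E {0..<int d}. (\<Sum>v\<in>V. f v) mod int d = 0} = d ^ (card V - 1)"
proof -
  obtain v W where V: "V = insert v W" "v \<notin> W" using assms(2) by (metis Set.set_insert ex_in_conv)
  have finW: "finite W" using V assms(1) by simp
  have sumV: "(\<Sum>u\<in>V. f u) = f v + (\<Sum>u\<in>W. f u)" for f :: "'a \<Rightarrow> int" using V finW by simp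
  have "bij_betw (\<lambda>f. restrict f W) {f \<in> V \<rightarrow>\<^sub>E {0..<int d}. (\<Sum>v\<in>V. f v) mod int d = 0} (W \<rightarrow>\<^sub>E {0..<int d})"
  proof (rule bij_betw_byWitness[where f' = "\<lambda>g. g(v := (- (\<Sum>u\<in>W. g u)) mod int d)"], goal_cases)
    case 1
    show ?case
    proof
      fix f assume f: "f \<in> {f \<in> V \<rightarrow>\<^sub>E {0..<int d}. (\<Sum>v\<in>V. f v) mod int d = 0}"
      have "(\<Sum>u\<in>W. restrict f W u) = (\<Sum>u\<in>W. f u)" by (rule sum.cong) auto
      moreover have "f v = (- (\<Sum>u\<in>W. f u)) mod int d"
      proof -
        have "f v \<in> {0..<int d}" using f V by auto
        then have "f v = f v mod int d" by simp
        also have "\<dots> = (- (\<Sum>u\<in>W. f u)) mod int d"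
          using f sumV[of f] by (auto simp: mod_eq_dvd_iff mod_eq_0_iff_dvd)
        finally show ?thesis .
      qed
      ultimately show "(restrict f W)(v := (- (\<Sum>u\<in>W. restrict f W u)) mod int d) = f"
        using f V by (auto simp: fun_eq_iff PiE_def extensional_def)
    qed
  next
    case 2
    then show ?case using V by (auto simp: fun_eq_iff PiE_def extensional_def)
  next
    case 3
    then show ?case using V by auto
  next
    case 4
    show ?case
    proof
      fix f assume "f \<in> (\<lambda>g. g(v := (- (\<Sum>u\<in>W. g u)) mod int d)) ` (W \<rightarrow>\<^sub>E {0..<int d})"
      then obtain g where g: "g \<in> W \<rightarrow>\<^sub>E {0..<int d}" "f = g(v := (- (\<Sum>u\<in>W. g u)) mod int d)" by blast
      have "(\<Sum>u\<in>W. f u) = (\<Sum>u\<in>W. g u)" using g V by (intro sum.cong) auto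
      then have "(\<Sum>u\<in>V. f u) mod int d = 0" unfolding sumV using g by (simp add: mod_simps)
      moreover have "f \<in> V \<rightarrow>\<^sub>E {0..<int d}" using g V assms(3) by (auto simp: PiE_def extensional_def)
      ultimately show "f \<in> {f \<in> V \<rightarrow>\<^sub>E {0..<int d}. (\<Sum>v\<in>V. f v) mod int d = 0}" by simp
    qed
  qed
  from bij_betw_same_card[OF this] show ?thesis using V finW by (simp add: card_PiE)
qed

text \<open>The boundary of a 1-chain on a directed graph, positive at the source. It is taken over
  the integers, so that the chains in \<open>boundary_surj\<close> have exact boundaries; reduction
  mod d comes afterwards.\<close>

definition boundary :: "'e set \<Rightarrow> ('e \<Rightarrow> 'v) \<Rightarrow> ('e \<Rightarrow> 'v) \<Rightarrow> ('e \<Rightarrow> int) \<Rightarrow> 'v \<Rightarrow> int" where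
  "boundary E src tgt a v = (\<Sum>e\<in>E. a e * (of_bool (src e = v) - of_bool (tgt e = v)))"

lemma sum_boundary:
  assumes "finite E" "finite V" "\<And>e. e \<in> E \<Longrightarrow> src e \<in> V" "\<And>e. e \<in> E \<Longrightarrow> tgt e \<in> V"
  shows "(\<Sum>v\<in>V. boundary E src tgt a v) = 0"
proof -
  have "(\<Sum>v\<in>V. boundary E src tgt a v) = (\<Sum>e\<in>E. a e * (\<Sum>v\<in>V. of_bool (src e = v) - of_bool (tgt e = v)))"
    unfolding boundary_def sum_distrib_left by (rule sum.swap)
  also have "\<dots> = 0"
    using assms by (intro sum.neutral ballI) (simp add: sum_subtractf of_bool_def sum.delta')
  finally show ?thesis .
qed

text \<open>Connectedness is expressed by labellings: one that agrees along every edge is constant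
  on \<open>V\<close>. It is applied to the labelling \<open>R\<close> of u by the set of v such
  that u - v is a boundary, which is why labels are sets of vertices. Then all differences of
  vertices are boundaries, and they span the functions of sum zero.\<close>

lemma boundary_surj:
  fixes f :: "'v \<Rightarrow> int" and src tgt :: "'e \<Rightarrow> 'v"
  assumes "finite E" "finite V" "(\<Sum>v\<in>V. f v) = 0"
    and conn: "\<And>(g :: 'v \<Rightarrow> 'v set) u v. (\<forall>e\<in>E. g (src e) = g (tgt e)) \<Longrightarrow> u \<in> V \<Longrightarrow> v \<in> V \<Longrightarrow> g u = g v"
  shows "\<exists>a. \<forall>v\<in>V. boundary E src tgt a v = f v"
proof (cases "V = {}")
  case False
  then obtain v0 where v0: "v0 \<in> V" by blast
  define R where "R u = {v. \<exists>a. \<forall>w\<in>V. boundary E src tgt a w = of_bool (u = w) - of_bool (v = w)}" for u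
  have add: "boundary E src tgt (\<lambda>e. a e + b e) w = boundary E src tgt a w + boundary E src tgt b w" for a b w
    unfolding boundary_def by (simp add: sum.distrib[symmetric] algebra_simps)
  have single: "boundary E src tgt (\<lambda>e. of_bool (e = e0) * z) w = z * (of_bool (src e0 = w) - of_bool (tgt e0 = w))" if "e0 \<in> E" for e0 w z
    unfolding boundary_def using that assms(1) by (simp add: of_bool_def if_distrib[of "\<lambda>x. x * _"] cong: if_cong)
  have "R (src e) = R (tgt e)" if e: "e \<in> E" for e
  proof
    show "R (src e) \<subseteq> R (tgt e)"
    proof
      fix v assume "v \<in> R (src e)"
      then obtain a where a: "\<forall>w\<in>V. boundary E src tgt a w = of_bool (src e = w) - of_bool (v = w)"
        by (auto simp: R_def)
      have "\<forall>w\<in>V. boundary E src tgt (\<lambda>x. a x + of_bool (x = e) * (-1)) w = of_bool (tgt e = w) - of_bool (v = w)"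
        unfolding add single[OF e] using a by simp
      then show "v \<in> R (tgt e)" unfolding R_def by blast
    qed
    show "R (tgt e) \<subseteq> R (src e)"
    proof
      fix v assume "v \<in> R (tgt e)"
      then obtain a where a: "\<forall>w\<in>V. boundary E src tgt a w = of_bool (tgt e = w) - of_bool (v = w)"
        by (auto simp: R_def)
      have "\<forall>w\<in>V. boundary E src tgt (\<lambda>x. a x + of_bool (x = e) * 1) w = of_bool (src e = w) - of_bool (v = w)"
        unfolding add single[OF e] using a by simp
      then show "v \<in> R (src e)" unfolding R_def by blast
    qed
  qed
  then have "R u = R v0" if "u \<in> V" for u using conn[of R] that v0 by blast
  moreover have "v0 \<in> R v0" unfolding R_def by (auto simp: boundary_def intro!: exI[of _ "\<lambda>_. 0"])
  ultimately have "v0 \<in> R u" if "u \<in> V" for u using that by blast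
  then have "\<exists>a. \<forall>w\<in>V. boundary E src tgt a w = of_bool (u = w) - of_bool (v0 = w)" if "u \<in> V" for u
    using that unfolding R_def mem_Collect_eq by blast
  then obtain b where b: "\<And>u w. u \<in> V \<Longrightarrow> w \<in> V \<Longrightarrow> boundary E src tgt (b u) w = of_bool (u = w) - of_bool (v0 = w)"
    by metis
  have "boundary E src tgt (\<lambda>e. \<Sum>u\<in>V. f u * b u e) w = f w" if w: "w \<in> V" for w
  proof -
    have "boundary E src tgt (\<lambda>e. \<Sum>u\<in>V. f u * b u e) w = (\<Sum>u\<in>V. f u * boundary E src tgt (b u) w)"
      unfolding boundary_def sum_distrib_left sum_distrib_right mult.assoc by (rule sum.swap)
    also have "\<dots> = (\<Sum>u\<in>V. f u * (of_bool (u = w) - of_bool (v0 = w)))"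
      using b w by (intro sum.cong) auto
    also have "\<dots> = (\<Sum>u\<in>V. f u * of_bool (u = w)) - (\<Sum>u\<in>V. f u) * of_bool (v0 = w)"
      by (simp add: right_diff_distrib sum_subtractf sum_distrib_right)
    \<comment> \<open>The contribution of \<open>v0\<close> drops out because the values of
      \<open>f\<close> sum to zero.\<close>
    also have "\<dots> = f w" using assms(2,3) w by (simp add: of_bool_def if_distrib[of "\<lambda>x. _ * x"] cong: if_cong)
    finally show ?thesis .
  qed
  then show ?thesis by blast
qed simp

text \<open>Adding a chain with boundary f' - f maps one fibre injectively into another, so all
  fibres over functions of sum zero have the same size. The \<open>d ^ card E\<close> chains are
  thus shared equally among \<open>d ^ (card V - 1)\<close> values.\<close>

lemma card_boundary_fibre:
  fixes src tgt :: "'e \<Rightarrow> 'v"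
  assumes "finite E" "finite V" "V \<noteq> {}" "d > 0"
    and ends: "\<And>e. e \<in> E \<Longrightarrow> src e \<in> V" "\<And>e. e \<in> E \<Longrightarrow> tgt e \<in> V"
    and conn: "\<And>(g :: 'v \<Rightarrow> 'v set) u v. (\<forall>e\<in>E. g (src e) = g (tgt e)) \<Longrightarrow> u \<in> V \<Longrightarrow> v \<in> V \<Longrightarrow> g u = g v"
    and f: "f \<in> V \<rightarrow>\<^sub>E {0..<int d}" "(\<Sum>v\<in>V. f v) mod int d = 0"
  shows "card {a \<in> E \<rightarrow>\<^sub>E {0..<int d}. \<forall>v\<in>V. boundary E src tgt a v mod int d = f v} * d ^ (card V - 1) = d ^ card E"
proof -
  let ?b = "boundary E src tgt"
  define T where "T = {f \<in> V \<rightarrow>\<^sub>E {0..<int d}. (\<Sum>v\<in>V. f v) mod int d = 0}"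
  define Fib where "Fib f = {a \<in> E \<rightarrow>\<^sub>E {0..<int d}. \<forall>v\<in>V. ?b a v mod int d = f v}" for f
  have finK: "finite (E \<rightarrow>\<^sub>E {0..<int d})" using assms(1) by (intro finite_PiE) auto
  have finFib: "finite (Fib f)" for f unfolding Fib_def using finK by simp
  have finT: "finite T" unfolding T_def using assms(2) by (simp add: finite_PiE)
  have le: "card (Fib f) \<le> card (Fib f')" if ff: "f \<in> T" "f' \<in> T" for f f'
  proof -
    obtain v0 where v0: "v0 \<in> V" using assms(3) by blast
    \<comment> \<open>The sum of f' - f is divisible by d but need not be zero. Subtracting it at
      \<open>v0\<close> makes the sum zero without changing the class mod d.\<close>
    define h where "h v = f' v - f v - of_bool (v = v0) * ((\<Sum>v\<in>V. f' v) - (\<Sum>v\<in>V. f v))" for v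
    have "(\<Sum>v\<in>V. h v) = 0"
      unfolding h_def using v0 assms(2) by (simp add: sum_subtractf sum_distrib_right[symmetric])
    from boundary_surj[OF assms(1,2) this conn] obtain g where g: "\<And>v. v \<in> V \<Longrightarrow> ?b g v = h v" by blast
    define \<Phi> where "\<Phi> a = (\<lambda>e\<in>E. (a e + g e) mod int d)" for a
    have "\<Phi> a \<in> Fib f'" if a: "a \<in> Fib f" for a
    proof -
      have "?b (\<Phi> a) v mod int d = f' v" if v: "v \<in> V" for v
      proof -
        have "?b (\<Phi> a) v mod int d = (\<Sum>e\<in>E. (\<Phi> a e * (of_bool (src e = v) - of_bool (tgt e = v))) mod int d) mod int d"
          unfolding boundary_def by (rule mod_sum_eq[symmetric])
        also have "\<dots> = (\<Sum>e\<in>E. ((a e + g e) * (of_bool (src e = v) - of_bool (tgt e = v))) mod int d) mod int d"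
          by (rule arg_cong[of _ _ "\<lambda>x. x mod int d"], rule sum.cong[OF refl])
            (simp only: \<Phi>_def restrict_apply' mod_mult_left_eq)
        also have "\<dots> = (?b a v + ?b g v) mod int d"
          unfolding mod_sum_eq boundary_def by (simp add: sum.distrib[symmetric] algebra_simps)
        also have "\<dots> = (?b a v mod int d + ?b g v) mod int d" by (simp add: mod_simps)
        also have "\<dots> = (f v + h v) mod int d" using a v g by (simp add: Fib_def)
        also have "\<dots> = f' v mod int d"
        proof -
          have "int d dvd (\<Sum>v\<in>V. f' v) - (\<Sum>v\<in>V. f v)" using ff by (auto simp: T_def intro!: dvd_diff)
          then have "int d dvd of_bool (v = v0) * ((\<Sum>v\<in>V. f' v) - (\<Sum>v\<in>V. f v))" by (rule dvd_mult)
          then show ?thesis by (simp add: h_def mod_eq_dvd_iff)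
        qed
        also have "\<dots> = f' v" using ff v by (auto simp: T_def PiE_def Pi_def)
        finally show ?thesis .
      qed
      then show ?thesis using assms(4) by (auto simp: Fib_def \<Phi>_def)
    qed
    moreover have "inj_on \<Phi> (Fib f)"
    proof (rule inj_onI)
      fix a b assume ab: "a \<in> Fib f" "b \<in> Fib f" "\<Phi> a = \<Phi> b"
      show "a = b"
      proof
        fix e
        show "a e = b e"
        proof (cases "e \<in> E")
          case True
          then have "(a e + g e) mod int d = (b e + g e) mod int d" using fun_cong[OF ab(3), of e] by (simp add: \<Phi>_def)
          then have "a e mod int d = b e mod int d" by (simp add: mod_eq_dvd_iff)
          moreover have "a e \<in> {0..<int d}" "b e \<in> {0..<int d}" using ab True by (auto simp: Fib_def)
          ultimately show ?thesis by simp
        next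
          case False
          then show ?thesis using ab by (auto simp: Fib_def PiE_def extensional_def)
        qed
      qed
    qed
    ultimately show ?thesis using finFib by (intro card_inj_on_le[of \<Phi>]) auto
  qed
  have fT: "f \<in> T" using f by (simp add: T_def)
  have "E \<rightarrow>\<^sub>E {0..<int d} = (\<Union>f\<in>T. Fib f)"
  proof
    show "E \<rightarrow>\<^sub>E {0..<int d} \<subseteq> (\<Union>f\<in>T. Fib f)"
    proof
      fix a assume a: "a \<in> E \<rightarrow>\<^sub>E {0..<int d}"
      define f where "f = (\<lambda>v\<in>V. ?b a v mod int d)"
      have "(\<Sum>v\<in>V. f v) mod int d = (\<Sum>v\<in>V. ?b a v mod int d) mod int d" by (simp add: f_def)
      also have "\<dots> = (\<Sum>v\<in>V. ?b a v) mod int d" by (rule mod_sum_eq)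
      also have "\<dots> = 0" using sum_boundary[of E V src tgt a] assms(1,2) ends by simp
      finally have "f \<in> T" using assms(4) by (auto simp: T_def f_def)
      moreover have "a \<in> Fib f" using a by (auto simp: Fib_def f_def)
      ultimately show "a \<in> (\<Union>f\<in>T. Fib f)" by blast
    qed
  qed (auto simp: Fib_def)
  then have "d ^ card E = card (\<Union>f\<in>T. Fib f)" using assms(1) card_PiE[of E "\<lambda>_. {0..<int d}"] by simp
  also have "\<dots> = (\<Sum>g\<in>T. card (Fib g))"
  proof (rule card_UN_disjoint[OF finT])
    show "\<forall>i\<in>T. \<forall>j\<in>T. i \<noteq> j \<longrightarrow> Fib i \<inter> Fib j = {}"
    proof (intro ballI impI)
      fix i j assume ij: "i \<in> T" "j \<in> T" "i \<noteq> j"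
      then obtain v where "i v \<noteq> j v" by blast
      moreover have "v \<in> V"
        using ij calculation by (auto simp: T_def PiE_def extensional_def)
      ultimately show "Fib i \<inter> Fib j = {}" by (auto simp: Fib_def)
    qed
  qed (use finFib in auto)
  also have "\<dots> = (\<Sum>g\<in>T. card (Fib f))" using le fT by (intro sum.cong) (auto intro: le_antisym)
  also have "\<dots> = d ^ (card V - 1) * card (Fib f)"
    using card_sum_zero_functions[OF assms(2,3,4)] by (simp add: T_def)
  finally show ?thesis by (simp add: Fib_def mult.commute)
qed

text \<open>The formula is what the characters of Z/d predict: the trivial one gives
  \<open>(x - 1 + of_nat d) ^ card W\<close>, and the d - 1 others give
  \<open>(x - 1) ^ card W\<close> times values at s that add up to d - 1 or -1. The induction treats
  all targets s together and keeps d on the left to avoid division.\<close>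

lemma sum_zero_weights:
  fixes x :: "'r::comm_ring_1"
  assumes "finite W" "d > 0" "s \<in> {0..<int d}"
  shows "of_nat d * (\<Sum>w\<in>W \<rightarrow>\<^sub>E {0..<int d}. if (\<Sum>C\<in>W. w C) mod int d = s then \<Prod>C\<in>W. if w C = 0 then x else 1 else 0)
       = (x - 1 + of_nat d) ^ card W + (if s = 0 then of_nat d - 1 else - 1) * (x - 1) ^ card W"
  using assms(1,3)
proof (induction W arbitrary: s rule: finite_induct)
  case empty
  then show ?case by simp
next
  case (insert C W)
  let ?D = "{0..<int d}"
  let ?m = "\<lambda>W (w :: 'a \<Rightarrow> int). \<Prod>C\<in>W. if w C = 0 then x else 1"
  define Z where "Z s = (\<Sum>w\<in>W \<rightarrow>\<^sub>E ?D. if (\<Sum>C\<in>W. w C) mod int d = s then ?m W w else 0)" for s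
  have sD: "s \<in> ?D" using insert by simp
  have inj: "inj_on (\<lambda>(y, g). g(C := y)) (?D \<times> (W \<rightarrow>\<^sub>E ?D))"
    using inj_combinator[of C W "\<lambda>_. ?D"] insert by simp
  have fin: "finite (W \<rightarrow>\<^sub>E ?D)" using insert by (intro finite_PiE) auto
  have "(\<Sum>w\<in>insert C W \<rightarrow>\<^sub>E ?D. if (\<Sum>C\<in>insert C W. w C) mod int d = s then ?m (insert C W) w else 0)
     = (\<Sum>(t, w)\<in>?D \<times> (W \<rightarrow>\<^sub>E ?D). if (t + (\<Sum>C\<in>W. w C)) mod int d = s then (if t = 0 then x else 1) * ?m W w else 0)"
    unfolding PiE_insert_eq sum.reindex[OF inj]
  proof (rule sum.cong[OF refl], clarify)
    fix t :: int and w :: "'a \<Rightarrow> int"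
    have 1: "(\<Sum>B\<in>insert C W. (w(C := t)) B) = t + (\<Sum>C\<in>W. w C)"
      using insert.hyps by (subst sum.insert) (auto intro!: sum.cong)
    have 2: "?m (insert C W) (w(C := t)) = (if t = 0 then x else 1) * ?m W w"
      using insert.hyps by (subst prod.insert) (auto intro!: arg_cong2[of _ _ _ _ "(*)"] prod.cong)
    show "((\<lambda>w. if (\<Sum>C\<in>insert C W. w C) mod int d = s then ?m (insert C W) w else 0) \<circ> (\<lambda>(y, g). g(C := y))) (t, w)
      = (if (t + (\<Sum>C\<in>W. w C)) mod int d = s then (if t = 0 then x else 1) * ?m W w else 0)"
      unfolding comp_apply prod.case 1 2 ..
  qed
  also have "\<dots> = (\<Sum>t\<in>?D. \<Sum>w\<in>W \<rightarrow>\<^sub>E ?D. if (t + (\<Sum>C\<in>W. w C)) mod int d = s then (if t = 0 then x else 1) * ?m W w else 0)"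
    by (rule sum.cartesian_product[symmetric])
  also have "\<dots> = (\<Sum>t\<in>?D. (if t = 0 then x else 1) * Z ((s - t) mod int d))"
  proof (rule sum.cong[OF refl], goal_cases)
    case (1 t)
    have "(t + S) mod int d = s \<longleftrightarrow> S mod int d = (s - t) mod int d" for S
    proof -
      have "(t + S) mod int d = s \<longleftrightarrow> (t + S) mod int d = s mod int d" using sD by simp
      also have "\<dots> \<longleftrightarrow> S mod int d = (s - t) mod int d" by (simp add: mod_eq_dvd_iff algebra_simps)
      finally show ?thesis .
    qed
    then show ?case
      unfolding Z_def sum_distrib_left by (intro sum.cong) auto
  qed
  \<comment> \<open>The weight of t is 1 plus an excess x - 1 at t = 0: the excess keeps the target
    s, while the constant part runs over all targets.\<close>
  also have "\<dots> = (\<Sum>t\<in>?D. (if t = 0 then (x - 1) * Z s else 0) + Z ((s - t) mod int d))"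
    using sD by (intro sum.cong) (auto simp: algebra_simps)
  also have "\<dots> = (x - 1) * Z s + (\<Sum>t\<in>?D. Z ((s - t) mod int d))"
    using assms(2) by (simp add: sum.distrib)
  also have "(\<Sum>t\<in>?D. Z ((s - t) mod int d)) = (\<Sum>t\<in>?D. Z t)"
  proof (rule sum.reindex_bij_witness[of _ "\<lambda>t. (s - t) mod int d" "\<lambda>t. (s - t) mod int d"], goal_cases)
    case (1 t)
    then show ?case by (simp add: mod_simps)
  next
    case (3 t)
    then show ?case by (simp add: mod_simps)
  qed (use assms(2) in auto)
  also have "(\<Sum>t\<in>?D. Z t) = (\<Sum>w\<in>W \<rightarrow>\<^sub>E ?D. \<Sum>t\<in>?D. if (\<Sum>C\<in>W. w C) mod int d = t then ?m W w else 0)"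
    unfolding Z_def by (rule sum.swap)
  also have "\<dots> = (\<Sum>w\<in>W \<rightarrow>\<^sub>E ?D. ?m W w)"
    using assms(2) by (intro sum.cong) (auto simp: sum.delta)
  also have "\<dots> = (\<Prod>C\<in>W. \<Sum>t\<in>?D. if t = 0 then x else 1)"
    using insert.hyps(1) by (subst prod_sum_PiE) auto
  also have "(\<Sum>t\<in>?D. if t = 0 then x else 1) = x - 1 + of_nat d"
  proof -
    have "(\<Sum>t\<in>?D. if t = 0 then x else 1) = (\<Sum>t\<in>?D. (if t = 0 then x - 1 else 0) + 1)" by (intro sum.cong) auto
    then show ?thesis using assms(2) by (simp add: sum.distrib)
  qed
  finally have eq: "(\<Sum>w\<in>insert C W \<rightarrow>\<^sub>E ?D. if (\<Sum>C\<in>insert C W. w C) mod int d = s then ?m (insert C W) w else 0)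
    = (x - 1) * Z s + (x - 1 + of_nat d) ^ card W" by simp
  have IH: "of_nat d * Z s = (x - 1 + of_nat d) ^ card W + (if s = 0 then of_nat d - 1 else - 1) * (x - 1) ^ card W"
    unfolding Z_def using insert.IH[OF sD] .
  have "of_nat d * ((x - 1) * Z s + (x - 1 + of_nat d) ^ card W)
      = (x - 1) * (of_nat d * Z s) + of_nat d * (x - 1 + of_nat d) ^ card W"
    by (simp add: algebra_simps)
  also have "\<dots> = (x - 1 + of_nat d) * (x - 1 + of_nat d) ^ card W + (if s = 0 then of_nat d - 1 else - 1) * ((x - 1) * (x - 1) ^ card W)"
    unfolding IH by (simp add: distrib_left distrib_right mult.left_commute)
  finally show ?case unfolding eq using insert.hyps by simp
qed

text \<open>The product of the factors after the i-th, and the identity for i at least k. It carries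
  a position j to the coordinate at which the colours of the i-th factor enter the product.\<close>

fun suffix_prod :: "(nat \<Rightarrow> 'a \<Rightarrow> 'a) \<Rightarrow> nat \<Rightarrow> nat \<Rightarrow> 'a \<Rightarrow> 'a" where
  "suffix_prod u i 0 = id"
| "suffix_prod u i (Suc k) = (if Suc k \<le> i then id else suffix_prod u i k \<circ> u (Suc k))"

lemma suffix_prod_permutes:
  "(\<And>i. i \<in> {1..k} \<Longrightarrow> u i permutes A) \<Longrightarrow> suffix_prod u i k permutes A"
  by (induction k) (auto simp: permutes_id simp del: suffix_prod.simps(2) simp: suffix_prod.simps(2)[abs_def] intro!: permutes_compose)

lemma suffix_prod_self [simp]: "i \<ge> k \<Longrightarrow> suffix_prod u i k = id"
  by (cases k) auto

text \<open>Invariance is required only under the factors after the i-th, which makes a downward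
  induction on i possible.\<close>

lemma suffix_prod_invariant:
  assumes "\<And>l. l \<in> {1..k} \<Longrightarrow> u l permutes A"
    and "\<And>l x. l \<in> {Suc i..k} \<Longrightarrow> x \<in> A \<Longrightarrow> G (u l x) = G x" "x \<in> A"
  shows "G (suffix_prod u i k x) = G x"
  using assms
proof (induction k arbitrary: x)
  case (Suc k)
  show ?case
  proof (cases "Suc k \<le> i")
    case False
    have "u (Suc k) x \<in> A" using Suc.prems(1)[of "Suc k"] Suc.prems(3) by (simp add: permutes_in_image)
    then have "G (suffix_prod u i k (u (Suc k) x)) = G (u (Suc k) x)"
      using Suc.prems by (intro Suc.IH) auto
    also have "\<dots> = G x" using Suc.prems(2)[of "Suc k" x] Suc.prems(3) False by auto
    finally show ?thesis using False by simp
  qed simp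
qed simp

text \<open>
  The second condition says that the colour vector of the product of the pairs
  $[u_i; a(i,\cdot)]$ is \<open>c\<close>.
\<close>

definition weighted_lifts ::
    "nat \<Rightarrow> 'a set \<Rightarrow> nat \<Rightarrow> (nat \<Rightarrow> 'a \<Rightarrow> 'a) \<Rightarrow> ('a \<Rightarrow> int) \<Rightarrow> (nat \<times> 'a \<Rightarrow> int) set" where
  "weighted_lifts d A k u c = {a \<in> ({1..k} \<times> A) \<rightarrow>\<^sub>E {0..<int d}.
     (\<forall>i\<in>{1..k}. (\<Sum>x\<in>A. a (i, x)) mod int d = 0) \<and>
     (\<forall>j\<in>A. (\<Sum>i=1..k. a (i, suffix_prod u i k j)) mod int d = c j)}"

lemma sum_cycles_on:
  assumes "finite A" "bij_betw p A A"
  shows "(\<Sum>C\<in>cycles_on A p. \<Sum>x\<in>C. f x) = (\<Sum>x\<in>A. f x)"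
proof -
  have "\<Union> (cycles_on A p) = A"
    unfolding cycles_on_def using cycle_subset[OF assms(2)] self_in_cycle by fastforce
  moreover have "C \<inter> D = {}" if CD: "C \<in> cycles_on A p" "D \<in> cycles_on A p" "C \<noteq> D" for C D
  proof (rule ccontr)
    assume "C \<inter> D \<noteq> {}"
    then obtain z where "z \<in> C" "z \<in> D" by blast
    then show False using CD cycle_eqI[OF assms] unfolding cycles_on_def by blast
  qed
  moreover have "finite C" if "C \<in> cycles_on A p" for C
    using that cycle_subset[OF assms(2)] assms(1) finite_subset unfolding cycles_on_def by blast
  ultimately show ?thesis
    using sum.Union_disjoint[of "cycles_on A p" f] by auto
qed

lemma mem_cycle_iff:
  assumes "finite A" "bij_betw p A A" "C \<in> cycles_on A p" "x \<in> A"
  shows "cycle_through p x = C \<longleftrightarrow> x \<in> C"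
proof -
  obtain y where y: "y \<in> A" "C = cycle_through p y" using assms(3) by (auto simp: cycles_on_def)
  show ?thesis using cycle_eqI[OF assms(1,2) y(1), of x] self_in_cycle[of x p] y(2) by auto
qed

text \<open>
  The variables $a(i,x)$ are the edges of a graph joining the cycle of \<open>u i\<close> through \<open>x\<close> to the
  position \<open>j\<close> with \<open>suffix_prod u i k j = x\<close> of the product. This graph is connected because
  the \<open>u i\<close> generate a transitive group, and the prescribed sums form its boundary.
\<close>

lemma sum_weighted_lifts:
  fixes x :: "nat \<Rightarrow> 'r::comm_ring_1" and u :: "nat \<Rightarrow> 'a \<Rightarrow> 'a" and c :: "'a \<Rightarrow> int"
  assumes "finite A" "A \<noteq> {}" "d > 0" and u: "\<And>i. i \<in> {1..k} \<Longrightarrow> u i permutes A"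
    and c: "(\<Sum>j\<in>A. c j) mod int d = 0" "\<And>j. j \<in> A \<Longrightarrow> c j \<in> {0..<int d}"
    and trans: "\<And>(G :: 'a \<Rightarrow> (nat \<times> 'a set + 'a) set) x y. (\<And>i x. i \<in> {1..k} \<Longrightarrow> x \<in> A \<Longrightarrow> G (u i x) = G x)
      \<Longrightarrow> x \<in> A \<Longrightarrow> y \<in> A \<Longrightarrow> G x = G y"
  obtains F where "F * d ^ ((\<Sum>i=1..k. num_cycles A (u i)) + card A - 1) = d ^ (k * card A)"
    and "(\<Sum>a\<in>weighted_lifts d A k u c.
        \<Prod>i=1..k. \<Prod>C\<in>cycles_on A (u i). if (\<Sum>x\<in>C. a (i, x)) mod int d = 0 then x i else 1)
      = of_nat F * (\<Prod>i=1..k. \<Sum>w\<in>cycles_on A (u i) \<rightarrow>\<^sub>E {0..<int d}.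
          if (\<Sum>C\<in>cycles_on A (u i). w C) mod int d = 0 then \<Prod>C\<in>cycles_on A (u i). if w C = 0 then x i else 1 else 0)"
proof -
  let ?D = "{0..<int d}"
  define cy where "cy i = cycles_on A (u i)" for i
  define sf where "sf i = suffix_prod u i k" for i
  define E where "E = {1..k} \<times> A"
  define V :: "(nat \<times> 'a set + 'a) set" where "V = Inl ` Sigma {1..k} cy \<union> Inr ` A"
  define src :: "nat \<times> 'a \<Rightarrow> nat \<times> 'a set + 'a" where "src = (\<lambda>(i, x). Inl (i, cycle_through (u i) x))"
  define tgt :: "nat \<times> 'a \<Rightarrow> nat \<times> 'a set + 'a" where "tgt = (\<lambda>(i, x). Inr (inv_into UNIV (sf i) x))"
  let ?b = "boundary E src tgt"
  have fincy: "finite (cy i)" for i unfolding cy_def by (rule finite_cycles_on[OF assms(1)])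
  have sf: "sf i permutes A" for i unfolding sf_def by (rule suffix_prod_permutes[OF u])
  have sf_inv: "inv_into UNIV (sf i) (sf i x) = x" "sf i (inv_into UNIV (sf i) x) = x" for i x
    using permutes_inverses[OF sf[of i]] by auto
  have sf_in: "inv_into UNIV (sf i) x \<in> A \<longleftrightarrow> x \<in> A" "sf i x \<in> A \<longleftrightarrow> x \<in> A" for i x
    using permutes_in_image[OF permutes_inv[OF sf[of i]]] permutes_in_image[OF sf[of i]] by auto
  have bu: "bij_betw (u i) A A" if "i \<in> {1..k}" for i using u[OF that] by (rule permutes_imp_bij)
  have finE: "finite E" unfolding E_def using assms(1) by simp
  have finV: "finite V" unfolding V_def using assms(1) fincy by auto
  have neV: "V \<noteq> {}" unfolding V_def using assms(2) by auto
  have cardE: "card E = k * card A" unfolding E_def by (simp add: card_cartesian_product)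
  have cardV: "card V = (\<Sum>i=1..k. num_cycles A (u i)) + card A"
  proof -
    have "card V = card (Inl ` Sigma {1..k} cy :: (nat \<times> 'a set + 'a) set) + card (Inr ` A :: (nat \<times> 'a set + 'a) set)"
      unfolding V_def using assms(1) fincy by (intro card_Un_disjoint) auto
    also have "card (Inl ` Sigma {1..k} cy :: (nat \<times> 'a set + 'a) set) = card (Sigma {1..k} cy)"
      by (rule card_image) (simp add: inj_on_def)
    also have "card (Inr ` A :: (nat \<times> 'a set + 'a) set) = card A"
      by (rule card_image) (simp add: inj_on_def)
    also have "card (Sigma {1..k} cy) = (\<Sum>i=1..k. num_cycles A (u i))"
      using fincy by (simp add: num_cycles_def cy_def)
    finally show ?thesis .
  qed
  have ends: "src e \<in> V" "tgt e \<in> V" if "e \<in> E" for e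
    using that sf_in by (auto simp: E_def src_def tgt_def V_def cy_def cycles_on_def)
  have conn: "g v = g w" if g: "\<forall>e\<in>E. g (src e) = g (tgt e)" and vw: "v \<in> V" "w \<in> V"
    for g :: "nat \<times> 'a set + 'a \<Rightarrow> (nat \<times> 'a set + 'a) set" and v w
  proof -
    define G where "G x = g (Inr x)" for x
    have edge: "g (Inl (i, cycle_through (u i) x)) = G (inv_into UNIV (sf i) x)" if "i \<in> {1..k}" "x \<in> A" for i x
      using g that unfolding E_def src_def tgt_def G_def by force
    \<comment> \<open>Downward induction on i: invariance under the later factors gives invariance
      under \<open>sf i\<close>. The edges of x and \<open>u i x\<close> share their cycle vertex,
      so the labels of their positions agree, and these labels are \<open>G x\<close> and
      \<open>G (u i x)\<close>.\<close>
    have inv: "G (u i x) = G x" if "i \<in> {1..k}" "x \<in> A" for i x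
      using that
    proof (induction "k - i" arbitrary: i x rule: less_induct)
      case less
      have Gsf: "G (sf i z) = G z" if "z \<in> A" for z
        unfolding sf_def
      proof (rule suffix_prod_invariant[OF u _ that])
        fix l y assume "l \<in> {Suc i..k}" "y \<in> A"
        then show "G (u l y) = G y" by (intro less.hyps) auto
      qed
      have Gi: "G (inv_into UNIV (sf i) z) = G z" if "z \<in> A" for z
        using Gsf[of "inv_into UNIV (sf i) z"] sf_in sf_inv that by auto
      have ux: "u i x \<in> A" using less.prems u permutes_in_image by metis
      have "cycle_through (u i) (u i x) = cycle_through (u i) x"
        by (rule cycle_step[OF assms(1) bu]) (use less.prems in auto)
      then show ?case using edge[OF less.prems] edge[OF less.prems(1) ux] Gi[OF ux] Gi[OF less.prems(2)] by simp
    qed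
    obtain z where z: "z \<in> A" using assms(2) by blast
    have "g v = G z" if vV: "v \<in> V" for v
    proof (cases v)
      case (Inl ic)
      then obtain i y where i: "i \<in> {1..k}" "y \<in> A" "v = Inl (i, cycle_through (u i) y)"
        using vV by (auto simp: V_def cy_def cycles_on_def)
      then have "g v = G (inv_into UNIV (sf i) y)" using edge by simp
      also have "\<dots> = G z" by (rule trans[OF inv]) (use i z sf_in in auto)
      finally show ?thesis .
    next
      case (Inr y)
      then have "y \<in> A" using vV by (auto simp: V_def)
      then have "G y = G z" by (intro trans[OF inv]) (use z in auto)
      then show ?thesis using Inr by (simp add: G_def)
    qed
    then show ?thesis using vw by simp
  qed
  have bInl: "?b a (Inl (i, C)) = (\<Sum>x\<in>C. a (i, x))" if iC: "i \<in> {1..k}" "C \<in> cy i" for a i C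
  proof -
    have CA: "C \<subseteq> A" using iC cycle_subset[OF bu] by (auto simp: cy_def cycles_on_def)
    have "?b a (Inl (i, C)) = (\<Sum>i'\<in>{1..k}. \<Sum>x\<in>A. a (i', x) * of_bool (i' = i \<and> cycle_through (u i') x = C))"
      unfolding boundary_def E_def sum.cartesian_product by (intro sum.cong) (auto simp: src_def tgt_def)
    also have "\<dots> = (\<Sum>i'\<in>{1..k}. if i' = i then \<Sum>x\<in>A. a (i, x) * of_bool (cycle_through (u i) x = C) else 0)"
      by (intro sum.cong) auto
    also have "\<dots> = (\<Sum>x\<in>A. a (i, x) * of_bool (cycle_through (u i) x = C))" using iC by simp
    also have "\<dots> = (\<Sum>x\<in>A. if x \<in> C then a (i, x) else 0)"
      using mem_cycle_iff[OF assms(1) bu[OF iC(1)]] iC(2) by (intro sum.cong) (auto simp: cy_def)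
    also have "\<dots> = (\<Sum>x\<in>C. a (i, x))"
      using assms(1) CA by (simp add: sum.inter_restrict[symmetric] Int_absorb1)
    finally show ?thesis .
  qed
  have bInr: "?b a (Inr j) = - (\<Sum>i=1..k. a (i, sf i j))" if j: "j \<in> A" for a j
  proof -
    have "?b a (Inr j) = (\<Sum>i\<in>{1..k}. \<Sum>x\<in>A. - (a (i, x) * of_bool (inv_into UNIV (sf i) x = j)))"
      unfolding boundary_def E_def sum.cartesian_product by (intro sum.cong) (auto simp: src_def tgt_def)
    also have "\<dots> = (\<Sum>i\<in>{1..k}. \<Sum>x\<in>A. if x = sf i j then - a (i, x) else 0)"
      using sf_inv by (intro sum.cong refl) (auto simp: of_bool_def)
    also have "\<dots> = (\<Sum>i\<in>{1..k}. - a (i, sf i j))"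
      using assms(1) j sf_in by (intro sum.cong) auto
    finally show ?thesis by (simp add: sum_negf)
  qed
  \<comment> \<open>The admissible boundaries. Positions are targets of edges and enter the boundary
    negatively, whence \<open>- c j\<close>.\<close>
  define T where "T = {f \<in> V \<rightarrow>\<^sub>E ?D. (\<forall>i\<in>{1..k}. (\<Sum>C\<in>cy i. f (Inl (i, C))) mod int d = 0)
      \<and> (\<forall>j\<in>A. f (Inr j) = (- c j) mod int d)}"
  define Fib where "Fib f = {a \<in> E \<rightarrow>\<^sub>E ?D. \<forall>v\<in>V. ?b a v mod int d = f v}" for f
  have sumV: "(\<Sum>v\<in>V. f v) = (\<Sum>i=1..k. \<Sum>C\<in>cy i. f (Inl (i, C))) + (\<Sum>j\<in>A. f (Inr j))" for f :: "_ \<Rightarrow> int"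
  proof -
    have "(\<Sum>v\<in>V. f v) = (\<Sum>v\<in>Inl ` Sigma {1..k} cy. f v) + (\<Sum>v\<in>Inr ` A. f v)"
      unfolding V_def using assms(1) fincy by (intro sum.union_disjoint) auto
    also have "(\<Sum>v\<in>Inl ` Sigma {1..k} cy. f v) = (\<Sum>ic\<in>Sigma {1..k} cy. f (Inl ic))"
      by (subst sum.reindex) (auto simp: inj_on_def)
    also have "\<dots> = (\<Sum>i=1..k. \<Sum>C\<in>cy i. f (Inl (i, C)))"
      by (subst sum.Sigma) (auto simp: fincy case_prod_unfold)
    also have "(\<Sum>v\<in>Inr ` A. f v) = (\<Sum>j\<in>A. f (Inr j))"
      by (subst sum.reindex) (auto simp: inj_on_def)
    finally show ?thesis .
  qed
  have Tsum: "(\<Sum>v\<in>V. f v) mod int d = 0" if "f \<in> T" for f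
  proof -
    have "int d dvd (\<Sum>i=1..k. \<Sum>C\<in>cy i. f (Inl (i, C)))"
      by (rule dvd_sum) (use that in \<open>auto simp: T_def mod_eq_0_iff_dvd\<close>)
    moreover have "int d dvd (\<Sum>j\<in>A. f (Inr j))"
    proof -
      have "(\<Sum>j\<in>A. f (Inr j)) mod int d = (\<Sum>j\<in>A. (- c j) mod int d) mod int d" using that by (simp add: T_def)
      also have "\<dots> = (- (\<Sum>j\<in>A. c j)) mod int d" unfolding mod_sum_eq by (simp add: sum_negf)
      also have "\<dots> = 0" using c(1) by (simp add: mod_eq_0_iff_dvd)
      finally show ?thesis by (simp add: mod_eq_0_iff_dvd)
    qed
    ultimately show ?thesis unfolding sumV by (simp add: mod_eq_0_iff_dvd)
  qed
  have VInl: "Inl (i, C) \<in> V \<longleftrightarrow> i \<in> {1..k} \<and> C \<in> cy i" for i C by (auto simp: V_def)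
  have VInr: "Inr j \<in> V \<longleftrightarrow> j \<in> A" for j by (auto simp: V_def)
  \<comment> \<open>An admissible boundary with all cycle weights zero; its fibre defines the common
    size \<open>F\<close>.\<close>
  define f0 where "f0 = (\<lambda>v\<in>V. case v of Inl _ \<Rightarrow> 0 | Inr j \<Rightarrow> (- c j) mod int d)"
  have "f0 \<in> T" unfolding T_def using assms(3) by (auto simp: f0_def VInl VInr split: sum.splits)
  define F where "F = card (Fib f0)"
  have cardFib: "card (Fib f) * d ^ (card V - 1) = d ^ card E" if "f \<in> T" for f
    unfolding Fib_def
    by (rule card_boundary_fibre[OF finE finV neV assms(3) ends conn _ Tsum[OF that]]) (use that in \<open>auto simp: T_def\<close>)
  have FibF: "card (Fib f) = F" if "f \<in> T" for f
  proof -
    have "card (Fib f) * d ^ (card V - 1) = F * d ^ (card V - 1)"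
      using cardFib[OF that] cardFib[OF \<open>f0 \<in> T\<close>] unfolding F_def by metis
    then show ?thesis using assms(3) by (subst (asm) mult_cancel2) auto
  qed
  have finFib: "finite (Fib f)" for f unfolding Fib_def using finE by (simp add: finite_PiE)
  have finT: "finite T" unfolding T_def using finV by (simp add: finite_PiE)
  have lifts: "weighted_lifts d A k u c = (\<Union>f\<in>T. Fib f)"
  proof
    show "weighted_lifts d A k u c \<subseteq> (\<Union>f\<in>T. Fib f)"
    proof
      fix a assume "a \<in> weighted_lifts d A k u c"
      then have a: "a \<in> E \<rightarrow>\<^sub>E ?D" "\<And>i. i \<in> {1..k} \<Longrightarrow> (\<Sum>x\<in>A. a (i, x)) mod int d = 0"
        "\<And>j. j \<in> A \<Longrightarrow> (\<Sum>i=1..k. a (i, sf i j)) mod int d = c j"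
        by (auto simp: weighted_lifts_def E_def sf_def)
      define f where "f = (\<lambda>v\<in>V. ?b a v mod int d)"
      have "(\<Sum>C\<in>cy i. f (Inl (i, C))) mod int d = 0" if i: "i \<in> {1..k}" for i
      proof -
        have "(\<Sum>C\<in>cy i. f (Inl (i, C))) = (\<Sum>C\<in>cy i. (\<Sum>x\<in>C. a (i, x)) mod int d)"
          using i by (intro sum.cong) (auto simp: f_def VInl bInl)
        then have "(\<Sum>C\<in>cy i. f (Inl (i, C))) mod int d = (\<Sum>C\<in>cy i. (\<Sum>x\<in>C. a (i, x))) mod int d"
          by (simp add: mod_sum_eq)
        then show ?thesis using sum_cycles_on[OF assms(1) bu[OF i], of "\<lambda>x. a (i, x)"] a(2)[OF i] by (simp add: cy_def)
      qed
      moreover have "f (Inr j) = (- c j) mod int d" if "j \<in> A" for j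
        using that a(3)[OF that] by (simp add: f_def VInr bInr) (metis mod_minus_eq)
      ultimately have "f \<in> T" using assms(3) by (auto simp: T_def f_def)
      moreover have "a \<in> Fib f" using a(1) by (auto simp: Fib_def f_def)
      ultimately show "a \<in> (\<Union>f\<in>T. Fib f)" by blast
    qed
    show "(\<Union>f\<in>T. Fib f) \<subseteq> weighted_lifts d A k u c"
    proof
      fix a assume "a \<in> (\<Union>f\<in>T. Fib f)"
      then obtain f where f: "f \<in> T" "a \<in> Fib f" by blast
      have fv: "?b a v mod int d = f v" if "v \<in> V" for v using f that by (auto simp: Fib_def)
      have "(\<Sum>x\<in>A. a (i, x)) mod int d = 0" if i: "i \<in> {1..k}" for i
      proof -
        have "(\<Sum>x\<in>A. a (i, x)) mod int d = (\<Sum>C\<in>cy i. \<Sum>x\<in>C. a (i, x)) mod int d"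
          using sum_cycles_on[OF assms(1) bu[OF i], of "\<lambda>x. a (i, x)"] by (simp add: cy_def)
        also have "\<dots> = (\<Sum>C\<in>cy i. (\<Sum>x\<in>C. a (i, x)) mod int d) mod int d" by (rule mod_sum_eq[symmetric])
        also have "(\<Sum>C\<in>cy i. (\<Sum>x\<in>C. a (i, x)) mod int d) = (\<Sum>C\<in>cy i. f (Inl (i, C)))"
          using fv[of "Inl (i, _)"] i by (intro sum.cong) (auto simp: VInl bInl)
        finally show ?thesis using f(1) i by (simp add: T_def)
      qed
      moreover have "(\<Sum>i=1..k. a (i, sf i j)) mod int d = c j" if j: "j \<in> A" for j
      proof -
        have "(- (\<Sum>i=1..k. a (i, sf i j))) mod int d = (- c j) mod int d"
          using fv[of "Inr j"] j f(1) by (simp add: VInr bInr T_def)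
        then have "(\<Sum>i=1..k. a (i, sf i j)) mod int d = c j mod int d"
          by (simp add: mod_eq_dvd_iff dvd_diff_commute)
        then show ?thesis using c(2)[OF j] by simp
      qed
      ultimately show "a \<in> weighted_lifts d A k u c"
        using f(2) by (auto simp: weighted_lifts_def Fib_def E_def sf_def)
    qed
  qed
  let ?W = "\<lambda>a. \<Prod>i=1..k. \<Prod>C\<in>cy i. if (\<Sum>x\<in>C. a (i, x)) mod int d = 0 then x i else 1"
  let ?W' = "\<lambda>f. \<Prod>i=1..k. \<Prod>C\<in>cy i. if f (Inl (i, C)) = 0 then x i else 1"
  have "(\<Sum>a\<in>weighted_lifts d A k u c. ?W a) = (\<Sum>f\<in>T. \<Sum>a\<in>Fib f. ?W a)"
    unfolding lifts
  proof (rule sum.UNION_disjoint[OF finT])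
    show "\<forall>i\<in>T. \<forall>j\<in>T. i \<noteq> j \<longrightarrow> Fib i \<inter> Fib j = {}"
    proof (intro ballI impI)
      fix i j assume ij: "i \<in> T" "j \<in> T" "i \<noteq> j"
      then obtain v where v: "i v \<noteq> j v" by blast
      then have "v \<in> V" using ij by (auto simp: T_def PiE_def extensional_def)
      with v show "Fib i \<inter> Fib j = {}" by (auto simp: Fib_def)
    qed
  qed (use finFib in auto)
  also have "\<dots> = (\<Sum>f\<in>T. of_nat F * ?W' f)"
  proof (rule sum.cong[OF refl], goal_cases)
    case f: (1 f)
    have "?W a = ?W' f" if a: "a \<in> Fib f" for a
    proof (intro prod.cong refl)
      fix i C assume "i \<in> {1..k}" "C \<in> cy i"
      then have "?b a (Inl (i, C)) mod int d = f (Inl (i, C))" "?b a (Inl (i, C)) = (\<Sum>x\<in>C. a (i, x))"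
        using a VInl bInl unfolding Fib_def by blast+
      then have "(\<Sum>x\<in>C. a (i, x)) mod int d = f (Inl (i, C))" by simp
      then show "(if (\<Sum>x\<in>C. a (i, x)) mod int d = 0 then x i else 1) = (if f (Inl (i, C)) = 0 then x i else 1)" by simp
    qed
    then have "(\<Sum>a\<in>Fib f. ?W a) = (\<Sum>a\<in>Fib f. ?W' f)" by (intro sum.cong) auto
    then show ?case using FibF[OF f] by simp
  qed
  also have "\<dots> = of_nat F * (\<Sum>f\<in>T. ?W' f)" by (rule sum_distrib_left[symmetric])
  \<comment> \<open>The values at positions are prescribed, so an admissible boundary amounts to an
    independent choice of zero-sum cycle weights for each factor, and the sum factorises.\<close>
  also have "(\<Sum>f\<in>T. ?W' f) = (\<Sum>w\<in>PiE {1..k} (\<lambda>i. {w \<in> cy i \<rightarrow>\<^sub>E ?D. (\<Sum>C\<in>cy i. w C) mod int d = 0}).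
      \<Prod>i=1..k. \<Prod>C\<in>cy i. if w i C = 0 then x i else 1)"
  proof (rule sum.reindex_bij_witness[of _
      "\<lambda>w. \<lambda>v\<in>V. case v of Inl (i, C) \<Rightarrow> w i C | Inr j \<Rightarrow> (- c j) mod int d"
      "\<lambda>f. \<lambda>i\<in>{1..k}. \<lambda>C\<in>cy i. f (Inl (i, C))"], goal_cases)
    case (1 f)
    show ?case
    proof
      fix v
      show "(\<lambda>v\<in>V. case v of Inl (i, C) \<Rightarrow> (\<lambda>i\<in>{1..k}. \<lambda>C\<in>cy i. f (Inl (i, C))) i C | Inr j \<Rightarrow> (- c j) mod int d) v = f v"
        using 1 by (cases v) (auto simp: T_def VInl VInr PiE_def extensional_def)
    qed
  next
    case (2 f)
    then show ?case by (auto simp: T_def PiE_def Pi_def VInl)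
  next
    case (3 w)
    show ?case
    proof (intro ext)
      fix i C
      show "(\<lambda>i\<in>{1..k}. \<lambda>C\<in>cy i. (\<lambda>v\<in>V. case v of Inl (i, C) \<Rightarrow> w i C | Inr j \<Rightarrow> (- c j) mod int d) (Inl (i, C))) i C = w i C"
        using 3 by (auto simp: VInl PiE_def extensional_def Pi_def)
    qed
  next
    case (4 w)
    have w: "w i \<in> cy i \<rightarrow>\<^sub>E ?D" "(\<Sum>C\<in>cy i. w i C) mod int d = 0" if "i \<in> {1..k}" for i using PiE_mem[OF 4 that] by auto
    have "(\<lambda>v\<in>V. case v of Inl (i, C) \<Rightarrow> w i C | Inr j \<Rightarrow> (- c j) mod int d) \<in> V \<rightarrow>\<^sub>E ?D"
    proof (rule restrict_PiE_iff[THEN iffD2], rule ballI)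
      fix v assume "v \<in> V"
      then show "(case v of Inl (i, C) \<Rightarrow> w i C | Inr j \<Rightarrow> (- c j) mod int d) \<in> ?D"
        using PiE_mem[OF w(1)] assms(3) by (auto simp: V_def)
    qed
    moreover have "(\<Sum>C\<in>cy i. (\<lambda>v\<in>V. case v of Inl (i, C) \<Rightarrow> w i C | Inr j \<Rightarrow> (- c j) mod int d) (Inl (i, C))) = (\<Sum>C\<in>cy i. w i C)"
      if "i \<in> {1..k}" for i using that by (intro sum.cong) (auto simp: VInl)
    ultimately show ?case using w(2) by (auto simp: T_def VInr)
  next
    case (5 f)
    then show ?case by (intro prod.cong refl) auto
  qed
  also have "\<dots> = (\<Prod>i=1..k. \<Sum>w | w \<in> cy i \<rightarrow>\<^sub>E ?D \<and> (\<Sum>C\<in>cy i. w C) mod int d = 0. \<Prod>C\<in>cy i. if w C = 0 then x i else 1)"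
    using fincy by (subst prod_sum_PiE) (auto simp: finite_PiE)
  also have "\<dots> = (\<Prod>i=1..k. \<Sum>w\<in>cy i \<rightarrow>\<^sub>E ?D.
          if (\<Sum>C\<in>cy i. w C) mod int d = 0 then \<Prod>C\<in>cy i. if w C = 0 then x i else 1 else 0)"
    using fincy by (intro prod.cong refl sum.inter_filter) (simp add: finite_PiE)
  finally have eq: "(\<Sum>a\<in>weighted_lifts d A k u c. ?W a) = of_nat F * \<dots>" .
  have "F * d ^ ((\<Sum>i=1..k. num_cycles A (u i)) + card A - 1) = d ^ (k * card A)"
    using cardFib[OF \<open>f0 \<in> T\<close>] unfolding F_def cardV cardE .
  from that[OF this] eq show thesis unfolding cy_def by blast
qed

section \<open>The group $G(d,d,n)$\<close>

lemma carrier_G_ddn: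
  "(p, a) \<in> carrier (G_ddn d n) \<longleftrightarrow> p permutes {1..n} \<and> a \<in> {1..n} \<rightarrow>\<^sub>E {0..<int d} \<and> (\<Sum>i=1..n. a i) mod int d = 0"
  by (auto simp: G_ddn_def G_d1n_def)

lemma mult_G_ddn:
  "(p, a) \<otimes>\<^bsub>G_ddn d n\<^esub> (q, b) = (p \<circ> q, \<lambda>i\<in>{1..n}. (a (q i) + b i) mod int d)"
  by (simp add: G_ddn_def G_d1n_def)

lemma one_G_ddn: "\<one>\<^bsub>G_ddn d n\<^esub> = (id, \<lambda>i\<in>{1..n}. 0)"
  by (simp add: G_ddn_def G_d1n_def)

lemma group_G_ddn:
  assumes "d > 0"
  shows "group (G_ddn d n)"
proof (rule groupI)
  let ?A = "{1..n}"
  fix g h assume "g \<in> carrier (G_ddn d n)" "h \<in> carrier (G_ddn d n)"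
  then obtain p a q b where gh: "g = (p, a)" "h = (q, b)" "(p, a) \<in> carrier (G_ddn d n)" "(q, b) \<in> carrier (G_ddn d n)"
    by (metis prod.collapse)
  then have p: "p permutes ?A" "(\<Sum>i\<in>?A. a i) mod int d = 0" and q: "q permutes ?A" "(\<Sum>i\<in>?A. b i) mod int d = 0"
    by (auto simp: carrier_G_ddn)
  have "(\<Sum>i\<in>?A. (a (q i) + b i) mod int d) mod int d = (\<Sum>i\<in>?A. a (q i) + b i) mod int d"
    by (rule mod_sum_eq)
  also have "(\<Sum>i\<in>?A. a (q i) + b i) = (\<Sum>i\<in>?A. a i) + (\<Sum>i\<in>?A. b i)"
    using sum.reindex_bij_betw[OF permutes_imp_bij[OF q(1)], of a] by (simp add: sum.distrib)
  also have "\<dots> mod int d = 0" using p q by (simp add: mod_eq_0_iff_dvd)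
  finally show "g \<otimes>\<^bsub>G_ddn d n\<^esub> h \<in> carrier (G_ddn d n)"
    using assms p q gh by (auto simp: mult_G_ddn carrier_G_ddn intro!: permutes_compose)
next
  show "\<one>\<^bsub>G_ddn d n\<^esub> \<in> carrier (G_ddn d n)" using assms by (simp add: one_G_ddn carrier_G_ddn permutes_id)
next
  fix g h l assume "g \<in> carrier (G_ddn d n)" "h \<in> carrier (G_ddn d n)" "l \<in> carrier (G_ddn d n)"
  then obtain p a q b r e where gh: "g = (p, a)" "h = (q, b)" "l = (r, e)" "(r, e) \<in> carrier (G_ddn d n)"
    by (metis prod.collapse)
  then have r: "r i \<in> {1..n} \<longleftrightarrow> i \<in> {1..n}" for i
    using permutes_in_image[of r "{1..n}" i] unfolding carrier_G_ddn by blast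
  show "g \<otimes>\<^bsub>G_ddn d n\<^esub> h \<otimes>\<^bsub>G_ddn d n\<^esub> l = g \<otimes>\<^bsub>G_ddn d n\<^esub> (h \<otimes>\<^bsub>G_ddn d n\<^esub> l)"
    unfolding gh mult_G_ddn by (auto simp: fun_eq_iff r[simplified] mod_simps algebra_simps)
next
  fix g assume "g \<in> carrier (G_ddn d n)"
  then obtain p a where g: "g = (p, a)" "p permutes {1..n}" "a \<in> {1..n} \<rightarrow>\<^sub>E {0..<int d}" "(\<Sum>i=1..n. a i) mod int d = 0"
    by (metis prod.collapse carrier_G_ddn)
  have "p i \<in> {1..n} \<longleftrightarrow> i \<in> {1..n}" for i using permutes_in_image[OF g(2)] .
  then show "\<one>\<^bsub>G_ddn d n\<^esub> \<otimes>\<^bsub>G_ddn d n\<^esub> g = g"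
    unfolding g one_G_ddn mult_G_ddn using g(3) by (auto simp: fun_eq_iff PiE_def extensional_def Pi_def)
  let ?q = "inv_into UNIV p"
  let ?b = "\<lambda>i\<in>{1..n}. (- a (?q i)) mod int d"
  have q: "?q permutes {1..n}" using permutes_inv[OF g(2)] .
  have "(\<Sum>i=1..n. ?b i) mod int d = (\<Sum>i=1..n. - a (?q i)) mod int d" by (simp add: mod_sum_eq)
  also have "(\<Sum>i=1..n. - a (?q i)) = - (\<Sum>i=1..n. a i)"
    using sum.reindex_bij_betw[OF permutes_imp_bij[OF q], of a] by (simp add: sum_negf)
  also have "\<dots> mod int d = 0" using g(4) by (simp add: mod_eq_0_iff_dvd)
  finally have "(?q, ?b) \<in> carrier (G_ddn d n)" using q assms by (simp add: carrier_G_ddn)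
  moreover have "(?q, ?b) \<otimes>\<^bsub>G_ddn d n\<^esub> g = \<one>\<^bsub>G_ddn d n\<^esub>"
    unfolding g(1) mult_G_ddn one_G_ddn
    using permutes_inverses[OF g(2)] permutes_in_image[OF g(2)] permutes_inv_o[OF g(2)]
    by (auto simp: fun_eq_iff mod_simps simp del: atLeastAtMost_iff)
  ultimately show "\<exists>h\<in>carrier (G_ddn d n). h \<otimes>\<^bsub>G_ddn d n\<^esub> g = \<one>\<^bsub>G_ddn d n\<^esub>" by blast
qed

lemma order_G_ddn:
  assumes "d > 0" "n > 0"
  shows "Coset.order (G_ddn d n) = d ^ (n - 1) * fact n"
proof -
  have "carrier (G_ddn d n) = {p. p permutes {1..n}} \<times> {a \<in> {1..n} \<rightarrow>\<^sub>E {0..<int d}. (\<Sum>i\<in>{1..n}. a i) mod int d = 0}"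
  proof (rule Set.set_eqI)
    fix g :: colored_perm
    show "g \<in> carrier (G_ddn d n) \<longleftrightarrow> g \<in> {p. p permutes {1..n}} \<times> {a \<in> {1..n} \<rightarrow>\<^sub>E {0..<int d}. (\<Sum>i\<in>{1..n}. a i) mod int d = 0}"
      by (cases g) (simp only: carrier_G_ddn mem_Times_iff mem_Collect_eq fst_conv snd_conv)
  qed
  then show ?thesis
    unfolding Coset.order_def using assms card_sum_zero_functions[of "{1..n}" d] card_permutations[of "{1..n}" n]
    by (simp add: card_cartesian_product)
qed

lemma ordered_prod_Suc:
  assumes "group G" "\<And>i. i \<in> {1..Suc k} \<Longrightarrow> u i \<in> carrier G"
  shows "ordered_prod G (Suc k) u = ordered_prod G k u \<otimes>\<^bsub>G\<^esub> u (Suc k)"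
proof -
  interpret group G by fact
  have "foldr (\<otimes>\<^bsub>G\<^esub>) xs x = foldr (\<otimes>\<^bsub>G\<^esub>) xs \<one>\<^bsub>G\<^esub> \<otimes>\<^bsub>G\<^esub> x \<and> foldr (\<otimes>\<^bsub>G\<^esub>) xs \<one>\<^bsub>G\<^esub> \<in> carrier G"
    if "set xs \<subseteq> carrier G" "x \<in> carrier G" for xs x
    using that by (induction xs) (auto simp: m_assoc)
  note fold = this
  have mem: "set (map u [1..<Suc k]) \<subseteq> carrier G" "u (Suc k) \<in> carrier G" using assms(2) by auto
  have "map u [1..<Suc (Suc k)] = map u [1..<Suc k] @ [u (Suc k)]" by simp
  then have "ordered_prod G (Suc k) u = foldr (\<otimes>\<^bsub>G\<^esub>) (map u [1..<Suc k]) (u (Suc k) \<otimes>\<^bsub>G\<^esub> \<one>\<^bsub>G\<^esub>)"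
    unfolding ordered_prod_def by (simp only: foldr_append foldr.simps comp_apply id_apply)
  then show ?thesis
    using fold[OF mem] mem(2) unfolding ordered_prod_def by (simp only: r_one)
qed

text \<open>Iteration of the twist in the group law: the colour of the i-th factor is read at the
  position to which the later factors have carried j.\<close>

lemma ordered_prod_G_ddn:
  assumes "d > 0" "\<And>i. i \<in> {1..k} \<Longrightarrow> (p i, a i) \<in> carrier (G_ddn d n)"
  shows "ordered_prod (G_ddn d n) k (\<lambda>i. (p i, a i))
    = (perm_prod k p, \<lambda>j\<in>{1..n}. (\<Sum>i=1..k. a i (suffix_prod p i k j)) mod int d)"
  using assms(2)
proof (induction k)
  case 0
  then show ?case by (simp add: ordered_prod_def one_G_ddn fun_eq_iff)
next
  case (Suc k)
  have P: "p (Suc k) permutes {1..n}" using Suc.prems[of "Suc k"] by (simp add: carrier_G_ddn)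
  have IH: "ordered_prod (G_ddn d n) k (\<lambda>i. (p i, a i))
    = (perm_prod k p, \<lambda>j\<in>{1..n}. (\<Sum>i=1..k. a i (suffix_prod p i k j)) mod int d)"
    by (rule Suc.IH) (use Suc.prems in auto)
  have "ordered_prod (G_ddn d n) (Suc k) (\<lambda>i. (p i, a i))
      = ordered_prod (G_ddn d n) k (\<lambda>i. (p i, a i)) \<otimes>\<^bsub>G_ddn d n\<^esub> (p (Suc k), a (Suc k))"
    by (rule ordered_prod_Suc[OF group_G_ddn[OF assms(1)]]) (rule Suc.prems)
  then show ?case unfolding IH mult_G_ddn perm_prod_Suc
  proof (elim ssubst)
    show "(perm_prod k p \<circ> p (Suc k), \<lambda>i\<in>{1..n}. ((\<lambda>j\<in>{1..n}. (\<Sum>i=1..k. a i (suffix_prod p i k j)) mod int d) (p (Suc k) i) + a (Suc k) i) mod int d)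
      = (perm_prod k p \<circ> p (Suc k), \<lambda>j\<in>{1..n}. (\<Sum>i=1..Suc k. a i (suffix_prod p i (Suc k) j)) mod int d)"
  proof (intro arg_cong2[of _ _ _ _ Pair] refl ext)
    fix j
    show "(\<lambda>i\<in>{1..n}. ((\<lambda>j\<in>{1..n}. (\<Sum>i=1..k. a i (suffix_prod p i k j)) mod int d) (p (Suc k) i) + a (Suc k) i) mod int d) j
      = (\<lambda>j\<in>{1..n}. (\<Sum>i=1..Suc k. a i (suffix_prod p i (Suc k) j)) mod int d) j"
    proof (cases "j \<in> {1..n}")
      case True
      then have "p (Suc k) j \<in> {1..n}" using permutes_in_image[OF P] by blast
      moreover have "(\<Sum>i=1..k. a i (suffix_prod p i (Suc k) j)) = (\<Sum>i=1..k. a i (suffix_prod p i k (p (Suc k) j)))"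
        by (intro sum.cong) auto
      ultimately show ?thesis using True by (simp add: mod_simps del: suffix_prod.simps(2))
    qed (simp only: restrict_apply if_False)
  qed
  qed
qed

section \<open>The dimension of the fixed space\<close>

lemma prim_root_power_eq_1_iff: "d > 0 \<Longrightarrow> prim_root d ^ k = 1 \<longleftrightarrow> d dvd k"
proof -
  assume d: "d > 0"
  have "prim_root d ^ k = cis (2 * pi * (real k / real d))"
    by (simp add: prim_root_def DeMoivre mult_ac)
  also have "\<dots> = 1 \<longleftrightarrow> (\<exists>m::int. real k / real d = of_int m)"
  proof -
    have "cis (2 * pi * (real k / real d)) = 1 \<longleftrightarrow> cos (2 * pi * (real k / real d)) = 1"
    proof
      assume c: "cos (2 * pi * (real k / real d)) = 1"
      then have "sin (2 * pi * (real k / real d)) = 0" using sin_cos_squared_add[of "2 * pi * (real k / real d)"] by simp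
      with c show "cis (2 * pi * (real k / real d)) = 1" by (simp add: complex_eq_iff)
    qed (simp add: complex_eq_iff)
    also have "\<dots> \<longleftrightarrow> (\<exists>m::int. 2 * pi * (real k / real d) = of_int m * 2 * pi)"
      by (rule cos_one_2pi_int)
    also have "\<dots> \<longleftrightarrow> (\<exists>m::int. real k / real d = of_int m)"
    proof -
      have "2 * pi * x = y * 2 * pi \<longleftrightarrow> x = y" for x y :: real by auto
      then show ?thesis by (simp only:)
    qed
    finally show ?thesis .
  qed
  also have "\<dots> \<longleftrightarrow> (\<exists>m::int. int k = m * int d)"
  proof -
    have "real k / real d = of_int m \<longleftrightarrow> int k = m * int d" for m :: int
    proof -
      have "real k / real d = of_int m \<longleftrightarrow> real k = of_int m * real d" using d by (simp add: field_simps)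
      also have "\<dots> \<longleftrightarrow> real_of_int (int k) = real_of_int (m * int d)" by simp
      also have "\<dots> \<longleftrightarrow> int k = m * int d" by (rule of_int_eq_iff)
      finally show ?thesis .
    qed
    then show ?thesis by (simp only:)
  qed
  also have "\<dots> \<longleftrightarrow> int d dvd int k" by (auto simp: dvd_def mult.commute)
  finally show "prim_root d ^ k = 1 \<longleftrightarrow> d dvd k" by simp
qed

text \<open>Coordinates are indexed by \<open>p j\<close> because row \<open>p j\<close> of the
  monomial matrix has its only nonzero entry in column j.\<close>

lemma act_apply:
  assumes "p permutes {1..n}" "j \<in> {1..n}"
  shows "act d n (p, a) v (p j) = prim_root d ^ nat (a j) * v j"
proof -
  have "p j \<in> {1..n}" using permutes_in_image[OF assms(1)] assms(2) by blast
  moreover have "monomial_entry d (p, a) (p j) i * v i = (if i = j then prim_root d ^ nat (a i) * v i else 0)" for i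
    using inj_eq[OF permutes_inj[OF assms(1)], of j i] by (auto simp: monomial_entry_def)
  ultimately have "act d n (p, a) v (p j) = (\<Sum>i=1..n. if i = j then prim_root d ^ nat (a i) * v i else 0)"
    unfolding act_def by (simp only: if_True)
  then show ?thesis using assms(2) by simp
qed

lemma fix_space_iff:
  assumes "p permutes {1..n}"
  shows "v \<in> fix_space d n (p, a) \<longleftrightarrow> v \<in> Cn n \<and> (\<forall>j\<in>{1..n}. v (p j) = prim_root d ^ nat (a j) * v j)"
proof -
  have "act d n (p, a) v = v \<longleftrightarrow> (\<forall>j\<in>{1..n}. v (p j) = prim_root d ^ nat (a j) * v j)" if "v \<in> Cn n"
  proof
    assume eq: "\<forall>j\<in>{1..n}. v (p j) = prim_root d ^ nat (a j) * v j"
    show "act d n (p, a) v = v"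
    proof
      fix i
      show "act d n (p, a) v i = v i"
      proof (cases "i \<in> {1..n}")
        case True
        then have "i \<in> p ` {1..n}" using permutes_image[OF assms] by simp
        then obtain j where "j \<in> {1..n}" "i = p j" by blast
        then show ?thesis using act_apply[OF assms, of j d a v] eq by simp
      next
        case False
        then show ?thesis using that by (auto simp: act_def Cn_def)
      qed
    qed
  qed (metis act_apply[OF assms])
  then show ?thesis by (auto simp: fix_space_def)
qed

text \<open>A fixed vector is determined on a cycle by its value at one point. One full turn
  multiplies this value by the root of unity raised to the weight of the cycle.\<close>

lemma fix_space_funpow:
  assumes "p permutes {1..n}" "v \<in> fix_space d n (p, a)" "x \<in> {1..n}"
  shows "v ((p ^^ i) x) = prim_root d ^ (\<Sum>l<i. nat (a ((p ^^ l) x))) * v x"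
proof (induction i)
  case (Suc i)
  have "(p ^^ i) x \<in> {1..n}" using funpow_in_stable[OF permutes_imp_bij[OF assms(1)] assms(3)] .
  then show ?case using Suc assms(2) unfolding fix_space_iff[OF assms(1)] by (simp add: power_add mult_ac)
qed simp

text \<open>Links the exponent collected during one turn of a cycle, a sum of naturals in order of
  visit, to the weight of the cycle mod d.\<close>

lemma sum_nat_cycle:
  fixes n :: nat
  assumes "p permutes {1..n}" "x \<in> {1..n}" "a \<in> {1..n} \<rightarrow>\<^sub>E {0..<int d}"
  shows "d dvd (\<Sum>l<card (cycle_through p x). nat (a ((p ^^ l) x))) \<longleftrightarrow> (\<Sum>y\<in>cycle_through p x. a y) mod int d = 0"
proof -
  note bp = permutes_imp_bij[OF assms(1)]
  have sub: "cycle_through p x \<subseteq> {1..n}" by (rule cycle_subset[OF bp assms(2)])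
  have "(\<Sum>l<card (cycle_through p x). nat (a ((p ^^ l) x))) = (\<Sum>y\<in>cycle_through p x. nat (a y))"
    by (rule sum.reindex_bij_betw[OF cycle_enumeration(1)[OF finite_atLeastAtMost bp assms(2)], of "\<lambda>y. nat (a y)"])
  moreover have "int (\<Sum>y\<in>cycle_through p x. nat (a y)) = (\<Sum>y\<in>cycle_through p x. a y)"
    unfolding of_nat_sum using sub assms(3) by (intro sum.cong) (auto simp: PiE_def Pi_def)
  ultimately show ?thesis by (metis mod_eq_0_iff_dvd int_dvd_int_iff)
qed

lemma sum_fun_apply: "(\<Sum>x\<in>S. f x) i = (\<Sum>x\<in>S. f x i :: 'b::comm_monoid_add)"
  by (induction S rule: infinite_finite_induct) (simp_all add: zero_fun_def plus_fun_def)

text \<open>Every weight-0 cycle C carries a fixed vector supported on C with value 1 at a chosen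
  point \<open>r C\<close>. These vectors form a basis: a fixed vector vanishes on the other cycles
  and is determined by its values at the points \<open>r C\<close>.\<close>

lemma dim_fix_eq:
  assumes "d > 0" "(p, a) \<in> carrier (G_ddn d n)"
  shows "dim_fix d n (p, a) = card {C \<in> cycles_on {1..n} p. (\<Sum>x\<in>C. a x) mod int d = 0}"
proof -
  interpret V: vector_space scaleC by (rule vector_space_scaleC)
  let ?A = "{1..n}" and ?z = "prim_root d"
  define Zc where "Zc = {C \<in> cycles_on ?A p. (\<Sum>x\<in>C. a x) mod int d = 0}"
  have p: "p permutes ?A" and a: "a \<in> ?A \<rightarrow>\<^sub>E {0..<int d}" using assms(2) by (auto simp: carrier_G_ddn)
  note bp = permutes_imp_bij[OF p]
  have cyc: "cycle_through p x = C" if CC: "C \<in> cycles_on ?A p" and xC: "x \<in> C" for x C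
  proof -
    obtain y where y: "y \<in> ?A" "C = cycle_through p y" using CC unfolding cycles_on_def by blast
    then show ?thesis using cycle_eqI[OF _ bp y(1), of x] xC by simp
  qed
  have sub: "C \<subseteq> ?A" if "C \<in> cycles_on ?A p" for C
    using that cycle_subset[OF bp] unfolding cycles_on_def by blast
  define r where "r C = (SOME x. x \<in> C)" for C :: "nat set"
  have r: "r C \<in> C" if "C \<in> cycles_on ?A p" for C
    unfolding r_def using that self_in_cycle unfolding cycles_on_def by (metis (no_types, lifting) imageE someI)
  have rA: "r C \<in> ?A" if "C \<in> cycles_on ?A p" for C using r[OF that] sub[OF that] by blast
  have ex: "\<exists>v. v \<in> fix_space d n (p, a) \<and> v (r C) = 1 \<and> (\<forall>x. x \<notin> C \<longrightarrow> v x = 0)" if C: "C \<in> Zc" for C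
  proof -
    have CC: "C \<in> cycles_on ?A p" using C by (simp add: Zc_def)
    let ?r = "r C" and ?L = "card C"
    have Cr: "C = cycle_through p ?r" using cyc[OF CC r[OF CC]] by simp
    have enum: "bij_betw (\<lambda>i. (p ^^ i) ?r) {..<?L} C" "(p ^^ ?L) ?r = ?r"
      using cycle_enumeration[OF _ bp rA[OF CC]] unfolding Cr[symmetric] by auto
    have L: "?L > 0" using r[OF CC] finite_subset[OF sub[OF CC]] by (auto simp: card_gt_0_iff)
    define e where "e i = (\<Sum>l<i. nat (a ((p ^^ l) ?r)))" for i
    have eL: "?z ^ e ?L = 1"
      using sum_nat_cycle[OF p rA[OF CC] a] C assms(1) unfolding e_def Cr[symmetric] 
      by (simp add: prim_root_power_eq_1_iff Zc_def)
    \<comment> \<open>The powers of the root accumulated along the cycle from \<open>r C\<close>;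
      weight 0 makes them consistent where the cycle closes.\<close>
    define v where "v x = (if x \<in> C then ?z ^ e (inv_into {..<?L} (\<lambda>i. (p ^^ i) ?r) x) else 0)" for x
    have vi: "v ((p ^^ i) ?r) = ?z ^ e i" if "i < ?L" for i
    proof -
      have "(p ^^ i) ?r \<in> C" using enum(1) that by (auto simp: bij_betw_def)
      then show ?thesis using bij_betw_inv_into_left[OF enum(1), of i] that by (simp add: v_def)
    qed
    have "v (p j) = ?z ^ nat (a j) * v j" if j: "j \<in> ?A" for j
    proof (cases "j \<in> C")
      case True
      then obtain i where i: "i < ?L" "j = (p ^^ i) ?r" using enum(1) by (auto simp: bij_betw_def)
      have e1: "?z ^ nat (a j) * v j = ?z ^ e (Suc i)" using vi[OF i(1)] i(2) by (simp add: e_def power_add)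
      show ?thesis
      proof (cases "Suc i = ?L")
        case True
        then have "p j = ?r" using i(2) enum(2) by (metis funpow.simps(2) comp_apply)
        then have "v (p j) = 1" using vi[of 0] L by (simp add: e_def)
        then show ?thesis using e1 True eL by simp
      next
        case False
        then show ?thesis using vi[of "Suc i"] i e1 by simp
      qed
    next
      case False
      have "p j \<notin> C"
      proof
        assume "p j \<in> C"
        then have "cycle_through p (p j) = C" by (rule cyc[OF CC])
        then show False using cycle_step[OF _ bp j] self_in_cycle[of j p] False by simp
      qed
      then show ?thesis using False by (simp add: v_def)
    qed
    moreover have "v \<in> Cn n" using sub[OF CC] by (auto simp: v_def Cn_def)
    moreover have "v ?r = 1" using vi[of 0] L by (simp add: e_def)
    ultimately show ?thesis unfolding fix_space_iff[OF p] by (intro exI[of _ v]) (auto simp: v_def)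
  qed
  then obtain b where b: "\<And>C. C \<in> Zc \<Longrightarrow> b C \<in> fix_space d n (p, a)" "\<And>C. C \<in> Zc \<Longrightarrow> b C (r C) = 1"
    "\<And>C x. C \<in> Zc \<Longrightarrow> x \<notin> C \<Longrightarrow> b C x = 0"
    by metis
  have finZ: "finite Zc" unfolding Zc_def using finite_cycles_on[of ?A p] by simp
  have Zcy: "C \<in> cycles_on ?A p" if "C \<in> Zc" for C using that by (simp add: Zc_def)
  have br: "b C (r C') = (if C = C' then 1 else 0)" if "C \<in> Zc" "C' \<in> Zc" for C C'
  proof (cases "C = C'")
    case False
    have "r C' \<notin> C"
    proof
      assume "r C' \<in> C"
      then have "C = C'" using cyc[OF Zcy[OF that(1)], of "r C'"] cyc[OF Zcy[OF that(2)] r[OF Zcy[OF that(2)]]] by simp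
      then show False using False by simp
    qed
    then show ?thesis using b(3)[OF that(1)] False by simp
  qed (use b(2) that in simp)
  have injb: "inj_on b Zc"
    by (rule inj_onI) (metis br zero_neq_one)
  have "V.dim (fix_space d n (p, a)) = card (b ` Zc)"
  proof (rule V.dim_unique[of "b ` Zc"])
    show "b ` Zc \<subseteq> fix_space d n (p, a)" using b(1) by blast
    show "V.independent (b ` Zc)"
    proof (rule V.independent_if_scalars_zero)
      fix f v assume eq: "(\<Sum>v\<in>b ` Zc. scaleC (f v) v) = 0" and "v \<in> b ` Zc"
      then obtain C where C: "C \<in> Zc" "v = b C" by blast
      \<comment> \<open>Evaluation at \<open>r C\<close> isolates the coefficient of
        \<open>b C\<close>.\<close>
      have "0 = (\<Sum>v\<in>b ` Zc. scaleC (f v) v) (r C)" using eq by simp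
      also have "\<dots> = (\<Sum>C'\<in>Zc. f (b C') * b C' (r C))"
        by (simp add: sum_fun_apply sum.reindex[OF injb] scaleC_def)
      also have "\<dots> = (\<Sum>C'\<in>Zc. if C' = C then f (b C) else 0)"
        using br C(1) by (intro sum.cong) auto
      also have "\<dots> = f (b C)" using C(1) finZ by simp
      finally show "f v = 0" using C by simp
    qed (use finZ in simp)
    show "fix_space d n (p, a) \<subseteq> V.span (b ` Zc)"
    proof
      fix v assume v: "v \<in> fix_space d n (p, a)"
      have "v = (\<Sum>C\<in>Zc. scaleC (v (r C)) (b C))"
      proof
        fix x
        have R: "(\<Sum>C\<in>Zc. scaleC (v (r C)) (b C)) x = (\<Sum>C\<in>Zc. v (r C) * b C x)"
          by (simp add: sum_fun_apply scaleC_def)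
        show "v x = (\<Sum>C\<in>Zc. scaleC (v (r C)) (b C)) x"
        proof (cases "x \<in> ?A")
          case False
          then have "b C x = 0" if "C \<in> Zc" for C using b(1)[OF that] by (simp add: fix_space_def Cn_def)
          moreover have "v x = 0" using v False by (simp add: fix_space_def Cn_def)
          ultimately show ?thesis unfolding R by simp
        next
          case True
          let ?C = "cycle_through p x"
          have CC: "?C \<in> cycles_on ?A p" using True by (auto simp: cycles_on_def)
          show ?thesis
          proof (cases "?C \<in> Zc")
            case False
            have wt: "\<not> d dvd (\<Sum>l<card ?C. nat (a ((p ^^ l) x)))"
              using sum_nat_cycle[OF p True a] False CC by (simp add: Zc_def)
            \<comment> \<open>One turn around a cycle of nonzero weight multiplies
              \<open>v x\<close> by a number different from 1.\<close>
            have "v x = ?z ^ (\<Sum>l<card ?C. nat (a ((p ^^ l) x))) * v x"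
              using fix_space_funpow[OF p v True, of "card ?C"] cycle_enumeration(2)[OF _ bp True] by simp
            then have "v x = 0" using wt assms(1) by (simp add: prim_root_power_eq_1_iff)
            moreover have "b C x = 0" if "C \<in> Zc" for C
              using b(3)[OF that] cyc[OF Zcy[OF that], of x] False that by blast
            ultimately show ?thesis unfolding R by simp
          next
            case inZ: True
            have bC: "b C x = 0" if "C \<in> Zc" "C \<noteq> ?C" for C
              using b(3)[OF that(1)] cyc[OF Zcy[OF that(1)], of x] that by blast
            have "(\<Sum>C\<in>Zc. v (r C) * b C x) = (\<Sum>C\<in>Zc. if C = ?C then v (r ?C) * b ?C x else 0)"
              using bC by (intro sum.cong) auto
            also have "\<dots> = v (r ?C) * b ?C x" using inZ finZ by simp
            finally have S: "(\<Sum>C\<in>Zc. v (r C) * b C x) = v (r ?C) * b ?C x" .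
            have "x \<in> cycle_through p (r ?C)" using cyc[OF CC r[OF CC]] self_in_cycle[of x p] by simp
            then obtain i where i: "x = (p ^^ i) (r ?C)" by (auto simp: cycle_through_def)
            have "b ?C x = ?z ^ (\<Sum>l<i. nat (a ((p ^^ l) (r ?C))))"
              using fix_space_funpow[OF p b(1)[OF inZ] rA[OF CC], of i] b(2)[OF inZ] i by simp
            moreover have "v x = ?z ^ (\<Sum>l<i. nat (a ((p ^^ l) (r ?C)))) * v (r ?C)"
              using fix_space_funpow[OF p v rA[OF CC], of i] i by simp
            ultimately show ?thesis unfolding R S by simp
          qed
        qed
      qed
      also have "\<dots> \<in> V.span (b ` Zc)"
        by (intro V.span_sum V.span_scale V.span_base) auto
      finally show "v \<in> V.span (b ` Zc)" .
    qed
  qed simp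
  then show ?thesis unfolding dim_fix_def using card_image[OF injb] by (simp add: Zc_def)
qed

section \<open>The element c and transitivity on X\<close>

lemma cycle_of_list_upt:
  assumes "j \<in> {1..<n}"
  shows "cycle_of_list [1..<n] j = (if j = n - 1 then 1 else Suc j)"
proof -
  let ?xs = "[1..<n]"
  have "map (cycle_of_list ?xs) ?xs = rotate1 ?xs"
    using cyclic_rotation[of ?xs 1] by simp
  then have "map (cycle_of_list ?xs) ?xs ! (j - 1) = rotate1 ?xs ! (j - 1)" by simp
  moreover have "j - 1 < length ?xs" using assms by auto
  ultimately have "cycle_of_list ?xs (?xs ! (j - 1)) = ?xs ! (Suc (j - 1) mod length ?xs)"
    by (simp only: nth_map nth_rotate1)
  moreover have "?xs ! (j - 1) = j" using assms by auto
  moreover have "?xs ! (Suc (j - 1) mod length ?xs) = (if j = n - 1 then 1 else Suc j)"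
    using assms by auto
  ultimately show ?thesis by simp
qed

lemma cycle_of_list_upt_permutes: "cycle_of_list [1..<n] permutes {1..n - 1}"
proof -
  have "set [1..<n] = {1..n - 1}" by auto
  then show ?thesis using cycle_permutes[of "[1..<n]"] by simp
qed

lemma cycle_of_list_upt_funpow:
  assumes "j \<in> {1..n - 1}"
  shows "(cycle_of_list [1..<n] ^^ (j - 1)) 1 = j"
  using assms
proof (induction j)
  case (Suc j)
  show ?case
  proof (cases "j = 0")
    case False
    then have "(cycle_of_list [1..<n] ^^ (j - 1)) 1 = j" using Suc by auto
    moreover have "cycle_of_list [1..<n] j = Suc j" using cycle_of_list_upt[of j n] Suc.prems False by auto
    moreover have "Suc j - 1 = Suc (j - 1)" using False by simp
    ultimately show ?thesis by (simp only: funpow.simps comp_apply)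
  qed simp
qed simp

lemma num_cycles_cycle_of_list_upt:
  assumes "n \<ge> 2"
  shows "num_cycles {1..n - 1} (cycle_of_list [1..<n]) = 1"
proof -
  let ?c = "cycle_of_list [1..<n]"
  have 1: "1 \<in> {1..n - 1}" using assms by auto
  note b = permutes_imp_bij[OF cycle_of_list_upt_permutes[of n]]
  have "cycle_through ?c j = cycle_through ?c 1" if "j \<in> {1..n - 1}" for j
    by (rule cycle_eqI[OF _ b 1])
      (use cycle_of_list_upt_funpow[OF that] in \<open>auto simp: cycle_through_def intro: range_eqI[of _ _ "j - 1"]\<close>)
  then have "cycles_on {1..n - 1} ?c = {cycle_through ?c 1}" unfolding cycles_on_def using 1 by blast
  then show ?thesis by (simp add: num_cycles_def)
qed

lemma act_unit:
  assumes "p permutes {1..n}" "j \<in> {1..n}"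
  shows "act d n (p, a) (scaleC (prim_root d ^ i) (unit_vector j))
       = scaleC (prim_root d ^ (i + nat (a j))) (unit_vector (p j))"
proof
  fix l
  show "act d n (p, a) (scaleC (prim_root d ^ i) (unit_vector j)) l
       = scaleC (prim_root d ^ (i + nat (a j))) (unit_vector (p j)) l"
  proof (cases "l \<in> {1..n}")
    case True
    then have "l \<in> p ` {1..n}" using permutes_image[OF assms(1)] by simp
    then obtain l' where l': "l' \<in> {1..n}" "l = p l'" by blast
    show ?thesis unfolding l'(2) act_apply[OF assms(1) l'(1)]
      using inj_eq[OF permutes_inj[OF assms(1)], of l' j] by (auto simp: scaleC_def unit_vector_def power_add)
  next
    case False
    moreover have "p j \<in> {1..n}" using permutes_in_image[OF assms(1)] assms(2) by blast
    ultimately show ?thesis by (auto simp: act_def scaleC_def unit_vector_def)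
  qed
qed

lemma unit_scaled_cong:
  assumes "d > 0" "i mod d = i' mod d"
  shows "prim_root d ^ i = prim_root d ^ i'"
proof -
  have "prim_root d ^ i = prim_root d ^ (i mod d)" for i
  proof -
    have "prim_root d ^ i = prim_root d ^ (d * (i div d) + i mod d)" by simp
    also have "\<dots> = (prim_root d ^ d) ^ (i div d) * prim_root d ^ (i mod d)" by (simp only: power_add power_mult)
    also have "prim_root d ^ d = 1" using assms(1) by (simp add: prim_root_power_eq_1_iff)
    finally show ?thesis by simp
  qed
  then show ?thesis using assms(2) by metis
qed

text \<open>Multiplicativity of the action along orbits in X. Colours are reduced mod d in the
  group, which is harmless because they enter as exponents of a d-th root of unity.\<close>

lemma act_mult_unit:
  assumes "d > 0" "g \<in> carrier (G_ddn d n)" "h \<in> carrier (G_ddn d n)" "j \<in> {1..n}"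
  shows "act d n (g \<otimes>\<^bsub>G_ddn d n\<^esub> h) (scaleC (prim_root d ^ i) (unit_vector j))
       = act d n g (act d n h (scaleC (prim_root d ^ i) (unit_vector j)))"
proof -
  obtain p a q b where gh: "g = (p, a)" "h = (q, b)" by (metis prod.collapse)
  have p: "p permutes {1..n}" "a \<in> {1..n} \<rightarrow>\<^sub>E {0..<int d}" and q: "q permutes {1..n}" "b \<in> {1..n} \<rightarrow>\<^sub>E {0..<int d}"
    using assms gh by (auto simp: carrier_G_ddn)
  have qj: "q j \<in> {1..n}" using permutes_in_image[OF q(1)] assms(4) by blast
  have nn: "0 \<le> a (q j)" "0 \<le> b j" using p(2) q(2) qj assms(4) by (auto simp: PiE_def Pi_def)
  have "prim_root d ^ (i + nat ((a (q j) + b j) mod int d)) = prim_root d ^ (i + nat (b j) + nat (a (q j)))"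
  proof (rule unit_scaled_cong[OF assms(1)])
    have "nat ((a (q j) + b j) mod int d) = (nat (a (q j)) + nat (b j)) mod d"
      using nn by (simp add: nat_mod_distrib nat_add_distrib)
    then show "(i + nat ((a (q j) + b j) mod int d)) mod d = (i + nat (b j) + nat (a (q j))) mod d"
      by (simp add: mod_simps add_ac)
  qed
  then show ?thesis
    unfolding gh mult_G_ddn act_unit[OF q(1) assms(4)] act_unit[OF p(1) qj] act_unit[OF permutes_compose[OF q(1) p(1)] assms(4)]
    using assms(4) by simp
qed

text \<open>If all factors fix n, so does the group they generate, and e_n never reaches e_1.
  Conversely, c lies in that group: it carries e_1 through e_2, ..., e_(n-1) back to a root of unity
  times e_1, so the multiples of these vectors lie in one orbit, and a factor moving n connects the
  multiples of e_n to it.\<close>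

lemma transitive_on_X_iff:
  assumes "d > 0" "n \<ge> 2" and u: "\<And>i. i \<in> {1..k} \<Longrightarrow> u i \<in> carrier (G_ddn d n)"
    and prod: "ordered_prod (G_ddn d n) k u = c_ddn d n"
  shows "transitive_on_X d n (u ` {1..k}) \<longleftrightarrow> (\<exists>i\<in>{1..k}. fst (u i) n \<noteq> n)"
proof -
  let ?G = "G_ddn d n" and ?H = "generate (G_ddn d n) (u ` {1..k})"
  let ?e = "\<lambda>i j. scaleC (prim_root d ^ i) (unit_vector j)"
  interpret group ?G by (rule group_G_ddn[OF assms(1)])
  have UG: "u ` {1..k} \<subseteq> carrier ?G" using u by blast
  have sub: "subgroup ?H ?G" by (rule generate_is_subgroup[OF UG])
  have HG: "?H \<subseteq> carrier ?G" using subgroup.subset[OF sub] .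
  show ?thesis
  proof
    assume tr: "transitive_on_X d n (u ` {1..k})"
    show "\<exists>i\<in>{1..k}. fst (u i) n \<noteq> n"
    proof (rule ccontr)
      assume "\<not> ?thesis"
      then have fx: "fst (u i) n = n" if "i \<in> {1..k}" for i using that by blast
      define K where "K = {g \<in> carrier ?G. fst g n = n}"
      have "subgroup K ?G"
      proof (rule subgroupI)
        have "\<one>\<^bsub>?G\<^esub> \<in> K" unfolding K_def by (simp) (simp add: one_G_ddn)
        then show "K \<noteq> {}" by blast
        fix g assume g: "g \<in> K"
        show "inv\<^bsub>?G\<^esub> g \<in> K"
        proof -
          have gc: "g \<in> carrier ?G" "fst g n = n" using g by (auto simp: K_def)
          have "fst (inv\<^bsub>?G\<^esub> g \<otimes>\<^bsub>?G\<^esub> g) = fst (inv\<^bsub>?G\<^esub> g) \<circ> fst g"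
            by (cases "inv\<^bsub>?G\<^esub> g", cases g) (simp add: mult_G_ddn)
          then have "(fst (inv\<^bsub>?G\<^esub> g) \<circ> fst g) n = n" using l_inv[OF gc(1)] by (simp only: one_G_ddn fst_conv id_apply)
          then have "fst (inv\<^bsub>?G\<^esub> g) n = n" using gc(2) by (simp only: comp_apply)
          then show ?thesis using gc by (simp add: K_def)
        qed
        fix h assume h: "h \<in> K"
        show "g \<otimes>\<^bsub>?G\<^esub> h \<in> K"
        proof -
          have "fst (g \<otimes>\<^bsub>?G\<^esub> h) = fst g \<circ> fst h" by (cases g, cases h) (simp add: mult_G_ddn)
          then show ?thesis using g h by (simp add: K_def)
        qed
      qed (auto simp: K_def)
      moreover have "u ` {1..k} \<subseteq> K" using UG fx by (auto simp: K_def)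
      ultimately have HK: "?H \<subseteq> K" using generate_subgroup_incl by blast
      have "?e 0 n \<in> X_set d n" "?e 0 1 \<in> X_set d n" using assms(1,2) unfolding X_set_def by force+
      then obtain g where g: "g \<in> ?H" "act d n g (?e 0 n) = ?e 0 1" using tr unfolding transitive_on_X_def by blast
      obtain p a where pa: "g = (p, a)" by (metis prod.collapse)
      have "p permutes {1..n}" "p n = n" using g(1) HK pa by (auto simp: K_def carrier_G_ddn)
      then have "act d n g (?e 0 n) = ?e (0 + nat (a n)) n" unfolding pa using assms(2) act_unit[of p n n d a 0] by simp
      then have "?e (0 + nat (a n)) n 1 = ?e 0 1 1" using g(2) by simp
      then show False using assms(2) by (simp add: scaleC_def unit_vector_def)
    qed
  next
    assume "\<exists>i\<in>{1..k}. fst (u i) n \<noteq> n"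
    then obtain t where t: "t \<in> {1..k}" "fst (u t) n \<noteq> n" by blast
    define Rc where "Rc x y \<longleftrightarrow> (\<exists>g\<in>?H. act d n g x = y)" for x y
    have eX: "\<exists>i j. x = ?e i j \<and> j \<in> {1..n}" if "x \<in> X_set d n" for x using that by (auto simp: X_set_def)
    have Otrans: "Rc (?e i j) z" if O1: "Rc (?e i j) (?e i' j')" and O2: "Rc (?e i' j') z" and j: "j \<in> {1..n}" for i j i' j' z
    proof -
      obtain g h where gh: "g \<in> ?H" "act d n g (?e i j) = ?e i' j'" "h \<in> ?H" "act d n h (?e i' j') = z"
        using O1 O2 by (auto simp: Rc_def)
      then have "act d n (h \<otimes>\<^bsub>?G\<^esub> g) (?e i j) = z"
        using act_mult_unit[OF assms(1), of h n g j i] HG j by auto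
      moreover have "h \<otimes>\<^bsub>?G\<^esub> g \<in> ?H" using gh subgroup.m_closed[OF sub] by blast
      ultimately show ?thesis by (auto simp: Rc_def)
    qed
    have Osym: "Rc (?e i' j') (?e i j)" if O1: "Rc (?e i j) (?e i' j')" and j: "j \<in> {1..n}" for i j i' j'
    proof -
      obtain g where g: "g \<in> ?H" "act d n g (?e i j) = ?e i' j'" using O1 by (auto simp: Rc_def)
      have gG: "g \<in> carrier ?G" using g HG by blast
      have "act d n (inv\<^bsub>?G\<^esub> g) (?e i' j') = act d n (inv\<^bsub>?G\<^esub> g \<otimes>\<^bsub>?G\<^esub> g) (?e i j)"
        using act_mult_unit[OF assms(1) _ gG j, of "inv\<^bsub>?G\<^esub> g" i] g gG by simp
      also have "\<dots> = act d n \<one>\<^bsub>?G\<^esub> (?e i j)" using gG by (simp add: l_inv)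
      also have "\<dots> = ?e i j" unfolding one_G_ddn act_unit[OF permutes_id j] using j by simp
      finally show ?thesis unfolding Rc_def using subgroup.m_inv_closed[OF sub g(1)] by blast
    qed
    have Omem: "Rc (?e i j) (?e (i + nat (snd g j)) (fst g j))" if "g \<in> ?H" "j \<in> {1..n}" for g i j
    proof -
      obtain p a where pa: "g = (p, a)" by (metis prod.collapse)
      then have p: "p permutes {1..n}" using that HG by (auto simp: carrier_G_ddn)
      show ?thesis unfolding Rc_def using that act_unit[OF p that(2), of d a i] pa by (intro bexI[of _ g]) auto
    qed
    have cH: "c_ddn d n \<in> ?H"
    proof -
      have "foldr (\<otimes>\<^bsub>?G\<^esub>) xs \<one>\<^bsub>?G\<^esub> \<in> ?H" if "set xs \<subseteq> u ` {1..k}" for xs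
        using that by (induction xs) (auto intro: generate.one generate.eng generate.incl)
      moreover have "set (map u [1..<Suc k]) \<subseteq> u ` {1..k}" by auto
      ultimately show ?thesis unfolding prod[symmetric] ordered_prod_def by blast
    qed
    have Ostep: "Rc (?e i j) (?e i (Suc j))" if "j \<in> {1..<n - 1}" for i j
    proof -
      have j: "j \<in> {1..n}" "j \<in> {1..<n}" "j \<noteq> n - 1" "j \<noteq> n" using that by auto
      have "fst (c_ddn d n) j = Suc j" using cycle_of_list_upt[OF j(2)] j(3) by (simp add: c_ddn_def)
      moreover have "snd (c_ddn d n) j = 0" using j by (simp add: c_ddn_def)
      ultimately show ?thesis using Omem[OF cH j(1), of i] by simp
    qed
    \<comment> \<open>The colour 1 of c at position n - 1 raises the exponent when the cycle closes,
      so repeated turns reach all multiples.\<close>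
    have Oturn: "Rc (?e i (n - 1)) (?e (Suc i) 1)" for i
    proof -
      have "Rc (?e i (n - 1)) (?e (i + nat (1 mod int d)) 1)"
        using Omem[OF cH, of "n - 1" i] cycle_of_list_upt[of "n - 1" n] assms(2) by (simp add: c_ddn_def)
      moreover have "prim_root d ^ (i + nat (1 mod int d)) = prim_root d ^ Suc i"
      proof (rule unit_scaled_cong[OF assms(1)])
        have "nat (1 mod int d) = 1 mod d" by (simp add: nat_mod_distrib)
        then show "(i + nat (1 mod int d)) mod d = Suc i mod d" by (simp add: mod_simps)
      qed
      ultimately show ?thesis by simp
    qed
    have O1j: "Rc (?e i 1) (?e i j)" if "j \<in> {1..n - 1}" for i j
      using that
    proof (induction j)
      case (Suc j)
      show ?case
      proof (cases "j = 0")
        case True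
        have "act d n \<one>\<^bsub>?G\<^esub> (?e i 1) = ?e i 1"
          using assms(2) act_unit[OF permutes_id, of 1 n d "\<lambda>i\<in>{1..n}. 0" i] by (simp add: one_G_ddn)
        then have "Rc (?e i 1) (?e i 1)" unfolding Rc_def using generate.one by blast
        then show ?thesis using True by simp
      next
        case False
        then have 1: "Rc (?e i 1) (?e i j)" by (intro Suc.IH) (use Suc.prems in auto)
        have 2: "Rc (?e i j) (?e i (Suc j))" by (rule Ostep) (use Suc.prems False in auto)
        show ?thesis by (rule Otrans[OF 1 2]) (use assms(2) in auto)
      qed
    qed simp
    have n1: "n - 1 \<in> {1..n - 1}" "1 \<in> {1..n}" using assms(2) by auto
    have O0: "Rc (?e 0 1) (?e i 1)" for i
    proof (induction i)
      case 0
      show ?case using O1j[of 1 0] assms(2) by simp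
    next
      case (Suc i)
      have "Rc (?e i 1) (?e (Suc i) 1)" by (rule Otrans[OF O1j[OF n1(1)] Oturn n1(2)])
      then show ?case by (rule Otrans[OF Suc _ n1(2)])
    qed
    have O0j: "Rc (?e 0 1) (?e i j)" if "j \<in> {1..n - 1}" for i j
      by (rule Otrans[OF O0 O1j[OF that] n1(2)])
    have all: "Rc (?e 0 1) (?e i j)" if j: "j \<in> {1..n}" for i j
    proof (cases "j = n")
      case True
      have uH: "u t \<in> ?H" using t(1) by (intro generate.incl) auto
      have "fst (u t) permutes {1..n}" using u[OF t(1)] by (metis prod.collapse carrier_G_ddn)
      then have "fst (u t) n \<in> {1..n}" using permutes_in_image[of "fst (u t)" "{1..n}" n] assms(2) by auto
      then have l: "fst (u t) n \<in> {1..n - 1}" using t(2) by auto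
      have "Rc (?e i n) (?e (i + nat (snd (u t) n)) (fst (u t) n))" by (rule Omem[OF uH]) (use assms(2) in auto)
      then have "Rc (?e (i + nat (snd (u t) n)) (fst (u t) n)) (?e i n)" by (rule Osym) (use assms(2) in auto)
      then have "Rc (?e 0 1) (?e i n)" by (rule Otrans[OF O0j[OF l] _ n1(2)])
      then show ?thesis using True by simp
    next
      case False
      then show ?thesis using j by (intro O0j) auto
    qed
    show "transitive_on_X d n (u ` {1..k})"
      unfolding transitive_on_X_def Rc_def[symmetric]
    proof (intro ballI)
      fix x y assume "x \<in> X_set d n" "y \<in> X_set d n"
      then obtain i j i' j' where xy: "x = ?e i j" "j \<in> {1..n}" "y = ?e i' j'" "j' \<in> {1..n}" using eX by meson
      show "Rc x y" unfolding xy using Otrans[OF Osym[OF all[OF xy(2)] n1(2)] all[OF xy(4)] xy(2)] .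
    qed
  qed
qed

section \<open>Generating functions\<close>

text \<open>There is no division by r!, so that the expression makes sense in every commutative
  ring.\<close>

definition falling :: "nat \<Rightarrow> 'a::comm_ring_1 \<Rightarrow> 'a" where
  "falling r z = (\<Prod>j<r. z - of_nat j)"

lemma falling_0 [simp]: "falling 0 z = 1"
  by (simp add: falling_def)

lemma falling_Suc: "falling (Suc r) z = falling r z * (z - of_nat r)"
  by (simp add: falling_def)

lemma falling_Suc': "falling (Suc r) z = z * falling r (z - 1)"
  unfolding falling_def by (subst prod.lessThan_Suc_shift) (simp add: algebra_simps)

lemma falling_pochhammer: "falling r z = (-1) ^ r * pochhammer (- z) r"
  by (induction r) (simp_all add: falling_Suc pochhammer_Suc algebra_simps)

text \<open>Vandermonde's identity, transferred from rising factorials by a change of sign of the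
  arguments.\<close>

lemma falling_add:
  fixes a b :: "'a::comm_ring_1"
  shows "falling N (a + b) = (\<Sum>k\<le>N. of_nat (N choose k) * falling k a * falling (N - k) b)"
proof -
  have "falling N (a + b) = (-1) ^ N * pochhammer (- a + - b) N"
    by (simp add: falling_pochhammer)
  also have "\<dots> = (\<Sum>k\<le>N. (-1) ^ N * (of_nat (N choose k) * pochhammer (- a) k * pochhammer (- b) (N - k)))"
    unfolding pochhammer_binomial_sum by (rule sum_distrib_left)
  also have "\<dots> = (\<Sum>k\<le>N. of_nat (N choose k) * falling k a * falling (N - k) b)"
  proof (rule sum.cong[OF refl], goal_cases)
    case (1 k)
    then have "(-1 :: 'a) ^ N = (-1) ^ k * (-1) ^ (N - k)" by (simp flip: power_add)
    then show ?case
      unfolding falling_pochhammer by (simp only: mult_ac)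
  qed
  finally show ?thesis .
qed

lemma falling_of_nat: "falling r (of_nat m :: 'a::comm_ring_1) = of_nat (fact r * (m choose r))"
proof (induction r)
  case (Suc r)
  show ?case
  proof (cases "r \<le> m")
    case True
    have "fact r * (m choose r) * (m - r) = fact (Suc r) * (m choose Suc r)"
    proof -
      have "(m - r) * (m choose r) = Suc r * (m choose Suc r)"
        using binomial_absorb_comp[of m r] binomial_absorption[of r m] by (simp only:)
      then have "fact r * ((m - r) * (m choose r)) = fact r * (Suc r * (m choose Suc r))" by (simp only:)
      then show ?thesis by (simp only: fact_Suc mult_ac of_nat_id)
    qed
    then have "of_nat (fact r * (m choose r)) * (of_nat (m - r) :: 'a) = of_nat (fact (Suc r) * (m choose Suc r))"
      by (metis of_nat_mult)
    then show ?thesis unfolding falling_Suc Suc using True by (simp only: of_nat_diff)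
  qed (simp add: falling_Suc Suc binomial_eq_0)
qed simp

text \<open>The factors are consecutive, so the product is a falling factorial from its largest
  factor y + N - s. Writing the latter as y - 1 plus a natural number makes Vandermonde's identity
  produce \<open>falling k (y - 1)\<close>, or \<open>falling k y\<close> when y is replaced by y +
  1.\<close>

lemma content_prod_falling:
  fixes y :: "'a::comm_ring_1"
  assumes "s \<le> Suc N"
  shows "content_prod N s y = falling N (y - 1 + of_nat (Suc N - s))"
proof -
  have "content_prod N s y = (\<Prod>j=1..N. y + of_nat (N + 1 - j) - of_nat s)"
    unfolding content_prod_def by (rule prod.atLeastAtMost_rev)
  also have "\<dots> = (\<Prod>j<N. y + of_nat (N - j) - of_nat s)"
    by (rule prod.reindex_bij_witness[of _ Suc "\<lambda>j. j - 1"]) auto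
  also have "\<dots> = falling N (y - 1 + of_nat (Suc N - s))"
    unfolding falling_def
  proof (rule prod.cong[OF refl], goal_cases)
    case (1 j)
    then have "j \<le> N" by simp
    then show ?case
      using assms by (simp add: of_nat_diff algebra_simps)
  qed
  finally show ?thesis .
qed

lemma content_prod_expand:
  fixes y :: "'a::comm_ring_1"
  assumes "s \<le> Suc N"
  shows "content_prod N s y = (\<Sum>k\<le>N. of_nat ((N choose k) * fact (N - k)) * of_nat ((Suc N - s) choose (N - k)) * falling k (y - 1))"
  unfolding content_prod_falling[OF assms] falling_add falling_of_nat by (simp add: mult_ac)

text \<open>In the variable y the step d of \<open>d_falling\<close> becomes 1. The linear factor
  splits as x - k (d-1) = (y+1) + (d-1) (y-k): one term for the value y + 1 and d - 1 terms for the
  value y. This is the origin of the factor x - (m-1)(d-1) in P_m.\<close>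

lemma P_poly_falling:
  fixes y :: "'a::comm_ring_1"
  assumes "d > 0"
  shows "P_poly d (Suc k) (1 + of_nat d * y)
    = of_nat d ^ k * ((y + 1) * falling k y + of_nat (d - 1) * (y * falling k (y - 1)))"
proof -
  let ?x = "1 + of_nat d * y"
  have df: "d_falling d k ?x = of_nat d ^ k * falling k y"
  proof -
    have "d_falling d k ?x = (\<Prod>i=1..k. of_nat d * (y - of_nat (i - 1)))"
      unfolding d_falling_def by (intro prod.cong) (auto simp: algebra_simps)
    also have "\<dots> = (\<Prod>i<k. of_nat d * (y - of_nat i))"
      by (rule prod.reindex_bij_witness[of _ Suc "\<lambda>j. j - 1"]) auto
    finally show ?thesis by (simp add: falling_def prod.distrib)
  qed
  have "P_poly d (Suc k) ?x = (?x - of_nat (k * (d - 1))) * d_falling d k ?x"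
    by (cases k) (auto simp: P_poly_def d_falling_def)
  also have "\<dots> = of_nat d ^ k * (falling k y * (?x - of_nat k * of_nat (d - 1)))"
    unfolding df by (simp add: mult_ac)
  also have "?x - of_nat k * of_nat (d - 1) = (y + 1) + of_nat (d - 1) * (y - of_nat k)"
  proof -
    have "(of_nat d :: 'a) = of_nat (d - 1) + 1" using assms by (simp add: of_nat_diff)
    then show ?thesis by (simp only: algebra_simps) (simp add: algebra_simps)
  qed
  also have "falling k y * ((y + 1) + of_nat (d - 1) * (y - of_nat k))
     = (y + 1) * falling k y + of_nat (d - 1) * (falling k y * (y - of_nat k))" by (simp add: algebra_simps)
  \<comment> \<open>Both sides are \<open>falling (Suc k) y\<close>, with the last or the first
    factor split off.\<close>
  also have "falling k y * (y - of_nat k) = y * falling k (y - 1)"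
    by (metis falling_Suc falling_Suc')
  finally show ?thesis .
qed

section \<open>Polynomials in several variables and the coefficients M\<close>

lemma Const_mult: "Const a * Const b = (Const (a * b) :: 'a::comm_ring_1 mpoly)"
  by (simp add: Const_def mult_single)

lemma Const_1: "Const 1 = (1 :: 'a::comm_ring_1 mpoly)"
  by (simp add: Const_def)

lemma Const_add: "Const (a + b) = Const a + (Const b :: 'a::comm_ring_1 mpoly)"
  by (simp add: Const_def single_add)

lemma Const_0: "Const 0 = (0 :: 'a::comm_ring_1 mpoly)"
  by (simp add: Const_def)

lemma Const_uminus: "Const (- a) = - (Const a :: 'a::comm_ring_1 mpoly)"
  by (simp add: Const_def single_uminus)

lemma Const_of_nat: "Const (of_nat m) = (of_nat m :: 'a::comm_ring_1 mpoly)"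
  by (induction m) (simp_all add: Const_0 Const_add Const_1)

lemma Const_power: "Const a ^ m = (Const (a ^ m) :: 'a::comm_ring_1 mpoly)"
  by (induction m) (simp_all add: Const_1 Const_mult)

lemma Const_sum: "Const (\<Sum>i\<in>I. f i) = (\<Sum>i\<in>I. Const (f i) :: 'a::comm_ring_1 mpoly)"
  by (induction I rule: infinite_finite_induct) (simp_all add: Const_0 Const_add)

lemma Const_prod: "Const (\<Prod>i\<in>I. f i) = (\<Prod>i\<in>I. Const (f i) :: 'a::comm_ring_1 mpoly)"
  by (induction I rule: infinite_finite_induct) (simp_all add: Const_1 Const_mult[symmetric])

lemma Var_power: "Var i ^ m = (Poly_Mapping.single (Poly_Mapping.single i m) 1 :: 'a::comm_ring_1 mpoly)"
  by (induction m) (simp_all add: Var_def mult_single flip: single_add)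

text \<open>Passes from functions on \<open>{1..k}\<close>, over which products of sums expand, to
  the exponents of monomials.\<close>

definition exponent_vector :: "nat \<Rightarrow> (nat \<Rightarrow> nat) \<Rightarrow> nat \<Rightarrow>\<^sub>0 nat" where
  "exponent_vector k q = (\<Sum>i=1..k. Poly_Mapping.single i (q i))"

lemma lookup_exponent_vector:
  "Poly_Mapping.lookup (exponent_vector k q) i = (if i \<in> {1..k} then q i else 0)"
  unfolding exponent_vector_def lookup_sum lookup_single
  by (simp add: when_def)

lemma prod_Var_power:
  "(\<Prod>i=1..k. Var i ^ q i) = (Poly_Mapping.single (exponent_vector k q) 1 :: 'a::comm_ring_1 mpoly)"
  unfolding exponent_vector_def by (induction k) (simp_all add: Var_power mult_single)

lemma exponent_vector_eq_iff:
  "exponent_vector k q = p \<longleftrightarrow> Poly_Mapping.keys p \<subseteq> {1..k} \<and> (\<forall>i\<in>{1..k}. q i = Poly_Mapping.lookup p i)"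
proof -
  have "exponent_vector k q = p \<longleftrightarrow> (\<forall>i. (if i \<in> {1..k} then q i else 0) = Poly_Mapping.lookup p i)"
    unfolding poly_mapping_eq_iff fun_eq_iff lookup_exponent_vector ..
  also have "\<dots> \<longleftrightarrow> Poly_Mapping.keys p \<subseteq> {1..k} \<and> (\<forall>i\<in>{1..k}. q i = Poly_Mapping.lookup p i)"
    by (auto simp: subset_iff in_keys_iff split: if_splits) (metis neq0_conv)+
  finally show ?thesis .
qed

text \<open>The lower index n - q makes the binomial vanish for q < s, so that the range of q is the
  same for all s.\<close>

lemma power_times_one_plus_power:
  fixes X :: "'a::comm_ring_1"
  assumes "s \<le> n"
  shows "X ^ s * (1 + X) ^ (n - s) = (\<Sum>q\<le>n. of_nat ((n - s) choose (n - q)) * X ^ q)"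
proof -
  have "(1 + X) ^ (n - s) = (\<Sum>r\<le>n - s. of_nat ((n - s) choose r) * X ^ (n - s - r))"
    using binomial_ring[of 1 X "n - s"] by simp
  then have "X ^ s * (1 + X) ^ (n - s) = (\<Sum>r\<le>n - s. of_nat ((n - s) choose r) * X ^ (n - r))"
  proof (simp only: sum_distrib_left, intro sum.cong refl)
    fix r assume "r \<in> {..n - s}"
    then have "s + (n - s - r) = n - r" using assms by auto
    then show "X ^ s * (of_nat ((n - s) choose r) * X ^ (n - s - r)) = of_nat ((n - s) choose r) * X ^ (n - r)"
      by (metis mult.left_commute power_add)
  qed
  also have "\<dots> = (\<Sum>r\<le>n. of_nat ((n - s) choose r) * X ^ (n - r))"
    by (rule sum.mono_neutral_left) (auto simp: binomial_eq_0)
  also have "\<dots> = (\<Sum>q\<le>n. of_nat ((n - s) choose (n - q)) * X ^ q)"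
    by (rule sum.reindex_bij_witness[of _ "\<lambda>q. n - q" "\<lambda>q. n - q"]) auto
  finally show ?thesis .
qed

text \<open>Binomial expansion by the number s of factors from which the full product of the
  variables is taken. The second part confines the support to a finite box.\<close>

lemma M_coeff_eq:
  assumes "q \<in> {1..k} \<rightarrow>\<^sub>E {..n}"
  shows "M_coeff n k (exponent_vector k q)
    = (\<Sum>s\<le>n. (-1) ^ s * of_nat (n choose s) * (\<Prod>i=1..k. of_nat ((n - s) choose (n - q i))))"
    and "Poly_Mapping.keys p = {1..k} \<Longrightarrow> M_coeff n k p \<noteq> 0 \<Longrightarrow> \<exists>q\<in>{1..k} \<rightarrow>\<^sub>E {1..n}. exponent_vector k q = p"
proof -
  let ?U = "\<Prod>i=1..k. 1 + Var i :: rat mpoly" and ?V = "\<Prod>i=1..k. Var i :: rat mpoly"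
  have "(?U - ?V) ^ n = (- ?V + ?U) ^ n" by simp
  also have "\<dots> = (\<Sum>s\<le>n. of_nat (n choose s) * (- ?V) ^ s * ?U ^ (n - s))" by (rule binomial_ring)
  also have "\<dots> = (\<Sum>s\<le>n. \<Sum>q\<in>{1..k} \<rightarrow>\<^sub>E {..n}.
      Const ((-1) ^ s * of_nat (n choose s) * (\<Prod>i=1..k. of_nat ((n - s) choose (n - q i)))) * Poly_Mapping.single (exponent_vector k q) 1)"
  proof (rule sum.cong[OF refl], goal_cases)
    case (1 s)
    then have s: "s \<le> n" by simp
    have "(- ?V) ^ s * ?U ^ (n - s) = (-1) ^ s * (\<Prod>i=1..k. Var i ^ s * (1 + Var i) ^ (n - s))"
      unfolding power_minus[of ?V] prod_power_distrib prod.distrib by (simp only: mult.assoc)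
    also have "(\<Prod>i=1..k. Var i ^ s * (1 + Var i) ^ (n - s)) = (\<Prod>i=1..k. \<Sum>q\<le>n. of_nat ((n - s) choose (n - q)) * Var i ^ q :: rat mpoly)"
      by (simp only: power_times_one_plus_power[OF s])
    also have "\<dots> = (\<Sum>q\<in>{1..k} \<rightarrow>\<^sub>E {..n}. \<Prod>i=1..k. of_nat ((n - s) choose (n - q i)) * Var i ^ q i)"
      by (rule prod_sum_PiE) auto
    also have "\<dots> = (\<Sum>q\<in>{1..k} \<rightarrow>\<^sub>E {..n}. (\<Prod>i=1..k. of_nat ((n - s) choose (n - q i))) * Poly_Mapping.single (exponent_vector k q) 1)"
      by (simp only: prod.distrib prod_Var_power)
    finally have "(- ?V) ^ s * ?U ^ (n - s) = (-1) ^ s * \<dots>" .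
    then have "of_nat (n choose s) * (- ?V) ^ s * ?U ^ (n - s) = of_nat (n choose s) * ((-1) ^ s * (\<Sum>q\<in>{1..k} \<rightarrow>\<^sub>E {..n}.
       (\<Prod>i=1..k. of_nat ((n - s) choose (n - q i))) * Poly_Mapping.single (exponent_vector k q) 1))"
      by (simp only: mult.assoc)
    also have "\<dots> = (\<Sum>q\<in>{1..k} \<rightarrow>\<^sub>E {..n}.
      Const ((-1) ^ s * of_nat (n choose s) * (\<Prod>i=1..k. of_nat ((n - s) choose (n - q i)))) * Poly_Mapping.single (exponent_vector k q) 1)"
      unfolding sum_distrib_left
      by (simp only: Const_mult[symmetric] Const_power[symmetric] Const_uminus Const_1 Const_of_nat Const_prod mult_ac)
    finally show ?case .
  qed
  finally have "M_coeff n k p = (\<Sum>s\<le>n. \<Sum>q\<in>{1..k} \<rightarrow>\<^sub>E {..n}.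
      ((-1) ^ s * of_nat (n choose s) * (\<Prod>i=1..k. of_nat ((n - s) choose (n - q i))) when exponent_vector k q = p))" for p
    unfolding M_coeff_def by (simp add: lookup_sum Const_def mult_single lookup_single)
  then have M: "M_coeff n k p = (\<Sum>q\<in>{1..k} \<rightarrow>\<^sub>E {..n}. \<Sum>s\<le>n.
      ((-1) ^ s * of_nat (n choose s) * (\<Prod>i=1..k. of_nat ((n - s) choose (n - q i))) when exponent_vector k q = p))" for p
    by (subst sum.swap)
  have inj: "q' = q" if "q' \<in> {1..k} \<rightarrow>\<^sub>E {..n}" "q \<in> {1..k} \<rightarrow>\<^sub>E {..n}" "exponent_vector k q' = exponent_vector k q" for q q'
  proof (rule PiE_ext[OF that(1,2)])
    fix i assume "i \<in> {1..k}"
    then show "q' i = q i" using lookup_exponent_vector[of k q i] lookup_exponent_vector[of k q' i] that(3) by simp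
  qed
  have fin: "finite ({1..k} \<rightarrow>\<^sub>E {..n})" by (intro finite_PiE) auto
  have "M_coeff n k (exponent_vector k q) = (\<Sum>q'\<in>{1..k} \<rightarrow>\<^sub>E {..n}. if q' = q then \<Sum>s\<le>n.
      ((-1) ^ s * of_nat (n choose s) * (\<Prod>i=1..k. of_nat ((n - s) choose (n - q i)))) else 0)"
    unfolding M
  proof (rule sum.cong[OF refl], goal_cases)
    case q': (1 q')
    show ?case
    proof (cases "q' = q")
      case False
      then have "exponent_vector k q' \<noteq> exponent_vector k q" using inj[OF q' assms] by blast
      then show ?thesis using False by simp
    qed simp
  qed
  then show "M_coeff n k (exponent_vector k q)
    = (\<Sum>s\<le>n. (-1) ^ s * of_nat (n choose s) * (\<Prod>i=1..k. of_nat ((n - s) choose (n - q i))))"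
    using fin assms by simp
  show "\<exists>q\<in>{1..k} \<rightarrow>\<^sub>E {1..n}. exponent_vector k q = p" if keys: "Poly_Mapping.keys p = {1..k}" and nz: "M_coeff n k p \<noteq> 0"
  proof -
    obtain q where q: "q \<in> {1..k} \<rightarrow>\<^sub>E {..n}" "exponent_vector k q = p"
    proof (rule ccontr)
      assume "\<not> thesis"
      then have "\<forall>q\<in>{1..k} \<rightarrow>\<^sub>E {..n}. exponent_vector k q \<noteq> p" using that by blast
      then have "M_coeff n k p = 0" unfolding M by (simp add: when_def)
      then show False using nz by simp
    qed
    have "q i \<ge> 1" if "i \<in> {1..k}" for i
      using that q(2) keys lookup_exponent_vector[of k q i] in_keys_iff[of i p] by auto
    then have "q \<in> {1..k} \<rightarrow>\<^sub>E {1..n}" using q(1) by (auto simp: PiE_def Pi_def)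
    with q(2) show ?thesis by blast
  qed
qed

section \<open>From factorizations in G(d,d,n) to sums over the symmetric group\<close>

lemma suffix_prod_cong:
  "(\<And>l. l \<in> {1..k} \<Longrightarrow> u l = v l) \<Longrightarrow> suffix_prod u i k = suffix_prod v i k"
  by (induction k) auto

definition factorizations :: "nat \<Rightarrow> nat \<Rightarrow> nat \<Rightarrow> (nat \<Rightarrow> colored_perm) set" where
  "factorizations d n k = {u. u \<in> {1..k} \<rightarrow>\<^sub>E carrier (G_ddn d n) \<and> ordered_prod (G_ddn d n) k u = c_ddn d n \<and>
         transitive_on_X d n (u ` {1..k})}"

text \<open>Each coefficient collects the factorizations with a given vector \<rho> of dimensions;
  grouping by \<rho> turns the series into a sum over single factorizations.\<close>

lemma sum_transitive_factorizations:
  "Sum_any (\<lambda>r. (of_nat (b_coeff d n k r) * (\<Prod>i=1..k. Var i ^ Poly_Mapping.lookup r i)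
          when Poly_Mapping.keys r \<subseteq> {1..k}))
    = (\<Sum>u\<in>factorizations d n k. \<Prod>i=1..k. Var i ^ dim_fix d n (u i) :: rat mpoly)"
proof -
  define TF where "TF = factorizations d n k"
  define \<rho> where "\<rho> u = exponent_vector k (\<lambda>i. dim_fix d n (u i))" for u
  let ?g = "\<lambda>r. (of_nat (b_coeff d n k r) * (\<Prod>i=1..k. Var i ^ Poly_Mapping.lookup r i)
          when Poly_Mapping.keys r \<subseteq> {1..k}) :: rat mpoly"
  have fin: "finite TF" unfolding TF_def factorizations_def
    by (rule finite_subset[of _ "{1..k} \<rightarrow>\<^sub>E carrier (G_ddn d n)"]) (auto intro!: finite_PiE finite_carrier_G_ddn)
  have TFr: "transitive_factorizations d n k r = {u \<in> TF. \<rho> u = r}" if "Poly_Mapping.keys r \<subseteq> {1..k}" for r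
    unfolding transitive_factorizations_def TF_def factorizations_def \<rho>_def exponent_vector_eq_iff using that by blast
  have keys: "Poly_Mapping.keys (\<rho> u) \<subseteq> {1..k}" for u
    using exponent_vector_eq_iff[of k "\<lambda>i. dim_fix d n (u i)" "\<rho> u"] by (simp add: \<rho>_def)
  have "Sum_any ?g = (\<Sum>r\<in>\<rho> ` TF. ?g r)"
  proof (rule Sum_any.expand_superset)
    show "finite (\<rho> ` TF)" using fin by simp
    show "{r. ?g r \<noteq> 0} \<subseteq> \<rho> ` TF"
    proof
      fix r assume "r \<in> {r. ?g r \<noteq> 0}"
      then have k: "Poly_Mapping.keys r \<subseteq> {1..k}" and "b_coeff d n k r \<noteq> 0"
        by (auto simp: when_def split: if_splits intro!: gr0I)
      then have "transitive_factorizations d n k r \<noteq> {}" by (auto simp: b_coeff_def)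
      then show "r \<in> \<rho> ` TF" unfolding TFr[OF k] by blast
    qed
  qed
  also have "\<dots> = (\<Sum>r\<in>\<rho> ` TF. \<Sum>u | u \<in> TF \<and> \<rho> u = r. \<Prod>i=1..k. Var i ^ dim_fix d n (u i))"
  proof (rule sum.cong[OF refl], goal_cases)
    case (1 r)
    then have k: "Poly_Mapping.keys r \<subseteq> {1..k}" using keys by blast
    have "(\<Prod>i=1..k. Var i ^ dim_fix d n (u i)) = (\<Prod>i=1..k. Var i ^ Poly_Mapping.lookup r i :: rat mpoly)" if "\<rho> u = r" for u
      using that unfolding \<rho>_def exponent_vector_eq_iff by (intro prod.cong) auto
    then have "(\<Sum>u | u \<in> TF \<and> \<rho> u = r. \<Prod>i=1..k. Var i ^ dim_fix d n (u i))
      = (\<Sum>u | u \<in> TF \<and> \<rho> u = r. \<Prod>i=1..k. Var i ^ Poly_Mapping.lookup r i :: rat mpoly)" by (intro sum.cong) auto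
    then show ?case
      using k TFr[OF k] by (simp add: b_coeff_def)
  qed
  also have "\<dots> = (\<Sum>u\<in>TF. \<Prod>i=1..k. Var i ^ dim_fix d n (u i))"
    by (rule sum.image_gen[OF fin, symmetric])
  finally show ?thesis unfolding TF_def .
qed

text \<open>A factorization is split into its permutations and its colours, the latter as one
  function of the pairs (i, j). Transitivity is a condition on the permutations, and by
  \<open>dim_fix_eq\<close> the power of \<open>x i\<close> is a product over cycles with a factor
  \<open>x i\<close> for each cycle of weight 0.\<close>

lemma sum_factorizations_lifts:
  fixes x :: "nat \<Rightarrow> 'r::comm_ring_1"
  assumes "d > 0" "n \<ge> 2"
  shows "(\<Sum>u\<in>factorizations d n k. \<Prod>i=1..k. x i ^ dim_fix d n (u i))
    = (\<Sum>p | p \<in> {1..k} \<rightarrow>\<^sub>E {p. p permutes {1..n}} \<and> perm_prod k p = fst (c_ddn d n) \<and> (\<exists>i\<in>{1..k}. p i n \<noteq> n).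
        \<Sum>a\<in>weighted_lifts d {1..n} k p (snd (c_ddn d n)).
          \<Prod>i=1..k. \<Prod>C\<in>cycles_on {1..n} (p i). if (\<Sum>j\<in>C. a (i, j)) mod int d = 0 then x i else 1)"
proof -
  let ?A = "{1..n}" and ?D = "{0..<int d}"
  let ?w = "\<lambda>p a. \<Prod>i=1..k. \<Prod>C\<in>cycles_on ?A (p i). if (\<Sum>j\<in>C. a (i, j)) mod int d = 0 then x i else 1"
  define TF where "TF = factorizations d n k"
  define PP where "PP = {p. p \<in> {1..k} \<rightarrow>\<^sub>E {p. p permutes ?A} \<and> perm_prod k p = fst (c_ddn d n) \<and> (\<exists>i\<in>{1..k}. p i n \<noteq> n)}"
  define L where "L p = weighted_lifts d ?A k p (snd (c_ddn d n))" for p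
  define mk where "mk = (\<lambda>(p, a). \<lambda>i\<in>{1..k}. (p i, \<lambda>j\<in>?A. a (i, j)) :: colored_perm)"
  define un where "un u = (\<lambda>i\<in>{1..k}. fst (u i), \<lambda>ij\<in>{1..k} \<times> ?A. snd (u (fst ij)) (snd ij))" for u :: "nat \<Rightarrow> colored_perm"
  have finPP: "finite PP" unfolding PP_def
    by (rule finite_subset[of _ "{1..k} \<rightarrow>\<^sub>E {p. p permutes ?A}"]) (auto intro!: finite_PiE finite_permutations)
  have finL: "finite (L p)" for p unfolding L_def weighted_lifts_def
    by (rule finite_subset[of _ "({1..k} \<times> ?A) \<rightarrow>\<^sub>E ?D"]) (auto intro!: finite_PiE)
  have c_ext: "snd (c_ddn d n) j = undefined" if "j \<notin> ?A" for j
    unfolding c_ddn_def snd_conv by (simp only: restrict_apply that if_False)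
  have mem: "(p, a) \<in> carrier (G_ddn d n) \<longleftrightarrow> p permutes ?A \<and> a \<in> ?A \<rightarrow>\<^sub>E ?D \<and> (\<Sum>i\<in>?A. a i) mod int d = 0" for p a
    by (rule carrier_G_ddn)
  have "(\<Sum>u\<in>TF. \<Prod>i=1..k. x i ^ dim_fix d n (u i)) = (\<Sum>pa\<in>Sigma PP L. ?w (fst pa) (snd pa))"
  proof (rule sum.reindex_bij_witness[of _ mk un])
    fix u assume u: "u \<in> TF"
    then have uc: "u \<in> {1..k} \<rightarrow>\<^sub>E carrier (G_ddn d n)" "ordered_prod (G_ddn d n) k u = c_ddn d n"
      "transitive_on_X d n (u ` {1..k})" by (auto simp: TF_def factorizations_def)
    have ui: "(fst (u i), snd (u i)) \<in> carrier (G_ddn d n)" if "i \<in> {1..k}" for i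
      using PiE_mem[OF uc(1) that] by simp
    note ui' = ui[unfolded mem]
    show "mk (un u) = u"
    proof
      fix i
      show "mk (un u) i = u i"
      proof (cases "i \<in> {1..k}")
        case True
        have "(\<lambda>j\<in>?A. (\<lambda>ij\<in>{1..k} \<times> ?A. snd (u (fst ij)) (snd ij)) (i, j)) = snd (u i)"
        proof
          fix j
          show "(\<lambda>j\<in>?A. (\<lambda>ij\<in>{1..k} \<times> ?A. snd (u (fst ij)) (snd ij)) (i, j)) j = snd (u i) j"
          proof (cases "j \<in> ?A")
            case False
            have "snd (u i) \<in> ?A \<rightarrow>\<^sub>E ?D" using ui'[OF True] by blast
            from PiE_arb[OF this False] show ?thesis using False by (simp only: restrict_apply if_False)
          qed (use True in simp)
        qed
        then show ?thesis using True by (simp add: mk_def un_def)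
      next
        case False
        then show ?thesis using PiE_arb[OF uc(1) False] unfolding mk_def un_def prod.case by (simp only: restrict_apply if_False)
      qed
    qed
    have op: "ordered_prod (G_ddn d n) k u = (perm_prod k (\<lambda>i. fst (u i)),
        \<lambda>j\<in>?A. (\<Sum>i=1..k. snd (u i) (suffix_prod (\<lambda>i. fst (u i)) i k j)) mod int d)"
      using ordered_prod_G_ddn[OF assms(1), of k "\<lambda>i. fst (u i)" "\<lambda>i. snd (u i)" n] ui by simp
    have pp: "perm_prod k (fst (un u)) = perm_prod k (\<lambda>i. fst (u i))"
      by (rule perm_prod_cong) (simp add: un_def)
    have sp: "suffix_prod (fst (un u)) i k = suffix_prod (\<lambda>i. fst (u i)) i k" for i
      by (rule suffix_prod_cong) (simp add: un_def)
    have ex: "\<exists>i\<in>{1..k}. fst (u i) n \<noteq> n"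
      using transitive_on_X_iff[OF assms PiE_mem[OF uc(1)] uc(2)] uc(3) by (rule iffD1)
    have "perm_prod k (\<lambda>i. fst (u i)) = fst (c_ddn d n)"
      using arg_cong[OF trans[OF op[symmetric] uc(2)], of fst] by (simp only: fst_conv)
    then have "fst (un u) \<in> PP"
      unfolding PP_def
    proof (intro CollectI conjI)
      show "fst (un u) \<in> {1..k} \<rightarrow>\<^sub>E {p. p permutes ?A}"
        unfolding un_def fst_conv by (rule restrict_PiE_iff[THEN iffD2]) (use ui' in blast)
      show "\<exists>i\<in>{1..k}. fst (un u) i n \<noteq> n" using ex by (auto simp: un_def)
    qed (use pp in simp)
    moreover have "snd (un u) \<in> L (fst (un u))"
      unfolding L_def weighted_lifts_def
    proof (intro CollectI conjI ballI)
      show "snd (un u) \<in> {1..k} \<times> ?A \<rightarrow>\<^sub>E ?D"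
        unfolding un_def snd_conv by (rule restrict_PiE_iff[THEN iffD2]) (use ui' in \<open>auto simp: PiE_def Pi_def\<close>)
    next
      fix i assume i: "i \<in> {1..k}"
      have "(\<Sum>j\<in>?A. snd (un u) (i, j)) = (\<Sum>j\<in>?A. snd (u i) j)"
        using i by (intro sum.cong) (auto simp: un_def)
      then show "(\<Sum>j\<in>?A. snd (un u) (i, j)) mod int d = 0" using ui'[OF i] by simp
    next
      fix j assume j: "j \<in> ?A"
      have "suffix_prod (\<lambda>i. fst (u i)) i k permutes ?A" for i
        by (rule suffix_prod_permutes) (use ui' in blast)
      then have "suffix_prod (\<lambda>i. fst (u i)) i k j \<in> ?A" for i using permutes_in_image j by metis
      then have "(\<Sum>i=1..k. snd (un u) (i, suffix_prod (fst (un u)) i k j)) = (\<Sum>i=1..k. snd (u i) (suffix_prod (\<lambda>i. fst (u i)) i k j))"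
        unfolding sp by (intro sum.cong) (auto simp: un_def)
      moreover have "(\<Sum>i=1..k. snd (u i) (suffix_prod (\<lambda>i. fst (u i)) i k j)) mod int d = snd (c_ddn d n) j"
        using arg_cong[OF trans[OF op[symmetric] uc(2)], of "\<lambda>z. snd z j"] j by simp
      ultimately show "(\<Sum>i=1..k. snd (un u) (i, suffix_prod (fst (un u)) i k j)) mod int d = snd (c_ddn d n) j" by simp
    qed
    ultimately show "un u \<in> Sigma PP L" by (metis SigmaI prod.collapse)
    show "?w (fst (un u)) (snd (un u)) = (\<Prod>i=1..k. x i ^ dim_fix d n (u i))"
    proof (rule prod.cong[OF refl], goal_cases)
      case i: (1 i)
      let ?C = "cycles_on ?A (fst (u i))"
      have fin: "finite ?C" by (rule finite_cycles_on) simp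
      have p: "fst (u i) permutes ?A" using ui'[OF i] by simp
      have "(\<Prod>C\<in>cycles_on ?A (fst (un u) i). if (\<Sum>j\<in>C. snd (un u) (i, j)) mod int d = 0 then x i else 1)
          = (\<Prod>C\<in>?C. if (\<Sum>j\<in>C. snd (u i) j) mod int d = 0 then x i else 1)"
      proof (rule prod.cong, goal_cases)
        case C: (2 C)
        then have "C \<subseteq> ?A" using cycle_subset[OF permutes_imp_bij[OF p]] unfolding cycles_on_def by blast
        then have "(\<Sum>j\<in>C. snd (un u) (i, j)) = (\<Sum>j\<in>C. snd (u i) j)"
          using i by (intro sum.cong) (auto simp: un_def)
        then show ?case by simp
      qed (use i in \<open>simp add: un_def\<close>)
      also have "\<dots> = x i ^ card {C \<in> ?C. (\<Sum>j\<in>C. snd (u i) j) mod int d = 0}"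
        using fin by (simp add: prod.inter_filter[symmetric])
      also have "card {C \<in> ?C. (\<Sum>j\<in>C. snd (u i) j) mod int d = 0} = dim_fix d n (u i)"
        using dim_fix_eq[OF assms(1) ui[OF i]] by simp
      finally show ?case .
    qed
  next
    fix pa assume "pa \<in> Sigma PP L"
    then obtain p a where pa: "pa = (p, a)" "p \<in> PP" "a \<in> L p" by blast
    have p: "p \<in> {1..k} \<rightarrow>\<^sub>E {p. p permutes ?A}" "perm_prod k p = fst (c_ddn d n)" "\<exists>i\<in>{1..k}. p i n \<noteq> n"
      using pa(2) by (auto simp: PP_def)
    have pi: "p i permutes ?A" if "i \<in> {1..k}" for i using PiE_mem[OF p(1) that] by simp
    have a: "a \<in> {1..k} \<times> ?A \<rightarrow>\<^sub>E ?D" "\<And>i. i \<in> {1..k} \<Longrightarrow> (\<Sum>j\<in>?A. a (i, j)) mod int d = 0"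
      "\<And>j. j \<in> ?A \<Longrightarrow> (\<Sum>i=1..k. a (i, suffix_prod p i k j)) mod int d = snd (c_ddn d n) j"
      using pa(3) unfolding L_def weighted_lifts_def by blast+
    show "un (mk pa) = pa"
    proof -
      have "(\<lambda>i\<in>{1..k}. fst (mk pa i)) = p"
        using p(1) by (auto simp: mk_def pa fun_eq_iff PiE_def extensional_def)
      moreover have "(\<lambda>ij\<in>{1..k} \<times> ?A. snd (mk pa (fst ij)) (snd ij)) = a"
        using a(1) by (auto simp: mk_def pa fun_eq_iff PiE_def extensional_def)
      ultimately show ?thesis by (simp add: un_def pa)
    qed
    let ?b = "\<lambda>i. \<lambda>j\<in>?A. a (i, j)"
    have carr: "(p i, ?b i) \<in> carrier (G_ddn d n)" if i: "i \<in> {1..k}" for i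
    proof -
      have "?b i \<in> ?A \<rightarrow>\<^sub>E ?D" by (rule restrict_PiE_iff[THEN iffD2]) (use a(1) i in \<open>auto simp: PiE_def Pi_def\<close>)
      moreover have "(\<Sum>j\<in>?A. ?b i j) = (\<Sum>j\<in>?A. a (i, j))" by (intro sum.cong) auto
      ultimately show ?thesis using a(2)[OF i] pi[OF i] unfolding mem by simp
    qed
    have mki: "mk pa i = (p i, ?b i)" if "i \<in> {1..k}" for i using that by (simp add: mk_def pa)
    have mkE: "mk pa \<in> {1..k} \<rightarrow>\<^sub>E carrier (G_ddn d n)"
    proof (rule PiE_I)
      show "mk pa i \<in> carrier (G_ddn d n)" if "i \<in> {1..k}" for i using carr[OF that] mki[OF that] by simp
      show "mk pa i = undefined" if "i \<notin> {1..k}" for i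
        unfolding mk_def pa prod.case by (simp only: restrict_apply that if_False)
    qed
    have "ordered_prod (G_ddn d n) k (mk pa) = ordered_prod (G_ddn d n) k (\<lambda>i. (p i, ?b i))"
      unfolding ordered_prod_def by (rule arg_cong[of _ _ "\<lambda>xs. foldr _ xs _"]) (auto simp: mki)
    also have "\<dots> = (perm_prod k p, \<lambda>j\<in>?A. (\<Sum>i=1..k. ?b i (suffix_prod p i k j)) mod int d)"
      by (rule ordered_prod_G_ddn[OF assms(1) carr])
    also have "(\<lambda>j\<in>?A. (\<Sum>i=1..k. ?b i (suffix_prod p i k j)) mod int d) = snd (c_ddn d n)"
    proof
      fix j
      show "(\<lambda>j\<in>?A. (\<Sum>i=1..k. ?b i (suffix_prod p i k j)) mod int d) j = snd (c_ddn d n) j"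
      proof (cases "j \<in> ?A")
        case True
        have "suffix_prod p i k permutes ?A" for i by (rule suffix_prod_permutes) (rule pi)
        then have "suffix_prod p i k j \<in> ?A" for i using permutes_in_image True by metis
        then have "(\<Sum>i=1..k. ?b i (suffix_prod p i k j)) = (\<Sum>i=1..k. a (i, suffix_prod p i k j))"
          by (intro sum.cong refl) (simp only: restrict_apply if_True)
        then show ?thesis using a(3)[OF True] True by (simp only: restrict_apply if_True)
      next
        case False
        then show ?thesis using c_ext[OF False] by (simp only: restrict_apply if_False)
      qed
    qed
    finally have op: "ordered_prod (G_ddn d n) k (mk pa) = c_ddn d n" using p(2) by simp
    have "transitive_on_X d n (mk pa ` {1..k})"
      using transitive_on_X_iff[OF assms PiE_mem[OF mkE] op] p(3) mki by fastforce
    then show "mk pa \<in> TF" unfolding TF_def factorizations_def using mkE op by blast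
  qed
  also have "\<dots> = (\<Sum>p\<in>PP. \<Sum>a\<in>L p. ?w p a)"
    using finPP finL by (simp add: sum.Sigma case_prod_unfold)
  finally show ?thesis unfolding TF_def PP_def L_def .
qed

lemma suffix_prod_0: "suffix_prod u 0 k = perm_prod k u"
  by (induction k) (simp_all add: perm_prod_Suc)

lemma sum_c_ddn:
  assumes "n \<ge> 2"
  shows "(\<Sum>j=1..n. snd (c_ddn d n) j) mod int d = 0"
proof -
  let ?f = "\<lambda>j. if j = n - 1 then 1 else if j = n then - 1 else (0::int)"
  have "(\<Sum>j=1..n. snd (c_ddn d n) j) mod int d = (\<Sum>j=1..n. ?f j mod int d) mod int d"
    by (simp add: c_ddn_def)
  also have "\<dots> = (\<Sum>j=1..n. ?f j) mod int d" by (rule mod_sum_eq)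
  also have "(\<Sum>j=1..n. ?f j) = (\<Sum>j=1..n. (if j = n - 1 then 1 else 0) + (if j = n then - 1 else 0))"
    using assms by (intro sum.cong) auto
  also have "\<dots> = 0" using assms by (simp add: sum.distrib)
  finally show ?thesis by simp
qed

text \<open>Transitivity in the form required by \<open>sum_weighted_lifts\<close>. A function
  invariant under all factors is invariant under their product, hence constant on 1, ..., n - 1, and
  the factor moving n ties \<open>G n\<close> to these values.\<close>

lemma invariant_const:
  assumes "n \<ge> 2" and p: "\<And>i. i \<in> {1..k} \<Longrightarrow> p i permutes {1..n}"
    and c: "perm_prod k p = cycle_of_list [1..<n]" and ex: "\<exists>i\<in>{1..k}. p i n \<noteq> n"
    and G: "\<And>i x. i \<in> {1..k} \<Longrightarrow> x \<in> {1..n} \<Longrightarrow> G (p i x) = G x"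
    and x: "x \<in> {1..n}"
  shows "G x = G 1"
proof -
  let ?c = "cycle_of_list [1..<n]"
  have Gc: "G (?c z) = G z" if "z \<in> {1..n}" for z
    using suffix_prod_invariant[of k p "{1..n}" 0 G z] p G that unfolding suffix_prod_0 c by simp
  have low: "G z = G 1" if z: "z \<in> {1..n - 1}" for z
  proof -
    note b = permutes_imp_bij[OF cycle_of_list_upt_permutes[of n]]
    have "z \<in> cycle_through ?c 1" unfolding cycle_through_def
      using cycle_of_list_upt_funpow[OF z] by (intro range_eqI[of _ _ "z - 1"]) simp
    moreover have "1 \<in> {1..n - 1}" using assms(1) by auto
    moreover have "G (?c t) = G t" if "t \<in> {1..n - 1}" for t by (rule Gc) (use that in auto)
    ultimately show ?thesis using invariant_on_cycle[OF b, of G 1 z] by blast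
  qed
  show ?thesis
  proof (cases "x = n")
    case True
    obtain i where i: "i \<in> {1..k}" "p i n \<noteq> n" using ex by blast
    have "p i n \<in> {1..n}" using permutes_in_image[OF p[OF i(1)], of n] assms(1) by auto
    then have "p i n \<in> {1..n - 1}" using i(2) by auto
    then have "G (p i n) = G 1" by (rule low)
    moreover have "G (p i n) = G n" by (rule G[OF i(1)]) (use x True in simp)
    ultimately show ?thesis using True by simp
  next
    case False
    then have "x \<in> {1..n - 1}" using x by auto
    then show ?thesis by (rule low)
  qed
qed

text \<open>Here e is the inverse of d. With N the total number of cycles, the fibre size
  contributes e^(N+n-1) and the weight sums contribute d^N e^k, so N cancels and the power of d is
  common to all tuples of permutations. The sum over \<open>l < d\<close> encodes one term at y + 1
  and d - 1 terms at y, ready to be expanded.\<close>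

lemma sum_lifts_eval:
  fixes x y :: "nat \<Rightarrow> 'r::comm_ring_1" and e :: 'r
  assumes d: "d > 0" and n: "n \<ge> 2" and p: "p \<in> {1..k} \<rightarrow>\<^sub>E {p. p permutes {1..n}}"
    and c: "perm_prod k p = fst (c_ddn d n)" and ex: "\<exists>i\<in>{1..k}. p i n \<noteq> n"
    and e: "of_nat d * e = 1" and y: "\<And>i. i \<in> {1..k} \<Longrightarrow> x i = 1 + of_nat d * y i"
  shows "(\<Sum>a\<in>weighted_lifts d {1..n} k p (snd (c_ddn d n)).
          \<Prod>i=1..k. \<Prod>C\<in>cycles_on {1..n} (p i). if (\<Sum>j\<in>C. a (i, j)) mod int d = 0 then x i else 1)
    = of_nat d ^ (k * n) * e ^ (n - 1 + k) * (\<Prod>i=1..k. \<Sum>l<d. (y i + of_bool (l = 0)) ^ num_cycles {1..n} (p i))"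
proof -
  let ?A = "{1..n}" and ?N = "\<Sum>i=1..k. num_cycles {1..n} (p i)"
  have pi: "p i permutes ?A" if "i \<in> {1..k}" for i using PiE_mem[OF p that] by simp
  have c': "perm_prod k p = cycle_of_list [1..<n]" using c by (simp add: c_ddn_def)
  have cD: "snd (c_ddn d n) j \<in> {0..<int d}" if "j \<in> ?A" for j using that d by (simp add: c_ddn_def)
  let ?Z = "\<lambda>i. \<Sum>w\<in>cycles_on ?A (p i) \<rightarrow>\<^sub>E {0..<int d}.
          if (\<Sum>C\<in>cycles_on ?A (p i). w C) mod int d = 0 then \<Prod>C\<in>cycles_on ?A (p i). if w C = 0 then x i else 1 else 0"
  obtain F where F: "F * d ^ (?N + card ?A - 1) = d ^ (k * card ?A)"
    and S: "(\<Sum>a\<in>weighted_lifts d ?A k p (snd (c_ddn d n)).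
        \<Prod>i=1..k. \<Prod>C\<in>cycles_on ?A (p i). if (\<Sum>x\<in>C. a (i, x)) mod int d = 0 then x i else 1) = of_nat F * (\<Prod>i=1..k. ?Z i)"
  proof (rule sum_weighted_lifts[of ?A d k p "snd (c_ddn d n)" x, OF _ _ d pi sum_c_ddn[OF n] cD])
    show "finite ?A" "?A \<noteq> {}" using n by auto
    fix G :: "nat \<Rightarrow> (nat \<times> nat set + nat) set" and z z'
    assume G: "\<And>i x. i \<in> {1..k} \<Longrightarrow> x \<in> ?A \<Longrightarrow> G (p i x) = G x" and z: "z \<in> ?A" "z' \<in> ?A"
    note const = invariant_const[where G = G and p = p and k = k and n = n, OF n pi c' ex G]
    show "G z = G z'" using const[OF _ _ _ z(1)] const[OF _ _ _ z(2)] by simp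
  qed blast+
  have pw: "of_nat d ^ m * e ^ m = (1::'r)" for m using e by (simp flip: power_mult_distrib)
  have Z: "?Z i = e * (of_nat d ^ num_cycles ?A (p i) * (\<Sum>l<d. (y i + of_bool (l = 0)) ^ num_cycles ?A (p i)))" if i: "i \<in> {1..k}" for i
  proof -
    let ?c = "num_cycles ?A (p i)"
    have x1: "x i - 1 = of_nat d * y i" "x i - 1 + of_nat d = of_nat d * (y i + 1)" using y[OF i] by (simp_all add: algebra_simps)
    have "of_nat d * ?Z i = (x i - 1 + of_nat d) ^ ?c + (of_nat d - 1) * (x i - 1) ^ ?c"
      using sum_zero_weights[OF finite_cycles_on[of ?A "p i"] d, of 0 "x i"] d by (simp add: num_cycles_def)
    also have "\<dots> = of_nat d ^ ?c * ((y i + 1) ^ ?c + (of_nat d - 1) * y i ^ ?c)"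
      unfolding x1(2) unfolding x1(1) power_mult_distrib by (simp only: distrib_left mult.left_commute)
    also have "(y i + 1) ^ ?c + (of_nat d - 1) * y i ^ ?c = (\<Sum>l<d. (y i + of_bool (l = 0)) ^ ?c)"
    proof -
      obtain d' where d': "d = Suc d'" using d by (cases d) auto
      show ?thesis unfolding d' by (subst sum.lessThan_Suc_shift) simp
    qed
    finally have "e * (of_nat d * ?Z i) = e * (of_nat d ^ ?c * (\<Sum>l<d. (y i + of_bool (l = 0)) ^ ?c))" by (simp only:)
    moreover have "e * (of_nat d * ?Z i) = ?Z i" by (simp only: mult.assoc[symmetric] mult.commute[of e] e mult_1)
    ultimately show ?thesis by simp
  qed
  have "(\<Prod>i=1..k. ?Z i) = (\<Prod>i=1..k. e * (of_nat d ^ num_cycles ?A (p i) * (\<Sum>l<d. (y i + of_bool (l = 0)) ^ num_cycles ?A (p i))))"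
    by (rule prod.cong[OF refl Z])
  also have "\<dots> = e ^ k * (of_nat d ^ ?N * (\<Prod>i=1..k. \<Sum>l<d. (y i + of_bool (l = 0)) ^ num_cycles ?A (p i)))"
    by (simp add: prod.distrib power_sum)
  finally have PZ: "(\<Prod>i=1..k. ?Z i) = \<dots>" .
  have "?N + card ?A - 1 = ?N + (n - 1)" using n by simp
  then have "of_nat F * of_nat d ^ (?N + (n - 1)) = (of_nat d ^ (k * n) :: 'r)"
    using F by (metis of_nat_mult of_nat_power card_atLeastAtMost diff_Suc_1)
  then have "of_nat F * (of_nat d ^ (?N + (n - 1)) * e ^ (?N + (n - 1))) = of_nat d ^ (k * n) * e ^ (?N + (n - 1))"
    by (simp only: mult.assoc[symmetric])
  then have Fe: "of_nat F = of_nat d ^ (k * n) * e ^ (?N + (n - 1))" unfolding pw by simp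
  have "of_nat F * (\<Prod>i=1..k. ?Z i) = of_nat d ^ (k * n) * e ^ (n - 1 + k) * (of_nat d ^ ?N * e ^ ?N) * (\<Prod>i=1..k. \<Sum>l<d. (y i + of_bool (l = 0)) ^ num_cycles ?A (p i))"
    unfolding PZ Fe power_add by (simp only: mult_ac)
  then show ?thesis unfolding S pw by simp
qed

text \<open>Expanding the product gives tuples l that choose \<open>y i + 1\<close> or
  \<open>y i\<close> for each factor. Each of them leads to a factorization sum with marked point n
  and M = {1..n-1}; for fixed s the tuples recombine into a product.\<close>

lemma sum_factorizations_eval:
  fixes x y :: "nat \<Rightarrow> 'r::comm_ring_1" and e :: 'r
  assumes d: "d > 0" and n: "n \<ge> 2" and e: "of_nat d * e = 1"
    and y: "\<And>i. i \<in> {1..k} \<Longrightarrow> x i = 1 + of_nat d * y i"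
  shows "of_nat (fact n) * (\<Sum>u\<in>factorizations d n k. \<Prod>i=1..k. x i ^ dim_fix d n (u i))
    = of_nat d ^ (k * n) * e ^ (n - 1 + k) * (\<Sum>s\<le>n. (-1) ^ s * of_nat (n choose s) *
        (\<Prod>i=1..k. (y i + 1) * content_prod (n - 1) s (y i + 1) + of_nat (d - 1) * (y i * content_prod (n - 1) s (y i))))"
proof -
  let ?Q = "of_nat d ^ (k * n) * e ^ (n - 1 + k)" and ?M = "{1..n - 1}"
  let ?PP = "{p. p \<in> {1..k} \<rightarrow>\<^sub>E {p. p permutes {1..n}} \<and> perm_prod k p = fst (c_ddn d n) \<and> (\<exists>i\<in>{1..k}. p i n \<noteq> n)}"
  let ?E = "{1..k} \<rightarrow>\<^sub>E {..<d}"
  let ?z = "\<lambda>(l :: nat \<Rightarrow> nat) i. y i + of_bool (l i = 0)"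
  have A: "insert n ?M = {1..n}" using n by auto
  have fin: "finite ?E" by (intro finite_PiE) auto
  have M: "finite ?M" "n \<notin> ?M" "?M \<noteq> {}" "card ?M = n - 1" using n by auto
  have sn: "Suc (n - 1) = n" using n by simp
  have c1: "fst (c_ddn d n) permutes ?M" using cycle_of_list_upt_permutes[of n] by (simp add: c_ddn_def)
  have c2: "num_cycles ?M (fst (c_ddn d n)) = 1" using num_cycles_cycle_of_list_upt[OF n] by (simp add: c_ddn_def)
  have "(\<Sum>u\<in>factorizations d n k. \<Prod>i=1..k. x i ^ dim_fix d n (u i))
      = (\<Sum>p\<in>?PP. ?Q * (\<Prod>i=1..k. \<Sum>l<d. (y i + of_bool (l = 0)) ^ num_cycles {1..n} (p i)))"
    unfolding sum_factorizations_lifts[OF d n]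
  proof (rule sum.cong[OF refl], goal_cases)
    case (1 p)
    then have "p \<in> {1..k} \<rightarrow>\<^sub>E {p. p permutes {1..n}}" "perm_prod k p = fst (c_ddn d n)" "\<exists>i\<in>{1..k}. p i n \<noteq> n" by blast+
    from sum_lifts_eval[OF d n this e y]
    show ?case .
  qed
  also have "\<dots> = ?Q * (\<Sum>p\<in>?PP. \<Sum>l\<in>?E. \<Prod>i=1..k. ?z l i ^ num_cycles {1..n} (p i))"
    by (subst sum_distrib_left, intro sum.cong refl arg_cong[of _ _ "\<lambda>z. ?Q * z"] prod_sum_PiE) auto
  also have "(\<Sum>p\<in>?PP. \<Sum>l\<in>?E. \<Prod>i=1..k. ?z l i ^ num_cycles {1..n} (p i)) = (\<Sum>l\<in>?E. factorization_sum n ?M k (?z l) (fst (c_ddn d n)))"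
    unfolding factorization_sum_def A by (rule sum.swap)
  finally have "of_nat (fact n) * (\<Sum>u\<in>factorizations d n k. \<Prod>i=1..k. x i ^ dim_fix d n (u i))
      = ?Q * (\<Sum>l\<in>?E. of_nat (fact n) * factorization_sum n ?M k (?z l) (fst (c_ddn d n)))"
    by (simp only: mult.left_commute sum_distrib_left)
  also have "\<dots> = ?Q * (\<Sum>l\<in>?E. \<Sum>s\<le>n. (-1) ^ s * of_nat (n choose s) * (\<Prod>i=1..k. ?z l i * content_prod (n - 1) s (?z l i)))"
  proof -
    have "of_nat (fact n) * factorization_sum n ?M k z (fst (c_ddn d n))
        = (\<Sum>s\<le>n. (-1) ^ s * of_nat (n choose s) * (\<Prod>i=1..k. z i * content_prod (n - 1) s (z i)))" for z :: "nat \<Rightarrow> 'r"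
      using factorization_sum_single_cycle[OF M(1-3) c1 c2, of k z] unfolding M(4) sn atLeast0AtMost .
    then show ?thesis by (simp only:)
  qed
  also have "(\<Sum>l\<in>?E. \<Sum>s\<le>n. (-1) ^ s * of_nat (n choose s) * (\<Prod>i=1..k. ?z l i * content_prod (n - 1) s (?z l i)))
      = (\<Sum>s\<le>n. (-1) ^ s * of_nat (n choose s) * (\<Sum>l\<in>?E. \<Prod>i=1..k. ?z l i * content_prod (n - 1) s (?z l i)))"
    unfolding sum_distrib_left by (rule sum.swap)
  also have "\<dots> = (\<Sum>s\<le>n. (-1) ^ s * of_nat (n choose s) *
        (\<Prod>i=1..k. (y i + 1) * content_prod (n - 1) s (y i + 1) + of_nat (d - 1) * (y i * content_prod (n - 1) s (y i))))"
  proof (rule sum.cong[OF refl], goal_cases)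
    case (1 s)
    have "(\<Sum>l\<in>?E. \<Prod>i=1..k. ?z l i * content_prod (n - 1) s (?z l i))
       = (\<Prod>i=1..k. \<Sum>l<d. (y i + of_bool (l = 0)) * content_prod (n - 1) s (y i + of_bool (l = 0)))"
      by (rule prod_sum_PiE[symmetric]) auto
    also have "\<dots> = (\<Prod>i=1..k. (y i + 1) * content_prod (n - 1) s (y i + 1) + of_nat (d - 1) * (y i * content_prod (n - 1) s (y i)))"
    proof -
      obtain d' where d': "d = Suc d'" using d by (cases d) auto
      show ?thesis unfolding d' by (subst sum.lessThan_Suc_shift) simp
    qed
    finally show ?case
      by (simp only:)
  qed
  finally show ?thesis .
qed

text \<open>The Vandermonde expansions at y + 1 and at y have the same coefficients, so
  corresponding terms combine into one P with index q = k + 1, by \<open>P_poly_falling\<close>. The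
  factor 1/(n-1)! turns the coefficients into 1/(q-1)! times a binomial that also occurs in
  M.\<close>

lemma content_prod_P_poly:
  fixes y :: "rat mpoly"
  assumes d: "d > 0" and n: "n > 0" and s: "s \<le> n"
  shows "Const (1 / fact (n - 1)) * ((y + 1) * content_prod (n - 1) s (y + 1) + of_nat (d - 1) * (y * content_prod (n - 1) s y))
    = (\<Sum>q=1..n. Const (of_nat ((n - s) choose (n - q))) * (Const (1 / (of_nat d ^ (q - 1) * fact (q - 1))) * P_poly d q (1 + of_nat d * y)))"
proof -
  obtain N where N: "n = Suc N" using n by (cases n) auto
  have s': "s \<le> Suc N" using s N by simp
  let ?h = "\<lambda>k. (y + 1) * falling k y + of_nat (d - 1) * (y * falling k (y - 1))"
  let ?a = "\<lambda>k. of_nat ((N choose k) * fact (N - k)) :: rat mpoly" and ?b = "\<lambda>k. of_nat ((Suc N - s) choose (N - k)) :: rat mpoly"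
  have "(y + 1) * content_prod N s (y + 1) + of_nat (d - 1) * (y * content_prod N s y) = (\<Sum>k\<le>N. ?a k * ?b k * ?h k)"
    unfolding content_prod_expand[OF s'] sum_distrib_left add_diff_cancel_right' sum.distrib[symmetric]
    by (rule sum.cong[OF refl]) (simp add: algebra_simps)
  then have "Const (1 / fact N) * ((y + 1) * content_prod N s (y + 1) + of_nat (d - 1) * (y * content_prod N s y))
     = (\<Sum>k\<le>N. Const (1 / fact N) * (?a k * ?b k * ?h k))" by (simp only: sum_distrib_left)
  also have "\<dots> = (\<Sum>k\<le>N. Const (of_nat ((Suc N - s) choose (N - k))) * (Const (1 / (of_nat d ^ k * fact k)) * P_poly d (Suc k) (1 + of_nat d * y)))"
  proof (rule sum.cong[OF refl], goal_cases)
    case (1 k)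
    then have k: "k \<le> N" by simp
    have "1 / fact N * of_nat ((N choose k) * fact (N - k)) = (1 / fact k :: rat)"
      using k by (simp add: binomial_fact field_simps)
    then have ca: "Const (1 / fact N) * ?a k = Const (1 / fact k)"
      unfolding Const_of_nat[symmetric] Const_mult by (simp only:)
    have cd: "Const (1 / (of_nat d ^ k * fact k)) * of_nat d ^ k = Const (1 / fact k :: rat)"
      unfolding Const_of_nat[symmetric] Const_power Const_mult using d by simp
    have "Const (of_nat ((Suc N - s) choose (N - k))) * (Const (1 / (of_nat d ^ k * fact k)) * P_poly d (Suc k) (1 + of_nat d * y))
       = ?b k * ((Const (1 / (of_nat d ^ k * fact k)) * of_nat d ^ k) * ?h k)"
      unfolding P_poly_falling[OF d] Const_of_nat by (simp only: mult.assoc)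
    also have "\<dots> = Const (1 / fact N) * (?a k * ?b k * ?h k)"
      unfolding cd ca[symmetric] by (simp only: mult_ac)
    finally show ?case ..
  qed
  also have "\<dots> = (\<Sum>q=1..Suc N. Const (of_nat ((Suc N - s) choose (Suc N - q))) * (Const (1 / (of_nat d ^ (q - 1) * fact (q - 1))) * P_poly d q (1 + of_nat d * y)))"
    by (rule sum.reindex_bij_witness[of _ "\<lambda>q. q - 1" Suc]) auto
  finally show ?thesis unfolding N by simp
qed

text \<open>Only exponents between 1 and n contribute, so the sum runs over a box, and for each s it
  factorises over the variables.\<close>

lemma sum_M_coeff:
  fixes g :: "nat \<Rightarrow> nat \<Rightarrow> rat mpoly"
  shows "Sum_any (\<lambda>p. (Const (M_coeff n k p) * (\<Prod>i=1..k. g i (Poly_Mapping.lookup p i)) when Poly_Mapping.keys p = {1..k}))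
    = (\<Sum>s\<le>n. (-1) ^ s * of_nat (n choose s) * (\<Prod>i=1..k. \<Sum>q=1..n. Const (of_nat ((n - s) choose (n - q))) * g i q))"
proof -
  let ?E = "{1..k} \<rightarrow>\<^sub>E {1..n}"
  let ?f = "\<lambda>p. (Const (M_coeff n k p) * (\<Prod>i=1..k. g i (Poly_Mapping.lookup p i)) when Poly_Mapping.keys p = {1..k})"
  have fin: "finite ?E" by (intro finite_PiE) auto
  have lk: "Poly_Mapping.lookup (exponent_vector k q) i = q i" if "i \<in> {1..k}" for q i
    using that by (simp add: lookup_exponent_vector)
  have inj: "inj_on (exponent_vector k) ?E"
  proof (rule inj_onI)
    fix q q' assume q: "q \<in> ?E" "q' \<in> ?E" "exponent_vector k q = exponent_vector k q'"
    show "q = q'"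
    proof (rule PiE_ext[OF q(1,2)])
      fix i assume "i \<in> {1..k}"
      then show "q i = q' i" using lk[of i q] lk[of i q'] q(3) by simp
    qed
  qed
  have keys: "Poly_Mapping.keys (exponent_vector k q) = {1..k}" if "q \<in> ?E" for q
  proof -
    have "q i \<ge> 1" if "i \<in> {1..k}" for i using PiE_mem[OF \<open>q \<in> ?E\<close> that] by simp
    then have "i \<in> Poly_Mapping.keys (exponent_vector k q) \<longleftrightarrow> i \<in> {1..k}" for i
      unfolding in_keys_iff lookup_exponent_vector by (cases "i \<in> {1..k}") fastforce+
    then show ?thesis by blast
  qed
  have "Sum_any ?f = (\<Sum>p\<in>exponent_vector k ` ?E. ?f p)"
  proof (rule Sum_any.expand_superset)
    show "finite (exponent_vector k ` ?E)" using fin by simp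
    show "{p. ?f p \<noteq> 0} \<subseteq> exponent_vector k ` ?E"
    proof
      fix p assume "p \<in> {p. ?f p \<noteq> 0}"
      then have "Poly_Mapping.keys p = {1..k}" "M_coeff n k p \<noteq> 0" by (auto simp: when_def Const_0 split: if_splits)
      moreover have "(\<lambda>i\<in>{1..k}. 0) \<in> {1..k} \<rightarrow>\<^sub>E {..n}" by auto
      ultimately show "p \<in> exponent_vector k ` ?E" using M_coeff_eq(2) by blast
    qed
  qed
  also have "\<dots> = (\<Sum>q\<in>?E. ?f (exponent_vector k q))" by (simp only: sum.reindex[OF inj] comp_def)
  also have "\<dots> = (\<Sum>q\<in>?E. \<Sum>s\<le>n. (-1) ^ s * of_nat (n choose s) * (\<Prod>i=1..k. Const (of_nat ((n - s) choose (n - q i))) * g i (q i)))"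
  proof (rule sum.cong[OF refl], goal_cases)
    case q: (1 q)
    then have q': "q \<in> {1..k} \<rightarrow>\<^sub>E {..n}" by (auto simp: PiE_def Pi_def)
    have "(\<Prod>i=1..k. g i (Poly_Mapping.lookup (exponent_vector k q) i)) = (\<Prod>i=1..k. g i (q i))"
      by (intro prod.cong) (auto simp: lk)
    then have "?f (exponent_vector k q) = Const (M_coeff n k (exponent_vector k q)) * (\<Prod>i=1..k. g i (q i))"
      using keys[OF q] by simp
    also have "\<dots> = (\<Sum>s\<le>n. ((-1) ^ s * of_nat (n choose s) * (\<Prod>i=1..k. Const (of_nat ((n - s) choose (n - q i))))) * (\<Prod>i=1..k. g i (q i)))"
      unfolding M_coeff_eq(1)[OF q'] Const_sum sum_distrib_right
      by (simp only: Const_mult[symmetric] Const_power[symmetric] Const_uminus Const_1 Const_of_nat Const_prod)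
    finally show ?case
      by (simp only: prod.distrib mult.assoc)
  qed
  also have "\<dots> = (\<Sum>s\<le>n. (-1) ^ s * of_nat (n choose s) * (\<Sum>q\<in>?E. \<Prod>i=1..k. Const (of_nat ((n - s) choose (n - q i))) * g i (q i)))"
    unfolding sum_distrib_left by (rule sum.swap)
  also have "\<dots> = (\<Sum>s\<le>n. (-1) ^ s * of_nat (n choose s) * (\<Prod>i=1..k. \<Sum>q=1..n. Const (of_nat ((n - s) choose (n - q))) * g i q))"
    by (subst prod_sum_PiE) auto
  finally show ?thesis .
qed

hide_const (open) Polynomial.order

theorem theorem4p1:
  fixes d n k :: nat
  assumes "d \<ge> 2" and "n \<ge> 2" and "k \<ge> 1"
  shows
    "(Sum_any (\<lambda>r :: nat \<Rightarrow>\<^sub>0 nat.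
        (of_nat (b_coeff d n k r) * (\<Prod>i=1..k. Var i ^ Poly_Mapping.lookup r i)
          when Poly_Mapping.keys r \<subseteq> {1..k})) :: rat mpoly)
     = Const (of_nat (order (G_ddn d n)) ^ (k - 1) / of_nat n ^ k) *
       Sum_any (\<lambda>p :: nat \<Rightarrow>\<^sub>0 nat.
        (Const (M_coeff n k p) *
           (\<Prod>i=1..k. Const (1 / (of_nat d ^ (Poly_Mapping.lookup p i - 1)
                                   * fact (Poly_Mapping.lookup p i - 1)))
                        * P_poly d (Poly_Mapping.lookup p i) (Var i))
          when Poly_Mapping.keys p = {1..k}))"
proof -
  have d: "d > 0" and n: "n > 0" using assms by auto
  \<comment> \<open>The constant polynomial e makes d invertible, and \<open>y i\<close> is the
    variable determined by x_i = 1 + d y_i.\<close>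
  define e :: "rat mpoly" where "e = Const (1 / of_nat d)"
  define y :: "nat \<Rightarrow> rat mpoly" where "y i = e * (Var i - 1)" for i
  have e: "of_nat d * e = 1"
    unfolding e_def Const_of_nat[symmetric] Const_mult using d by (simp add: Const_1)
  have x: "Var i = 1 + of_nat d * y i" for i
  proof -
    have "of_nat d * y i = (of_nat d * e) * (Var i - 1)" unfolding y_def by (simp only: mult.assoc)
    then show ?thesis unfolding e by simp
  qed
  let ?\<gamma> = "\<lambda>s i. (y i + 1) * content_prod (n - 1) s (y i + 1) + of_nat (d - 1) * (y i * content_prod (n - 1) s (y i))"
  let ?S = "\<Sum>s\<le>n. (-1) ^ s * of_nat (n choose s) * (\<Prod>i=1..k. ?\<gamma> s i)"
  let ?L = "Sum_any (\<lambda>r. (of_nat (b_coeff d n k r) * (\<Prod>i=1..k. Var i ^ Poly_Mapping.lookup r i)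
          when Poly_Mapping.keys r \<subseteq> {1..k})) :: rat mpoly"
  let ?R = "Sum_any (\<lambda>p. (Const (M_coeff n k p) *
           (\<Prod>i=1..k. Const (1 / (of_nat d ^ (Poly_Mapping.lookup p i - 1)
                                   * fact (Poly_Mapping.lookup p i - 1)))
                        * P_poly d (Poly_Mapping.lookup p i) (Var i))
          when Poly_Mapping.keys p = {1..k})) :: rat mpoly"
  have "of_nat (fact n) * ?L = of_nat d ^ (k * n) * e ^ (n - 1 + k) * ?S"
    unfolding sum_transitive_factorizations by (rule sum_factorizations_eval[OF d assms(2) e x])
  then have "Const (1 / fact n) * (of_nat (fact n) * ?L) = Const (1 / fact n) * (of_nat d ^ (k * n) * e ^ (n - 1 + k) * ?S)"
    by (simp only:)
  moreover have "Const (1 / fact n) * (of_nat (fact n) * ?L) = ?L"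
    unfolding mult.assoc[symmetric] Const_of_nat[symmetric] Const_mult by (simp add: Const_1)
  ultimately have L: "?L = Const (1 / fact n * (of_nat d ^ (k * n) * (1 / of_nat d) ^ (n - 1 + k))) * ?S"
    unfolding e_def Const_of_nat[symmetric] Const_power Const_mult mult.assoc[symmetric] by simp
  have "?R = (\<Sum>s\<le>n. (-1) ^ s * of_nat (n choose s) * (\<Prod>i=1..k. \<Sum>q=1..n. Const (of_nat ((n - s) choose (n - q))) *
      (Const (1 / (of_nat d ^ (q - 1) * fact (q - 1))) * P_poly d q (Var i))))"
    by (rule sum_M_coeff)
  \<comment> \<open>Here the right-hand side becomes the same sum over s as the left-hand side, up
    to a constant.\<close>
  also have "\<dots> = (\<Sum>s\<le>n. (-1) ^ s * of_nat (n choose s) * (\<Prod>i=1..k. Const (1 / fact (n - 1)) * ?\<gamma> s i))"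
    using content_prod_P_poly[OF d n] x by (intro sum.cong refl) (auto intro!: arg_cong2[of _ _ _ _ "(*)"] prod.cong)
  also have "\<dots> = Const ((1 / fact (n - 1)) ^ k) * ?S"
    unfolding sum_distrib_left by (rule sum.cong) (simp_all add: prod.distrib Const_power mult_ac)
  finally have R: "?R = \<dots>" .
  \<comment> \<open>Comparison of the constants. With n = N + 1 and k = k' + 1 the exponent k n
    equals N k' + N + k, so d^(N k') remains, the power of d in |G|^(k-1). The factorials agree
    since n! = n (n-1)!.\<close>
  have "(1 / fact n * (of_nat d ^ (k * n) * (1 / of_nat d) ^ (n - 1 + k)) :: rat)
      = of_nat (order (G_ddn d n)) ^ (k - 1) / of_nat n ^ k * (1 / fact (n - 1)) ^ k" (is "?l = ?r")
  proof -
    obtain k' where k': "k = Suc k'" using assms(3) by (cases k) auto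
    obtain N where N: "n = Suc N" using n by (cases n) auto
    have "(of_nat d :: rat) ^ (k * n) = of_nat d ^ (N * k') * of_nat d ^ (N + k)"
      unfolding k' N power_add[symmetric] by (rule arg_cong[of _ _ "power (of_nat d)"]) (simp add: algebra_simps)
    then have "?l = of_nat d ^ (N * k') / fact n" using d N by (simp add: power_divide)
    moreover have "?r = of_nat d ^ (N * k') * fact n ^ k' / (of_nat n * fact N) ^ k"
    proof -
      have "(a * f) ^ k' / m ^ k * (1 / g) ^ k = a ^ k' * f ^ k' / (m * g) ^ k" for a f m g :: rat
        by (simp add: power_mult_distrib power_divide)
      from this[of "of_nat d ^ N" "fact n" "of_nat n" "fact N"] show ?thesis
        unfolding order_G_ddn[OF d n] of_nat_mult of_nat_power of_nat_fact power_mult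
        by (simp only: N k' diff_Suc_1)
    qed
    moreover have "of_nat n * fact N = (fact n :: rat)" using N by simp
    moreover have "D * F ^ k' / F ^ Suc k' = D / F" if "F \<noteq> 0" for D F :: rat using that by simp
    ultimately show ?thesis by (simp only: k' fact_nonzero not_False_eq_True simp_thms)
  qed
  then show ?thesis unfolding L R mult.assoc[symmetric] Const_mult by (simp only:)
qed

end
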